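(* Let $H$ be a Hilbert space, and let $A$ be a self-adjoint nonnegative operator on $H$ with dense domain $D(A)$. Assume that the spectrum of $A$ is an increasing unbounded sequence of positive real numbers $\{\lambda_k^2\}_{k\ge 1}$, with $\lambda_k>0$ for every $k\ge 1$. Let $R>0$ be a real number, and let $$t_0:=\pi\sum_{\lambda_k^2\le 2(R+\lambda_1)^2}\frac{1}{\lambda_k},$$ where the sum runs over all indices $k\ge 1$ with $\lambda_k^2\le 2(R+\lambda_1)^2$. Then there exists a $t_0$-periodic function $\delta:[0,+\infty)\to[0,+\infty)$ such that every weak solution $u$ to $$u''(t)+2\delta(t)u'(t)+Au(t)=0$$ satisfies $$|u'(t)|^2+|A^{1/2}u(t)|^2\le\left(|u'(0)|^2+|A^{1/2}u(0)|^2\right)\exp\left(-R\,(t-t_0)^+\right)$$ for every $t\ge 0$. Moreover, $\delta$ can be chosen of class $C^\infty$, and it can alternatively be chosen piecewise constant (i.e. there exist both a $C^\infty$ function $\delta:[0,+\infty)\to[0,+\infty)$ and a piecewise constant function $\delta:[0,+\infty)\to[0,+\infty)$, each of which is $t_0$-periodic and such that every weak solution $u$ to $u''(t)+2\delta(t)u'(t)+Au(t)=0$ satisfies $|u'(t)|^2+|A^{1/2}u(t)|^2\le\left(|u'(0)|^2+|A^{1/2}u(0)|^2\right)\exp\left(-R\,(t-t_0)^+\right)$ for every $t\ge 0$).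
   Context: $(x)^+:=\max\{x,0\}$; $|\cdot|$ is the norm of $H$. The spectrum is regarded as a set, so the $\lambda_k^2$ are distinct eigenvalues listed in increasing order, without counting multiplicities. A weak solution is a function $u\in C^0([0,+\infty),D(A^{1/2}))\cap C^1([0,+\infty),H)$ (with initial data $u(0)\in D(A^{1/2})$, $u'(0)\in H$) satisfying the equation in the usual weak sense: for every $\phi\in D(A^{1/2})$ the function $t\mapsto\langle u'(t),\phi\rangle$ is locally absolutely continuous and $\frac{d}{dt}\langle u'(t),\phi\rangle+2\delta(t)\langle u'(t),\phi\rangle+\langle A^{1/2}u(t),A^{1/2}\phi\rangle=0$ for almost every $t$. Piecewise constant means having finitely many constancy intervals on each bounded interval. *)

theory Defs
  imports "HOL-Analysis.Analysis"
begin

text \<open>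
  An unbounded operator on a Hilbert space is a partial function \<open>A :: 'a \<rightharpoonup> 'a\<close>: its domain is
  \<open>dom A\<close>, its value at \<open>x \<in> dom A\<close> is \<open>the (A x)\<close>, and \<open>B \<circ>\<^sub>m B\<close> is the square of \<open>B\<close> with
  its natural domain. Two operators are equal iff their domains and their values
  on the domain agree.
\<close>

definition linear_operator :: "('a::real_vector \<rightharpoonup> 'a) \<Rightarrow> bool" where
  "linear_operator A \<longleftrightarrow>
     subspace (dom A) \<and>
     (\<forall>x\<in>dom A. \<forall>y\<in>dom A. the (A (x + y)) = the (A x) + the (A y)) \<and>
     (\<forall>c. \<forall>x\<in>dom A. the (A (c *\<^sub>R x)) = c *\<^sub>R the (A x))"

text \<open>For a densely defined operator the vector \<open>z\<close> below is unique if it exists.\<close>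

definition adjoint_operator :: "('a::real_inner \<rightharpoonup> 'a) \<Rightarrow> ('a \<rightharpoonup> 'a)" where
  "adjoint_operator A y =
     (if \<exists>z. \<forall>x\<in>dom A. the (A x) \<bullet> y = x \<bullet> z
      then Some (THE z. \<forall>x\<in>dom A. the (A x) \<bullet> y = x \<bullet> z)
      else None)"

definition selfadjoint_operator :: "('a::real_inner \<rightharpoonup> 'a) \<Rightarrow> bool" where
  "selfadjoint_operator A \<longleftrightarrow>
     linear_operator A \<and> closure (dom A) = UNIV \<and> adjoint_operator A = A"

definition nonneg_operator :: "('a::real_inner \<rightharpoonup> 'a) \<Rightarrow> bool" where
  "nonneg_operator A \<longleftrightarrow> (\<forall>x\<in>dom A. 0 \<le> the (A x) \<bullet> x)"

definition resolvent_set :: "('a::real_normed_vector \<rightharpoonup> 'a) \<Rightarrow> real set" where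
  "resolvent_set A =
     {\<mu>. bij_betw (\<lambda>x. the (A x) - \<mu> *\<^sub>R x) (dom A) UNIV \<and>
         bounded_linear (inv_into (dom A) (\<lambda>x. the (A x) - \<mu> *\<^sub>R x))}"

text \<open>Only real spectral values are considered: it is applied to self-adjoint operators only.\<close>

definition spectrum :: "('a::real_normed_vector \<rightharpoonup> 'a) \<Rightarrow> real set" where
  "spectrum A = - resolvent_set A"

text \<open>\<open>A\<^sup>1\<^sup>/\<^sup>2\<close>: the unique nonnegative self-adjoint square root of a nonnegative self-adjoint \<open>A\<close>.\<close>

definition operator_sqrt :: "('a::real_inner \<rightharpoonup> 'a) \<Rightarrow> ('a \<rightharpoonup> 'a)" where
  "operator_sqrt A =
     (THE B. selfadjoint_operator B \<and> nonneg_operator B \<and> B \<circ>\<^sub>m B = A)"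

definition abs_continuous_on_Icc :: "real \<Rightarrow> real \<Rightarrow> (real \<Rightarrow> real) \<Rightarrow> bool" where
  "abs_continuous_on_Icc c d f \<longleftrightarrow>
     (\<forall>\<epsilon>>0. \<exists>\<eta>>0. \<forall>P.
        finite P \<and> (\<forall>(a, b)\<in>P. c \<le> a \<and> a \<le> b \<and> b \<le> d) \<and>
        disjoint_family_on (\<lambda>(a, b). {a<..<b}) P \<and> (\<Sum>(a, b)\<in>P. b - a) < \<eta>
        \<longrightarrow> (\<Sum>(a, b)\<in>P. \<bar>f b - f a\<bar>) < \<epsilon>)"

text \<open>
  \<open>u\<close> is a weak solution of \<open>u'' + 2 \<delta> u' + A u = 0\<close> on \<open>[0,\<infinity>)\<close> and \<open>u'\<close> is its derivative.
  The space \<open>D(A\<^sup>1\<^sup>/\<^sup>2)\<close> carries the graph norm, so that continuity of \<open>u\<close> with values in it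
  means continuity in \<open>'a\<close> of both \<open>u\<close> and \<open>A\<^sup>1\<^sup>/\<^sup>2 u\<close>.
\<close>

definition weak_solution ::
  "('a::real_inner \<rightharpoonup> 'a) \<Rightarrow> (real \<Rightarrow> real) \<Rightarrow> (real \<Rightarrow> 'a) \<Rightarrow> (real \<Rightarrow> 'a) \<Rightarrow> bool" where
  "weak_solution A \<delta> u u' \<longleftrightarrow>
     (\<forall>t\<ge>0. u t \<in> dom (operator_sqrt A)) \<and>
     continuous_on {0..} u \<and>
     continuous_on {0..} (\<lambda>t. the (operator_sqrt A (u t))) \<and>
     (\<forall>t\<ge>0. (u has_vector_derivative u' t) (at t within {0..})) \<and>
     continuous_on {0..} u' \<and>
     (\<forall>\<phi>\<in>dom (operator_sqrt A).
        (\<forall>T>0. abs_continuous_on_Icc 0 T (\<lambda>t. u' t \<bullet> \<phi>)) \<and>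
        (AE t in lebesgue. 0 \<le> t \<longrightarrow>
           (\<exists>d. ((\<lambda>s. u' s \<bullet> \<phi>) has_real_derivative d) (at t within {0..}) \<and>
                d + 2 * \<delta> t * (u' t \<bullet> \<phi>)
                  + the (operator_sqrt A (u t)) \<bullet> the (operator_sqrt A \<phi>) = 0)))"

definition energy ::
  "('a::real_inner \<rightharpoonup> 'a) \<Rightarrow> (real \<Rightarrow> 'a) \<Rightarrow> (real \<Rightarrow> 'a) \<Rightarrow> real \<Rightarrow> real" where
  "energy A u u' t = (norm (u' t))\<^sup>2 + (norm (the (operator_sqrt A (u t))))\<^sup>2"

text \<open>Functions on \<open>[0,\<infinity>)\<close> are total functions whose values at negative arguments are irrelevant;
  derivatives at \<open>0\<close> are one-sided.\<close>

definition smooth_on_halfline :: "(real \<Rightarrow> real) \<Rightarrow> bool" where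
  "smooth_on_halfline f \<longleftrightarrow>
     (\<exists>D. D 0 = f \<and>
        (\<forall>n::nat. \<forall>t\<ge>0. (D n has_real_derivative D (Suc n) t) (at t within {0..})))"

definition piecewise_constant_on_halfline :: "(real \<Rightarrow> real) \<Rightarrow> bool" where
  "piecewise_constant_on_halfline f \<longleftrightarrow>
     (\<forall>T>0. \<exists>P. finite P \<and> partition_on {0..T} P \<and>
        (\<forall>I\<in>P. is_interval I \<and> f constant_on I))"

definition periodic_on_halfline :: "real \<Rightarrow> (real \<Rightarrow> real) \<Rightarrow> bool" where
  "periodic_on_halfline p f \<longleftrightarrow> (\<forall>t\<ge>0. f (t + p) = f t)"

end

theory Submission
  imports Defs
begin

text \<open>
  Since the spectrum is discrete, the space is the orthogonal sum of the eigenspaces of \<open>A\<close>, so that the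
  energy is the sum of the energies of independent damped oscillators of frequencies \<open>\<lambda>\<^sub>k\<close>, and each of
  them has to lose a factor \<open>exp (- R t\<^sub>0)\<close> per period. A short and strong pulse of damping
  annihilates the kinetic energy of an oscillator, after the time \<open>\<pi> / (2 \<lambda>\<^sub>k)\<close> without damping the
  potential energy has become kinetic, and a second pulse annihilates it as well. One pulse at each
  end of consecutive waiting times \<open>\<pi> / (2 \<lambda>\<^sub>k)\<close> treats all the low frequencies within half of the
  period. In the other half the constant damping \<open>D = R + \<lambda>\<^sub>1\<close> acts on the frequencies above
  \<open>\<surd>2 D\<close>, whose energy decays like \<open>exp (- 2 D t)\<close> up to a constant, which is absorbed by the
  factor \<open>exp (- \<lambda>\<^sub>1 t\<^sub>0) \<le> exp (- \<pi>)\<close>.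
\<close>

section \<open>Eigenvectors of a self-adjoint operator with isolated spectrum\<close>

text \<open>Eigenvalues may have infinite multiplicity and one damping must serve all solutions.
  Contraction is therefore proved for every scalar triple obeying \<open>damped_mode\<close>, the
  system satisfied by the squared norms and the inner product of the components in one eigenspace,
  whatever its dimension. Pulses can be tuned to finitely many frequencies only, so all others must
  share one constant damping \<open>D\<close>. Above the threshold \<open>l^2 > 2 D^2\<close> the
  ratio \<open>D / l\<close> stays below \<open>1 / sqrt 2\<close>, which makes the comparison
  constants uniform in \<open>l\<close>. Since energy never increases, a frequency may ignore
  whatever happens outside its own window. The pulses lengthen the first half of the period
  slightly; this costs at most 1 in the exponent, and the comparison constant 6 costs less than 2.
  Both are paid for by the slack \<pi> > 3. The equation is given only weakly and almost everywhere.
  Tested with eigenvectors and integrated, it becomes classical wherever \<delta> is continuous,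
  that is, off finitely many points of each bounded interval.\<close>

lemma adjoint_operator_eq_Some_iff:
  fixes A :: "'a::real_inner \<rightharpoonup> 'a"
  assumes "closure (dom A) = UNIV"
  shows "adjoint_operator A y = Some z \<longleftrightarrow> (\<forall>x\<in>dom A. the (A x) \<bullet> y = x \<bullet> z)"
proof -
  have unique: "z = w" if "\<forall>x\<in>dom A. the (A x) \<bullet> y = x \<bullet> z" "\<forall>x\<in>dom A. the (A x) \<bullet> y = x \<bullet> w" for z w
  proof -
    have "closed {x. x \<bullet> (z - w) = 0}"
      by (intro closed_Collect_eq continuous_intros)
    moreover have "dom A \<subseteq> {x. x \<bullet> (z - w) = 0}"
      using that by (simp add: subset_iff inner_diff_right)
    ultimately have "closure (dom A) \<subseteq> {x. x \<bullet> (z - w) = 0}"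
      by (simp add: closure_minimal)
    then have "(z - w) \<bullet> (z - w) = 0" using assms by blast
    then show ?thesis by simp
  qed
  show ?thesis
  proof (cases "\<exists>z. \<forall>x\<in>dom A. the (A x) \<bullet> y = x \<bullet> z")
    case True
    then obtain w where w: "\<forall>x\<in>dom A. the (A x) \<bullet> y = x \<bullet> w" by blast
    then have "(THE z. \<forall>x\<in>dom A. the (A x) \<bullet> y = x \<bullet> z) = w" using unique by (intro the_equality)
    then have "adjoint_operator A y = Some w" unfolding adjoint_operator_def using True by (simp only: if_True)
    then show ?thesis using w unique by auto
  next
    case False
    then show ?thesis unfolding adjoint_operator_def by auto
  qed
qed

lemma subspace_closure:
  fixes S :: "'a::real_normed_vector set"
  assumes "subspace S"
  shows "subspace (closure S)"
proof (rule subspaceI)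
  show "0 \<in> closure S" using subspace_0[OF assms] closure_subset by blast
  show "x + y \<in> closure S" if "x \<in> closure S" "y \<in> closure S" for x y
  proof -
    obtain f where f: "(\<forall>n. f n \<in> S) \<and> f \<longlonglongrightarrow> x" using \<open>x \<in> closure S\<close> unfolding closure_sequential ..
    obtain g where g: "(\<forall>n. g n \<in> S) \<and> g \<longlonglongrightarrow> y" using \<open>y \<in> closure S\<close> unfolding closure_sequential ..
    have "(\<forall>n. f n + g n \<in> S) \<and> (\<lambda>n. f n + g n) \<longlonglongrightarrow> x + y"
      using f g subspace_add[OF assms] by (auto intro: tendsto_add)
    then show ?thesis unfolding closure_sequential by (rule exI[of _ "\<lambda>n. f n + g n"])
  qed
  show "c *\<^sub>R x \<in> closure S" if "x \<in> closure S" for c x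
  proof -
    obtain f where f: "(\<forall>n. f n \<in> S) \<and> f \<longlonglongrightarrow> x" using \<open>x \<in> closure S\<close> unfolding closure_sequential ..
    then have "(\<forall>n. c *\<^sub>R f n \<in> S) \<and> (\<lambda>n. c *\<^sub>R f n) \<longlonglongrightarrow> c *\<^sub>R x"
      using subspace_scale[OF assms] by (auto intro: tendsto_intros)
    then show ?thesis unfolding closure_sequential by (rule exI[of _ "\<lambda>n. c *\<^sub>R f n"])
  qed
qed

text \<open>A minimizing sequence of the distance is Cauchy by the parallelogram law, because
  midpoints stay in \<open>S\<close>; completeness gives the minimizer.\<close>

lemma exists_orthogonal_projection:
  fixes S :: "'a::{real_inner,complete_space} set"
  assumes "subspace S" "closed S"
  shows "\<exists>p\<in>S. \<forall>s\<in>S. (x - p) \<bullet> s = 0"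
proof -
  define d where "d = (INF s\<in>S. (norm (x - s))\<^sup>2)"
  have ne: "S \<noteq> {}" using assms(1) subspace_0 by blast
  have bdd: "bdd_below ((\<lambda>s. (norm (x - s))\<^sup>2) ` S)" by (rule bdd_belowI2[of _ 0]) simp
  have d_le: "d \<le> (norm (x - s))\<^sup>2" if "s \<in> S" for s
    unfolding d_def by (rule cINF_lower[OF bdd that])
  have "\<exists>s\<in>S. (norm (x - s))\<^sup>2 < d + 1 / (real n + 1)" for n :: nat
  proof -
    have "d < d + 1 / (real n + 1)" by simp
    then show ?thesis unfolding d_def using cINF_less_iff[OF ne bdd] by blast
  qed
  then obtain f where f: "\<And>n. f n \<in> S" "\<And>n. (norm (x - f n))\<^sup>2 < d + 1 / (real n + 1)" by metis
  have par: "(norm (f m - f n))\<^sup>2 \<le> 2 / (real m + 1) + 2 / (real n + 1)" for m n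
  proof -
    have mid: "(1/2) *\<^sub>R (f m + f n) \<in> S"
      using f(1) assms(1) by (simp add: subspace_add subspace_scale)
    have "(norm (f m - f n))\<^sup>2 = 2 * (norm (x - f m))\<^sup>2 + 2 * (norm (x - f n))\<^sup>2
        - 4 * (norm (x - (1/2) *\<^sub>R (f m + f n)))\<^sup>2"
      by (simp add: power2_norm_eq_inner inner_diff inner_add algebra_simps inner_commute)
    moreover have "2 * (norm (x - f m))\<^sup>2 + 2 * (norm (x - f n))\<^sup>2
        - 4 * (norm (x - (1/2) *\<^sub>R (f m + f n)))\<^sup>2 \<le> 2 * (d + 1 / (real m + 1)) + 2 * (d + 1 / (real n + 1)) - 4 * d"
      using d_le[OF mid] less_imp_le[OF f(2)[of m]] less_imp_le[OF f(2)[of n]]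
      by (intro diff_mono add_mono) auto
    ultimately show ?thesis by (simp add: algebra_simps)
  qed
  have "Cauchy f"
  proof (rule metric_CauchyI)
    fix e :: real assume e: "0 < e"
    obtain M where M: "inverse (of_nat (Suc M)) < e\<^sup>2 / 4"
      using reals_Archimedean[of "e\<^sup>2 / 4"] e by auto
    have "dist (f m) (f n) < e" if "m \<ge> M" "n \<ge> M" for m n
    proof -
      have "1 / (real m + 1) \<le> inverse (of_nat (Suc M))" "1 / (real n + 1) \<le> inverse (of_nat (Suc M))"
        using that by (auto simp: field_simps)
      then have "(norm (f m - f n))\<^sup>2 < e\<^sup>2" using par[of m n] M by linarith
      then show ?thesis using e by (simp add: dist_norm power2_less_imp_less)
    qed
    then show "\<exists>M. \<forall>m\<ge>M. \<forall>n\<ge>M. dist (f m) (f n) < e" by blast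
  qed
  then obtain p where p: "f \<longlonglongrightarrow> p" using Cauchy_convergent convergent_def by blast
  have pS: "p \<in> S" using closed_sequentially[OF assms(2) _ p] f(1) by blast
  have "(\<lambda>n. (norm (x - f n))\<^sup>2) \<longlonglongrightarrow> (norm (x - p))\<^sup>2" by (intro tendsto_intros p)
  moreover have "(\<lambda>n. d + 1 / (real n + 1)) \<longlonglongrightarrow> d + 0"
    by (intro tendsto_intros LIMSEQ_inverse_real_of_nat[unfolded inverse_eq_divide, simplified add.commute])
       (use LIMSEQ_inverse_real_of_nat in \<open>simp add: inverse_eq_divide add.commute\<close>)
  ultimately have pd: "(norm (x - p))\<^sup>2 \<le> d"
    using LIMSEQ_le f(2) by (metis (no_types, lifting) add.right_neutral less_imp_le)
  have "(x - p) \<bullet> s = 0" if s: "s \<in> S" for s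
  proof (cases "s = 0")
    case False
    \<comment> \<open>This \<open>r\<close> minimizes the quadratic function
      \<open>r \<mapsto> |x - (p + r s)|^2\<close>, so a nonzero inner product would beat the
      minimal distance.\<close>
    define r where "r = ((x - p) \<bullet> s) / (s \<bullet> s)"
    have ss: "s \<bullet> s > 0" using False by simp
    have "p + r *\<^sub>R s \<in> S" using pS s assms(1) by (simp add: subspace_add subspace_scale)
    then have "(norm (x - p))\<^sup>2 \<le> (norm (x - (p + r *\<^sub>R s)))\<^sup>2" using d_le pd order_trans by blast
    also have "\<dots> = (norm (x - p))\<^sup>2 - 2 * r * ((x - p) \<bullet> s) + r * r * (s \<bullet> s)"
      by (simp add: power2_norm_eq_inner inner_diff inner_add algebra_simps inner_commute)
    also have "\<dots> = (norm (x - p))\<^sup>2 - ((x - p) \<bullet> s)\<^sup>2 / (s \<bullet> s)"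
      using ss by (simp add: r_def power2_eq_square field_simps)
    finally have "((x - p) \<bullet> s)\<^sup>2 / (s \<bullet> s) \<le> 0" by simp
    then show ?thesis using ss by (simp add: divide_le_0_iff)
  qed simp
  then show ?thesis using pS by blast
qed

text \<open>On \<open>N\<close> the operator \<open>M = m - T\<close> satisfies 0 <= M <= m as a
  form, hence \<open>M^2 <= m M\<close>. No root of \<open>M\<close> is used: positivity of
  \<open>M\<close> is tested at \<open>w = x - (1/m) M x\<close>, where
  \<open>M w = (1/m) T (M x)\<close>.\<close>

lemma symmetric_form_upper_bound:
  fixes T :: "'a::real_inner \<Rightarrow> 'a"
  assumes "linear T" "subspace N" and TN: "\<And>x. x \<in> N \<Longrightarrow> T x \<in> N"
    and sym: "\<And>x y. T x \<bullet> y = x \<bullet> T y" and nonneg: "\<And>x. 0 \<le> T x \<bullet> x"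
    and le: "\<And>x. x \<in> N \<Longrightarrow> T x \<bullet> x \<le> m * (norm x)\<^sup>2" and "m > 0" "x \<in> N"
  shows "(norm (m *\<^sub>R x - T x))\<^sup>2 \<le> m * (m * (norm x)\<^sup>2 - T x \<bullet> x)"
proof -
  interpret linear T by fact
  define y where "y = m *\<^sub>R x - T x"
  define w where "w = x - (1/m) *\<^sub>R y"
  have y: "y \<in> N" unfolding y_def using assms by (simp add: subspace_diff subspace_scale)
  have "w \<in> N" unfolding w_def using assms y by (simp add: subspace_diff subspace_scale)
  then have "0 \<le> m * (norm w)\<^sup>2 - T w \<bullet> w" using le by simp
  also have "\<dots> = (m *\<^sub>R w - T w) \<bullet> w"
    by (simp add: power2_norm_eq_inner inner_diff)
  also have "m *\<^sub>R w - T w = (1/m) *\<^sub>R T y"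
    unfolding w_def using \<open>m > 0\<close> by (simp add: diff scale scaleR_diff_right) (simp add: y_def)
  also have "\<dots> \<bullet> w = (1/m) * (y \<bullet> T x) - (1/m) * ((1/m) * (T y \<bullet> y))"
    unfolding w_def using sym[of y x] by (simp add: inner_diff_right diff_divide_distrib)
  also have "T x = m *\<^sub>R x - y" by (simp add: y_def)
  finally have "0 \<le> (1/m) * (y \<bullet> (m *\<^sub>R x - y)) - (1/m) * ((1/m) * (T y \<bullet> y))" .
  moreover have "0 \<le> (1/m) * ((1/m) * (T y \<bullet> y))" using \<open>m > 0\<close> nonneg[of y] by simp
  ultimately have "0 \<le> (1/m) * (y \<bullet> (m *\<^sub>R x - y))" by linarith
  then have "y \<bullet> y \<le> m * (y \<bullet> x)"
    using \<open>m > 0\<close> by (simp add: inner_diff_right zero_le_divide_iff)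
  then show ?thesis unfolding y_def by (simp add: power2_norm_eq_inner inner_diff inner_commute)
qed

text \<open>If the bound \<open>m\<close> of a nonnegative symmetric form is optimal, then \<open>m\<close> is an approximate
  eigenvalue.\<close>

lemma symmetric_form_bound_improves:
  fixes T :: "'a::real_inner \<Rightarrow> 'a"
  assumes "linear T" "subspace N" and TN: "\<And>x. x \<in> N \<Longrightarrow> T x \<in> N"
    and sym: "\<And>x y. T x \<bullet> y = x \<bullet> T y" and nonneg: "\<And>x. 0 \<le> T x \<bullet> x"
    and le: "\<And>x. x \<in> N \<Longrightarrow> T x \<bullet> x \<le> m * (norm x)\<^sup>2" and m: "m > 0"
    and \<kappa>: "\<kappa> > 0" and lower: "\<And>x. x \<in> N \<Longrightarrow> \<kappa> * norm (T x) \<le> norm (m *\<^sub>R x - T x)"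
  shows "\<exists>m'<m. \<forall>x\<in>N. T x \<bullet> x \<le> m' * (norm x)\<^sup>2"
proof -
  \<comment> \<open>Combining \<open>m |x| <= |m x - T x| + |T x|\<close> with the hypothesis
    \<open>lower\<close> gives \<open>q |x| <= |m x - T x|\<close> for exactly this
    \<open>q\<close>.\<close>
  define q where "q = m * \<kappa> / (1 + \<kappa>)"
  have q: "q > 0" unfolding q_def using m \<kappa> by simp
  have "T x \<bullet> x \<le> (m - q\<^sup>2 / m) * (norm x)\<^sup>2" if x: "x \<in> N" for x
  proof -
    have "m * norm x \<le> norm (m *\<^sub>R x - T x) + norm (T x)"
      using norm_triangle_ineq[of "m *\<^sub>R x - T x" "T x"] m by simp
    then have "\<kappa> * (m * norm x) \<le> \<kappa> * norm (m *\<^sub>R x - T x) + norm (m *\<^sub>R x - T x)"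
      using lower[OF x] \<kappa> mult_left_mono[of "m * norm x" "norm (m *\<^sub>R x - T x) + norm (T x)" \<kappa>]
      by (simp add: distrib_left)
    then have "q * norm x \<le> norm (m *\<^sub>R x - T x)"
      unfolding q_def using \<kappa> by (simp add: field_simps)
    then have "(q * norm x)\<^sup>2 \<le> (norm (m *\<^sub>R x - T x))\<^sup>2"
      using q by (intro power_mono) auto
    also have "\<dots> \<le> m * (m * (norm x)\<^sup>2 - T x \<bullet> x)"
      by (rule symmetric_form_upper_bound[OF assms(1-7) x])
    finally show ?thesis using m by (simp add: field_simps power2_eq_square)
  qed
  moreover have "m - q\<^sup>2 / m < m" using m q by simp
  ultimately show ?thesis by blast
qed

section \<open>Eigenspaces, resolvents and spectral gaps of a self-adjoint operator\<close>

locale selfadjoint_op =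
  fixes A :: "'a::{real_inner,complete_space} \<rightharpoonup> 'a"
  assumes selfadjoint: "selfadjoint_operator A"
begin

abbreviation op :: "'a \<Rightarrow> 'a" where "op x \<equiv> the (A x)"

text \<open>The eigenvector equation is moved to the other side of the inner product. In this form
  closedness is immediate, and self-adjointness puts the vectors into the domain
  (\<open>eigenspace_iff\<close>).\<close>

definition eigenspace :: "real \<Rightarrow> 'a set" where
  "eigenspace \<mu> = {x. \<forall>y\<in>dom A. op y \<bullet> x = y \<bullet> (\<mu> *\<^sub>R x)}"

lemma dom_subspace: "subspace (dom A)"
  and op_add: "x \<in> dom A \<Longrightarrow> y \<in> dom A \<Longrightarrow> op (x + y) = op x + op y"
  and op_scale: "x \<in> dom A \<Longrightarrow> op (c *\<^sub>R x) = c *\<^sub>R op x"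
  and dom_dense: "closure (dom A) = UNIV"
  and adjoint: "adjoint_operator A = A"
  using selfadjoint unfolding selfadjoint_operator_def linear_operator_def by auto

lemma op_diff: "x \<in> dom A \<Longrightarrow> y \<in> dom A \<Longrightarrow> op (x - y) = op x - op y"
  using op_add[of x "(-1) *\<^sub>R y"] op_scale[of y "-1"] dom_subspace
  by (simp add: subspace_neg)

lemma eq_Some_iff: "A y = Some z \<longleftrightarrow> (\<forall>x\<in>dom A. op x \<bullet> y = x \<bullet> z)"
  using adjoint_operator_eq_Some_iff[OF dom_dense] adjoint by simp

lemma op_sym: "x \<in> dom A \<Longrightarrow> y \<in> dom A \<Longrightarrow> op x \<bullet> y = x \<bullet> op y"
  using eq_Some_iff[of y "op y"] by (auto simp: domIff)

lemma eigenspace_iff: "x \<in> eigenspace \<mu> \<longleftrightarrow> A x = Some (\<mu> *\<^sub>R x)"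
  unfolding eigenspace_def eq_Some_iff by simp

lemma eigenspace_subspace: "subspace (eigenspace \<mu>)"
  unfolding subspace_def eigenspace_def by (simp add: inner_add_right algebra_simps)

lemma eigenspace_closed: "closed (eigenspace \<mu>)"
proof -
  have "eigenspace \<mu> = (\<Inter>y\<in>dom A. {x. op y \<bullet> x = y \<bullet> (\<mu> *\<^sub>R x)})"
    unfolding eigenspace_def by auto
  then show ?thesis by (auto intro!: closed_INT closed_Collect_eq continuous_intros)
qed

lemma eigenspace_orthogonal:
  assumes "x \<in> eigenspace \<mu>" "y \<in> eigenspace \<nu>" "\<mu> \<noteq> \<nu>"
  shows "x \<bullet> y = 0"
proof -
  have "\<mu> * (x \<bullet> y) = \<nu> * (x \<bullet> y)"
    using op_sym[of x y] assms(1,2) unfolding eigenspace_iff by (auto simp: domIff)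
  then show ?thesis using assms(3) by simp
qed

definition res :: "real \<Rightarrow> 'a \<Rightarrow> 'a" where
  "res \<mu> = inv_into (dom A) (\<lambda>x. op x - \<mu> *\<^sub>R x)"

context
  fixes \<mu> assumes \<mu>: "\<mu> \<in> resolvent_set A"
begin

lemma res_linear: "bounded_linear (res \<mu>)"
  and res_dom: "res \<mu> x \<in> dom A"
  and op_res: "op (res \<mu> x) - \<mu> *\<^sub>R res \<mu> x = x"
  and res_op: "z \<in> dom A \<Longrightarrow> res \<mu> (op z - \<mu> *\<^sub>R z) = z"
proof -
  have bij: "bij_betw (\<lambda>x. op x - \<mu> *\<^sub>R x) (dom A) UNIV"
    and bl: "bounded_linear (inv_into (dom A) (\<lambda>x. op x - \<mu> *\<^sub>R x))"
    using \<mu> unfolding resolvent_set_def by auto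
  show "bounded_linear (res \<mu>)" using bl unfolding res_def .
  show "res \<mu> x \<in> dom A" unfolding res_def
    using bij by (metis UNIV_I bij_betw_imp_surj_on inv_into_into)
  show "op (res \<mu> x) - \<mu> *\<^sub>R res \<mu> x = x" unfolding res_def
    using bij_betw_inv_into_right[OF bij, of x] by simp
  show "z \<in> dom A \<Longrightarrow> res \<mu> (op z - \<mu> *\<^sub>R z) = z" unfolding res_def
    using bij_betw_inv_into_left[OF bij, of z] by simp
qed

lemma res_sym: "res \<mu> x \<bullet> y = x \<bullet> res \<mu> y"
proof -
  have "res \<mu> x \<bullet> y = res \<mu> x \<bullet> (op (res \<mu> y) - \<mu> *\<^sub>R res \<mu> y)" by (simp add: op_res)
  also have "\<dots> = (op (res \<mu> x) - \<mu> *\<^sub>R res \<mu> x) \<bullet> res \<mu> y"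
    using op_sym[OF res_dom res_dom] by (simp add: inner_diff inner_diff_right)
  finally show ?thesis by (simp add: op_res)
qed

lemma res_lower_bound: "\<exists>\<kappa>>0. \<forall>z\<in>dom A. \<kappa> * norm z \<le> norm (op z - \<mu> *\<^sub>R z)"
proof -
  obtain K where K: "K > 0" "\<And>x. norm (res \<mu> x) \<le> norm x * K"
    using bounded_linear.pos_bounded[OF res_linear] by blast
  have "(1 / K) * norm z \<le> norm (op z - \<mu> *\<^sub>R z)" if "z \<in> dom A" for z
    using K(2)[of "op z - \<mu> *\<^sub>R z"] res_op[OF that] K(1) by (simp add: field_simps)
  then show ?thesis using K(1) by (intro exI[of _ "1 / K"]) auto
qed

end

text \<open>With \<open>G\<close> the resolvent at \<open>c\<close> and \<open>L\<close> its norm, the bound \<open>L\<^sup>2\<close> of the form of \<open>G\<^sup>2\<close> is optimal,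
  so that \<open>L\<^sup>2 - G\<^sup>2 = (L - G) (L + G)\<close> is not bounded below and \<open>c + 1/L\<close> or \<open>c - 1/L\<close> is in the
  spectrum.\<close>

lemma norm_ge_distance_to_spectrum:
  assumes d: "{c - d<..<c + d} \<subseteq> resolvent_set A" and z: "z \<in> dom A" and "d > 0"
  shows "d * norm z \<le> norm (op z - c *\<^sub>R z)"
proof -
  have c: "c \<in> resolvent_set A" using d \<open>d > 0\<close> by auto
  define G where "G = res c"
  define L where "L = onorm G"
  interpret G: bounded_linear G unfolding G_def by (rule res_linear[OF c])
  have GL: "norm (G x) \<le> L * norm x" for x unfolding L_def by (rule onorm[OF G.bounded_linear])
  have "L \<ge> 0" unfolding L_def by (rule onorm_pos_le[OF G.bounded_linear])
  have Gz: "G (op z - c *\<^sub>R z) = z" unfolding G_def by (rule res_op[OF c z])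
  have "L * d \<le> 1"
  proof (rule ccontr)
    assume "\<not> L * d \<le> 1"
    then have Ld: "L * d > 1" by simp
    then have L: "L > 0" using \<open>L \<ge> 0\<close> \<open>d > 0\<close> by (cases "L = 0") auto
    then have dL: "1 / L < d" using Ld by (simp add: field_simps)
    \<comment> \<open>The point \<open>c + s / L\<close> has distance \<open>1 / L < d\<close> from
      \<open>c\<close>, hence lies in the resolvent set. Applied to \<open>G y\<close>, the operator
      \<open>A - (c + s / L)\<close> yields \<open>(1/L) (L y - s G y)\<close>, so its lower bound
      transfers to \<open>L - s G\<close>.\<close>
    have shifted: "\<exists>\<kappa>>0. \<forall>y. \<kappa> * norm (G y) \<le> norm (L *\<^sub>R y - s *\<^sub>R G y)" if s: "s = 1 \<or> s = -1" for s :: real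
    proof -
      have "- d < 1 / L" "1 / L > 0" using L \<open>d > 0\<close> by (auto intro: less_trans[of _ 0])
      then have "c + 1 / L < c + d" "c - d < c + 1 / L" "c - 1 / L < c + d" "c - d < c - 1 / L"
        using dL by linarith+
      then have "c + s / L \<in> resolvent_set A" using s by (auto intro!: subsetD[OF d])
      then obtain \<kappa> where \<kappa>: "\<kappa> > 0" "\<forall>z\<in>dom A. \<kappa> * norm z \<le> norm (op z - (c + s / L) *\<^sub>R z)"
        using res_lower_bound by blast
      have "(L * \<kappa>) * norm (G y) \<le> norm (L *\<^sub>R y - s *\<^sub>R G y)" for y
      proof -
        have "op (G y) - (c + s / L) *\<^sub>R G y = (1/L) *\<^sub>R (L *\<^sub>R y - s *\<^sub>R G y)"
          using op_res[OF c, of y] L unfolding G_def by (simp add: algebra_simps)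
        then have "\<kappa> * norm (G y) \<le> norm ((1/L) *\<^sub>R (L *\<^sub>R y - s *\<^sub>R G y))"
          using \<kappa>(2) res_dom[OF c, of y] unfolding G_def by metis
        then have "\<kappa> * norm (G y) \<le> (1 / L) * norm (L *\<^sub>R y - s *\<^sub>R G y)"
          using L by simp
        then show ?thesis using L by (simp add: field_simps)
      qed
      then show ?thesis using \<kappa>(1) L by (intro exI[of _ "L * \<kappa>"]) auto
    qed
    obtain \<kappa> where \<kappa>: "\<kappa> > 0" "\<And>y. \<kappa> * norm (G y) \<le> norm (L *\<^sub>R y - G y)"
      using shifted[of 1] by auto
    obtain \<kappa>' where \<kappa>': "\<kappa>' > 0" "\<And>y. \<kappa>' * norm (G y) \<le> norm (L *\<^sub>R y + G y)"
      using shifted[of "-1"] by auto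
    have lin: "linear (\<lambda>x. G (G x))"
      using G.linear by (auto intro!: linearI simp: G.add G.scaleR)
    have "\<exists>m'<L\<^sup>2. \<forall>x\<in>UNIV. G (G x) \<bullet> x \<le> m' * (norm x)\<^sup>2"
    proof (rule symmetric_form_bound_improves[OF lin, of _ _ "\<kappa> * \<kappa>'"])
      show "G (G x) \<bullet> y = x \<bullet> G (G y)" for x y unfolding G_def by (simp add: res_sym[OF c])
      have GG: "G (G x) \<bullet> x = (norm (G x))\<^sup>2" for x
        unfolding G_def by (simp add: res_sym[OF c] power2_norm_eq_inner)
      then show "0 \<le> G (G x) \<bullet> x" for x by simp
      show "G (G x) \<bullet> x \<le> L\<^sup>2 * (norm x)\<^sup>2" for x
        using power_mono[OF GL[of x], of 2] GG by (simp add: power_mult_distrib)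
      show "0 < \<kappa> * \<kappa>'" using \<kappa> \<kappa>' by simp
      show "\<kappa> * \<kappa>' * norm (G (G x)) \<le> norm (L\<^sup>2 *\<^sub>R x - G (G x))" for x
      proof -
        have "\<kappa> * \<kappa>' * norm (G (G x)) \<le> \<kappa> * norm (L *\<^sub>R G x + G (G x))"
          using \<kappa>'(2)[of "G x"] \<kappa>(1) by simp
        also have "\<dots> = \<kappa> * norm (G (L *\<^sub>R x + G x))" by (simp add: G.add G.scaleR)
        also have "\<dots> \<le> norm (L *\<^sub>R (L *\<^sub>R x + G x) - G (L *\<^sub>R x + G x))" by (rule \<kappa>(2))
        also have "L *\<^sub>R (L *\<^sub>R x + G x) - G (L *\<^sub>R x + G x) = L\<^sup>2 *\<^sub>R x - G (G x)"
          by (simp add: G.add G.scaleR algebra_simps power2_eq_square)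
        finally show ?thesis .
      qed
    qed (use L in auto)
    then obtain m' where m': "m' < L\<^sup>2" "\<And>x. G (G x) \<bullet> x \<le> m' * (norm x)\<^sup>2" by blast
    have Gm: "(norm (G x))\<^sup>2 \<le> m' * (norm x)\<^sup>2" for x
      using m'(2)[of x] unfolding G_def by (simp add: res_sym[OF c] power2_norm_eq_inner)
    \<comment> \<open>A negative bound of a square would force the space to be trivial, and then
      \<open>L = 0\<close>.\<close>
    have "m' \<ge> 0"
    proof (rule ccontr)
      assume "\<not> m' \<ge> 0"
      then have "norm x = 0" for x :: 'a
        using Gm[of x] by (smt (verit) mult_neg_pos zero_le_power2 zero_less_power2)
      then have "onorm G = 0" using onorm_eq_0[OF G.bounded_linear] by (auto simp: G.zero)
      then show False using L L_def by simp
    qed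
    have "norm (G x) \<le> sqrt m' * norm x" for x
      using real_sqrt_le_mono[OF Gm[of x]] by (simp add: real_sqrt_mult)
    then have "L \<le> sqrt m'" unfolding L_def using \<open>m' \<ge> 0\<close> by (intro onorm_bound) auto
    then have "L\<^sup>2 \<le> m'" using \<open>m' \<ge> 0\<close> L by (metis less_imp_le power_mono real_sqrt_pow2)
    then show False using m'(1) by simp
  qed
  have "d * norm z \<le> d * (L * norm (op z - c *\<^sub>R z))"
    using GL[of "op z - c *\<^sub>R z"] Gz \<open>d > 0\<close> by simp
  also have "\<dots> = (L * d) * norm (op z - c *\<^sub>R z)" by simp
  also have "\<dots> \<le> 1 * norm (op z - c *\<^sub>R z)" using \<open>L * d \<le> 1\<close> by (intro mult_right_mono) auto
  finally show ?thesis by simp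
qed

text \<open>Let \<open>Y = A - \<mu>\<close>. The gaps on the two sides of \<mu> are intervals
  centred at \<open>\<mu> + \<epsilon>/2\<close> and \<open>\<mu> - \<epsilon>/2\<close>; squaring
  the distance bounds at these centres gives \<open>\<epsilon> |Y x \<bullet> x| <= |Y x|^2\<close>,
  which polarizes to \<open>\<epsilon> |Y x \<bullet> y| <= |Y x| |Y y|\<close>. By continuity
  \<open>Y x\<close> may be any vector in the closed range of \<open>Y\<close>, and \<open>z\<close>
  itself lies there since it is orthogonal to the kernel.\<close>

lemma isolated_point_lower_bound:
  assumes gap: "{\<mu> - \<epsilon><..<\<mu> + \<epsilon>} - {\<mu>} \<subseteq> resolvent_set A" and \<epsilon>: "\<epsilon> > 0"
    and z: "z \<in> dom A" and orth: "\<And>e. e \<in> eigenspace \<mu> \<Longrightarrow> z \<bullet> e = 0"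
  shows "\<epsilon> * norm z \<le> norm (op z - \<mu> *\<^sub>R z)"
proof -
  define Y where "Y x = op x - \<mu> *\<^sub>R x" for x
  have Y_add: "Y (x + y) = Y x + Y y" and Y_diff: "Y (x - y) = Y x - Y y" 
    and Y_sym: "Y x \<bullet> y = x \<bullet> Y y" if "x \<in> dom A" "y \<in> dom A" for x y
    using that by (simp_all add: Y_def op_add op_diff op_sym algebra_simps inner_diff inner_diff_right)
  have Y_scale: "Y (r *\<^sub>R x) = r *\<^sub>R Y x" if "x \<in> dom A" for x r
    using that by (simp add: Y_def op_scale algebra_simps)
  have half: "\<epsilon> * (s * (Y x \<bullet> x)) \<le> (norm (Y x))\<^sup>2" if x: "x \<in> dom A" and s: "s = 1 \<or> s = -1" for x s
  proof -
    define c where "c = \<mu> + s * \<epsilon> / 2"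
    have "{c - \<epsilon>/2<..<c + \<epsilon>/2} \<subseteq> resolvent_set A" using gap s by (auto simp: c_def intro!: subsetD[OF gap])
    from norm_ge_distance_to_spectrum[OF this x] \<epsilon>
    have "(\<epsilon> / 2) * norm x \<le> norm (op x - c *\<^sub>R x)" by simp
    then have "((\<epsilon> / 2) * norm x)\<^sup>2 \<le> (norm (op x - c *\<^sub>R x))\<^sup>2" using \<epsilon> by (intro power_mono) auto
    also have "op x - c *\<^sub>R x = Y x - (s * \<epsilon> / 2) *\<^sub>R x" unfolding Y_def c_def by (simp add: algebra_simps)
    also have "(norm \<dots>)\<^sup>2 = (norm (Y x))\<^sup>2 - s * \<epsilon> * (Y x \<bullet> x) + (s * s) * ((\<epsilon> / 2) * norm x)\<^sup>2"
      unfolding power_mult_distrib power2_norm_eq_inner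
      by (simp add: inner_diff inner_diff_right inner_commute algebra_simps power2_eq_square)
    finally show ?thesis using s by (auto simp: algebra_simps)
  qed
  have diag: "\<epsilon> * \<bar>Y x \<bullet> x\<bar> \<le> (norm (Y x))\<^sup>2" if "x \<in> dom A" for x
    using half[OF that, of 1] half[OF that, of "-1"] by (auto simp: abs_if)
  have polar: "2 * \<epsilon> * \<bar>Y x \<bullet> y\<bar> \<le> (norm (Y x))\<^sup>2 + (norm (Y y))\<^sup>2" if xy: "x \<in> dom A" "y \<in> dom A" for x y
  proof -
    have dom: "x + y \<in> dom A" "x - y \<in> dom A" using xy dom_subspace by (auto simp: subspace_add subspace_diff)
    have "4 * (Y x \<bullet> y) = Y (x + y) \<bullet> (x + y) - Y (x - y) \<bullet> (x - y)"
      using Y_sym[OF xy(2,1)] by (simp add: Y_add Y_diff xy inner_add inner_diff inner_commute algebra_simps)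
    then have "4 * \<bar>Y x \<bullet> y\<bar> \<le> \<bar>Y (x + y) \<bullet> (x + y)\<bar> + \<bar>Y (x - y) \<bullet> (x - y)\<bar>" by linarith
    then have "\<epsilon> * (4 * \<bar>Y x \<bullet> y\<bar>) \<le> \<epsilon> * (\<bar>Y (x + y) \<bullet> (x + y)\<bar> + \<bar>Y (x - y) \<bullet> (x - y)\<bar>)"
      using \<epsilon> by simp
    also have "\<dots> \<le> (norm (Y (x + y)))\<^sup>2 + (norm (Y (x - y)))\<^sup>2"
      using diag[OF dom(1)] diag[OF dom(2)] by (simp add: distrib_left)
    also have "\<dots> = 2 * (norm (Y x))\<^sup>2 + 2 * (norm (Y y))\<^sup>2"
      by (simp add: Y_add Y_diff xy power2_norm_eq_inner inner_add inner_diff inner_commute algebra_simps)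
    finally show ?thesis by simp
  qed
  have cs: "\<epsilon> * \<bar>Y x \<bullet> y\<bar> \<le> norm (Y x) * norm (Y y)" if xy: "x \<in> dom A" "y \<in> dom A" for x y
  proof (cases "Y x = 0 \<or> Y y = 0")
    case True
    then show ?thesis using Y_sym[OF xy] by auto
  next
    case False
    \<comment> \<open>The scaling \<open>x \<mapsto> s x\<close>, \<open>y \<mapsto> y / s\<close>
      leaves the left side of \<open>polar\<close> unchanged and balances the two squares on the
      right.\<close>
    define s where "s = sqrt (norm (Y y) / norm (Y x))"
    have s: "s > 0" "s\<^sup>2 = norm (Y y) / norm (Y x)" using False by (auto simp: s_def)
    have "2 * \<epsilon> * \<bar>Y (s *\<^sub>R x) \<bullet> ((1/s) *\<^sub>R y)\<bar> \<le> (norm (Y (s *\<^sub>R x)))\<^sup>2 + (norm (Y ((1/s) *\<^sub>R y)))\<^sup>2"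
      using xy dom_subspace by (intro polar) (auto simp: subspace_scale)
    also have "\<dots> = s\<^sup>2 * (norm (Y x))\<^sup>2 + (norm (Y y))\<^sup>2 / s\<^sup>2"
      by (simp add: Y_scale xy power_mult_distrib power_divide)
    also have "\<dots> = 2 * (norm (Y x) * norm (Y y))"
      unfolding s(2) using False by (simp add: power2_eq_square field_simps)
    finally show ?thesis using s(1) by (simp add: Y_scale xy)
  qed
  define W where "W = closure (Y ` dom A)"
  have "subspace (Y ` dom A)"
  proof (rule subspaceI)
    show "0 \<in> Y ` dom A" using Y_scale[of 0 0] subspace_0[OF dom_subspace] by (auto simp: image_iff)
    show "v + w \<in> Y ` dom A" if "v \<in> Y ` dom A" "w \<in> Y ` dom A" for v w
      using that Y_add subspace_add[OF dom_subspace] by (smt (verit) image_iff)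
    show "r *\<^sub>R v \<in> Y ` dom A" if "v \<in> Y ` dom A" for r v
      using that Y_scale subspace_scale[OF dom_subspace] by (smt (verit) image_iff)
  qed
  then have "subspace W" unfolding W_def by (rule subspace_closure)
  then obtain p where p: "p \<in> W" "\<forall>s\<in>W. (z - p) \<bullet> s = 0"
    using exists_orthogonal_projection[of W z] unfolding W_def by auto
  \<comment> \<open>A vector orthogonal to the range of \<open>Y\<close> is an eigenvector, by the
    weak form of the definition.\<close>
  have "z - p \<in> eigenspace \<mu>"
    unfolding eigenspace_def
  proof (intro CollectI ballI)
    fix y assume "y \<in> dom A"
    then have "Y y \<in> W" unfolding W_def by (intro subsetD[OF closure_subset] imageI)
    then have "(z - p) \<bullet> Y y = 0" using p by blast
    then have "(op y - \<mu> *\<^sub>R y) \<bullet> (z - p) = 0" unfolding Y_def by (subst inner_commute)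
    then show "op y \<bullet> (z - p) = y \<bullet> (\<mu> *\<^sub>R (z - p))" by (simp add: inner_diff_left)
  qed
  then have "z \<bullet> (z - p) = 0" using orth by blast
  moreover have "(z - p) \<bullet> p = 0" using p by blast
  ultimately have "(z - p) \<bullet> (z - p) = 0" by (simp add: inner_diff_right inner_diff_left inner_commute)
  then have "z \<in> W" using p(1) by simp
  moreover have "W \<subseteq> {w. \<epsilon> * \<bar>w \<bullet> z\<bar> \<le> norm w * norm (Y z)}"
    unfolding W_def using cs z
    by (intro closure_minimal closed_Collect_le continuous_intros) auto
  ultimately have "\<epsilon> * (norm z)\<^sup>2 \<le> norm z * norm (Y z)" by (auto simp: power2_norm_eq_inner)
  then show ?thesis unfolding Y_def[symmetric]
    by (cases "z = 0") (auto simp: power2_eq_square)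
qed

text \<open>The supremum \<open>m\<close> of the form of the inverse of \<open>A\<close> over unit vectors orthogonal to all
  eigenvectors cannot be positive, since \<open>A - 1/m\<close> is bounded below on these vectors.\<close>

lemma eigenvectors_complete:
  assumes nonneg: "nonneg_operator A" and zero: "0 \<in> resolvent_set A"
    and isolated: "\<And>\<mu>. \<mu> \<in> spectrum A \<Longrightarrow> \<exists>\<epsilon>>0. {\<mu> - \<epsilon><..<\<mu> + \<epsilon>} - {\<mu>} \<subseteq> resolvent_set A"
    and orth: "\<And>\<mu> e. \<mu> \<in> spectrum A \<Longrightarrow> e \<in> eigenspace \<mu> \<Longrightarrow> x \<bullet> e = 0"
  shows "x = 0"
proof (rule ccontr)
  assume "x \<noteq> 0"
  define N where "N = {x. \<forall>\<mu>\<in>spectrum A. \<forall>e\<in>eigenspace \<mu>. x \<bullet> e = 0}"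
  define T where "T = res 0"
  interpret T: bounded_linear T unfolding T_def by (rule res_linear[OF zero])
  have opT: "op (T y) = y" and Tdom: "T y \<in> dom A" for y
    using op_res[OF zero, of y] res_dom[OF zero, of y] unfolding T_def by auto
  have Tsym: "T y \<bullet> w = y \<bullet> T w" for y w unfolding T_def by (rule res_sym[OF zero])
  have Tnonneg: "0 \<le> T y \<bullet> y" for y
    using nonneg Tdom[of y] opT[of y] unfolding nonneg_operator_def by (metis inner_commute)
  have N: "subspace N" unfolding N_def subspace_def by (simp add: inner_add)
  \<comment> \<open>\<open>T\<close> maps \<open>N\<close> into itself because every spectral value
    is nonzero: \<open>\<mu> (T y \<bullet> e) = y \<bullet> e = 0\<close>.\<close>
  have TN: "T y \<in> N" if y: "y \<in> N" for y
    unfolding N_def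
  proof (clarsimp)
    fix \<mu> e assume \<mu>: "\<mu> \<in> spectrum A" and e: "e \<in> eigenspace \<mu>"
    have "\<mu> * (T y \<bullet> e) = op (T y) \<bullet> e" using e Tdom unfolding eigenspace_def by simp
    also have "\<dots> = 0" using opT y \<mu> e unfolding N_def by simp
    finally show "T y \<bullet> e = 0" using \<mu> zero unfolding spectrum_def by auto
  qed
  have lower: "\<exists>\<kappa>>0. \<forall>z\<in>dom A \<inter> N. \<kappa> * norm z \<le> norm (op z - \<mu> *\<^sub>R z)" for \<mu>
  proof (cases "\<mu> \<in> spectrum A")
    case True
    then show ?thesis
      using isolated[OF True] isolated_point_lower_bound[of \<mu>] unfolding N_def by blast
  next
    case False
    then show ?thesis using res_lower_bound[of \<mu>] unfolding spectrum_def by blast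
  qed
  define U where "U = {y \<in> N. norm y = 1}"
  define m where "m = (SUP y\<in>U. T y \<bullet> y)"
  obtain K where K: "\<And>y. norm (T y) \<le> norm y * K" using T.bounded by blast
  have bdd: "bdd_above ((\<lambda>y. T y \<bullet> y) ` U)"
  proof (rule bdd_aboveI2)
    fix y assume "y \<in> U"
    then show "T y \<bullet> y \<le> K"
      using norm_cauchy_schwarz[of "T y" y] K[of y] unfolding U_def by simp
  qed
  have x: "x \<in> N" using orth unfolding N_def by blast
  have normalized: "T y \<bullet> y \<le> m' * (norm y)\<^sup>2"
    if "\<And>w. w \<in> U \<Longrightarrow> T w \<bullet> w \<le> m'" and y: "y \<in> N" for y m'
  proof (cases "y = 0")
    case False
    define w where "w = (1 / norm y) *\<^sub>R y"
    have "w \<in> U" unfolding U_def w_def using y N False by (simp add: subspace_scale)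
    then have "T w \<bullet> w \<le> m'" using that by blast
    moreover have "T w \<bullet> w = (T y \<bullet> y) / (norm y)\<^sup>2"
      unfolding w_def by (simp add: T.scaleR power2_eq_square)
    ultimately show ?thesis using False by (simp add: field_simps)
  qed (simp add: T.zero)
  have le: "T y \<bullet> y \<le> m * (norm y)\<^sup>2" if "y \<in> N" for y
    using that by (intro normalized) (auto simp: m_def intro!: cSUP_upper bdd)
  have "m > 0"
  proof (rule ccontr)
    assume "\<not> m > 0"
    then have "T y \<bullet> y \<le> 0" if "y \<in> N" for y
      using le[OF that] order_trans[OF _ mult_nonpos_nonneg[of m "(norm y)\<^sup>2"]] by simp
    then have zero: "T y \<bullet> y = 0" if "y \<in> N" for y using Tnonneg[of y] that by (simp add: order_antisym)
    \<comment> \<open>Polarization along \<open>x\<close> and \<open>T x\<close>: a symmetric form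
      that vanishes on the diagonal of \<open>N\<close> vanishes on all of \<open>N\<close>.\<close>
    have "T x \<bullet> T x = (T (x + T x) \<bullet> (x + T x) - T x \<bullet> x - T (T x) \<bullet> T x) / 2"
      using Tsym[of "T x" x] by (simp add: T.add inner_add inner_add_right inner_commute)
    also have "\<dots> = 0" using zero x TN[OF x] N by (simp add: subspace_add)
    finally have "T x = 0" by simp
    then have "x = 0" using opT[of x] op_scale[of 0 0] dom_subspace by (simp add: subspace_0)
    then show False using \<open>x \<noteq> 0\<close> by simp
  qed
  obtain \<kappa> where \<kappa>: "\<kappa> > 0" "\<forall>z\<in>dom A \<inter> N. \<kappa> * norm z \<le> norm (op z - (1/m) *\<^sub>R z)"
    using lower by blast
  have "\<exists>m'<m. \<forall>x\<in>N. T x \<bullet> x \<le> m' * (norm x)\<^sup>2"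
  proof (rule symmetric_form_bound_improves[OF T.linear N TN Tsym Tnonneg le \<open>m > 0\<close>, of "m * \<kappa>"])
    show "m * \<kappa> * norm (T y) \<le> norm (m *\<^sub>R y - T y)" if y: "y \<in> N" for y
    proof -
      have "\<kappa> * norm (T y) \<le> norm (y - (1/m) *\<^sub>R T y)"
        using \<kappa>(2) Tdom TN[OF y] opT by (metis IntI)
      moreover have "m *\<^sub>R y - T y = m *\<^sub>R (y - (1/m) *\<^sub>R T y)"
        using \<open>m > 0\<close> by (simp add: algebra_simps)
      ultimately show ?thesis using \<open>m > 0\<close> by simp
    qed
  qed (use \<kappa> \<open>m > 0\<close> in auto)
  then obtain m' where m': "m' < m" "\<And>y. y \<in> N \<Longrightarrow> T y \<bullet> y \<le> m' * (norm y)\<^sup>2" by blast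
  have "m \<le> m'" unfolding m_def
  proof (rule cSUP_least)
    have "(1 / norm x) *\<^sub>R x \<in> U" unfolding U_def using x N \<open>x \<noteq> 0\<close> by (simp add: subspace_scale)
    then show "U \<noteq> {}" by blast
    show "T y \<bullet> y \<le> m'" if "y \<in> U" for y using m'(2)[of y] that unfolding U_def by simp
  qed
  then show False using m'(1) by simp
qed

end

section \<open>Diagonal operators and their square roots\<close>

text \<open>Passing to adjoints reverses inclusions, so a self-adjoint operator has no proper
  self-adjoint extension. Later only one inclusion has to be checked to identify operators.\<close>

lemma selfadjoint_extension_eq:
  assumes "selfadjoint_operator A" "selfadjoint_operator B" and sub: "\<And>x y. A x = Some y \<Longrightarrow> B x = Some y"
  shows "A = B"
proof
  fix x
  have "A x = Some y" if "B x = Some y" for y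
  proof -
    have "the (A w) \<bullet> x = w \<bullet> y" if w: "w \<in> dom A" for w
    proof -
      have "B w = Some (the (A w))" using sub w by auto
      moreover have "\<forall>w\<in>dom B. the (B w) \<bullet> x = w \<bullet> y"
        using assms(2) \<open>B x = Some y\<close> adjoint_operator_eq_Some_iff[of B x y]
        unfolding selfadjoint_operator_def by simp
      ultimately show ?thesis by (metis domI option.sel)
    qed
    then show ?thesis
      using assms(1) adjoint_operator_eq_Some_iff[of A x y] unfolding selfadjoint_operator_def by simp
  qed
  then show "A x = B x" using sub[of x] by (cases "A x"; cases "B x") auto
qed

section \<open>Hilbert sums of orthogonal projections and the operators diagonal in them\<close>

locale orthogonal_projections =
  fixes P :: "nat \<Rightarrow> 'a::{real_inner,complete_space} \<Rightarrow> 'a"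
  assumes linear: "\<And>k. linear (P k)"
    and sym: "\<And>k x y. P k x \<bullet> y = x \<bullet> P k y"
    and idem: "\<And>k x. P k (P k x) = P k x"
    and orth: "\<And>j k x. j \<noteq> k \<Longrightarrow> P j (P k x) = 0"
begin

lemma inner_proj: "P k x \<bullet> P k y = P k x \<bullet> y"
  using sym[of k "P k x" y] idem by simp

lemma inner_orth: "j \<noteq> k \<Longrightarrow> P j x \<bullet> P k y = 0"
  using sym[of j x "P k y"] orth by simp

lemma proj_bounded_linear: "bounded_linear (P k)"
proof -
  have "norm (P k x) \<le> norm x * 1" for x
  proof -
    have "(norm (P k x))\<^sup>2 \<le> norm (P k x) * norm x"
      using norm_cauchy_schwarz[of "P k x" x] inner_proj[of k x x] by (simp add: power2_norm_eq_inner)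
    then show ?thesis by (cases "P k x = 0") (auto simp: power2_eq_square)
  qed
  then show ?thesis
    unfolding bounded_linear_def bounded_linear_axioms_def using linear[of k] by (intro conjI exI[of _ 1] allI)
qed

lemma norm_sum_power2:
  assumes "finite I" and w: "\<And>k. P k (w k) = w k"
  shows "(norm (\<Sum>k\<in>I. w k))\<^sup>2 = (\<Sum>k\<in>I. (norm (w k))\<^sup>2)"
proof -
  have "w j \<bullet> w k = 0" if "j \<noteq> k" for j k using inner_orth[OF that, of "w j" "w k"] w by simp
  then show ?thesis using assms(1)
    by (intro norm_sum_Pythagorean) (auto simp: pairwise_def orthogonal_def)
qed

lemma bessel: "(\<Sum>k<n. (norm (P k x))\<^sup>2) \<le> (norm x)\<^sup>2"
proof -
  define s where "s = (\<Sum>k<n. P k x)"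
  have "s \<bullet> s = (\<Sum>k<n. (norm (P k x))\<^sup>2)"
    using norm_sum_power2[of "{..<n}" "\<lambda>k. P k x"] idem unfolding s_def by (simp add: power2_norm_eq_inner)
  moreover have "s \<bullet> x = (\<Sum>k<n. (norm (P k x))\<^sup>2)"
    unfolding s_def inner_sum_left power2_norm_eq_inner by (simp add: inner_proj)
  moreover have "0 \<le> (x - s) \<bullet> (x - s)" by simp
  ultimately show ?thesis
    by (simp add: inner_diff_left inner_diff_right inner_commute[of x s] power2_norm_eq_inner)
qed

lemma summable_norm_proj: "summable (\<lambda>k. (norm (P k x))\<^sup>2)"
  using bessel[of x] by (intro summableI_nonneg_bounded[where x = "(norm x)\<^sup>2"]) auto

text \<open>Riesz-Fischer: for orthogonal terms the distances of partial sums are controlled by the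
  partial sums of the squared norms, and continuity of \<open>P k\<close> reads off the components
  of the limit.\<close>

lemma exists_sums:
  assumes w: "\<And>k. P k (w k) = w k" and summable: "summable (\<lambda>k. (norm (w k))\<^sup>2)"
  shows "\<exists>y. w sums y \<and> (\<forall>k. P k y = w k)"
proof -
  define S where "S n = (\<Sum>k<n. w k)" for n
  define N where "N n = (\<Sum>k<n. (norm (w k))\<^sup>2)" for n
  have N: "Cauchy N" using summable unfolding N_def
    by (simp add: summable_iff_convergent Cauchy_convergent_iff)
  have diff: "(dist (S m) (S n))\<^sup>2 \<le> dist (N m) (N n)" for m n
  proof (induction m n rule: linorder_wlog)
    case (le m n)
    have "S n - S m = (\<Sum>k\<in>{m..<n}. w k)" "N n - N m = (\<Sum>k\<in>{m..<n}. (norm (w k))\<^sup>2)"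
      unfolding S_def N_def using le sum_diff[of "{..<n}" "{..<m}" w]
        sum_diff[of "{..<n}" "{..<m}" "\<lambda>k. (norm (w k))\<^sup>2"]
      by (simp_all add: lessThan_minus_lessThan)
    then have "(norm (S n - S m))\<^sup>2 = N n - N m" using norm_sum_power2[of "{m..<n}" w] w by simp
    then show ?case by (simp add: dist_norm norm_minus_commute)
  qed (simp add: dist_commute)
  have "Cauchy S"
  proof (rule metric_CauchyI)
    fix e :: real assume e: "e > 0"
    obtain M where M: "\<forall>m\<ge>M. \<forall>n\<ge>M. dist (N m) (N n) < e\<^sup>2"
      using metric_CauchyD[OF N, of "e\<^sup>2"] e by auto
    have "dist (S m) (S n) < e" if "m \<ge> M" "n \<ge> M" for m n
      using M that diff[of m n] e by (metis le_less_trans less_imp_le power2_less_imp_less)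
    then show "\<exists>M. \<forall>m\<ge>M. \<forall>n\<ge>M. dist (S m) (S n) < e" by blast
  qed
  then obtain y where y: "S \<longlonglongrightarrow> y" using Cauchy_convergent convergent_def by blast
  have "P k y = w k" for k
  proof -
    interpret bounded_linear "P k" by (rule proj_bounded_linear)
    have "(\<lambda>n. P k (S n)) \<longlonglongrightarrow> P k y" by (rule tendsto[OF y])
    moreover have "eventually (\<lambda>n. P k (S n) = w k) sequentially"
    proof (rule eventually_sequentiallyI)
      fix n assume n: "Suc k \<le> n"
      have "P k (w j) = (if j = k then w k else 0)" for j
        using w[of j] w[of k] orth[of k j "w j"] by auto
      then show "P k (S n) = w k" unfolding S_def sum using n by simp
    qed
    ultimately show ?thesis by (metis LIMSEQ_unique tendsto_eventually)
  qed
  then show ?thesis using y unfolding sums_def S_def by blast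
qed

end

locale complete_projections = orthogonal_projections +
  assumes complete: "\<And>x. (\<And>k. P k x = 0) \<Longrightarrow> x = 0"
begin

lemma proj_eqI: "(\<And>k. P k x = P k y) \<Longrightarrow> x = y"
  using complete[of "x - y"] linear by (simp add: linear_diff)

lemma proj_sums: "(\<lambda>k. P k x) sums x"
proof -
  obtain y where "(\<lambda>k. P k x) sums y" "\<forall>k. P k y = P k x"
    using exists_sums[of "\<lambda>k. P k x", OF idem summable_norm_proj] by blast
  then show ?thesis using proj_eqI by blast
qed

lemma inner_sums: "(\<lambda>k. P k x \<bullet> P k y) sums (x \<bullet> y)"
  using bounded_linear.sums[OF bounded_linear_inner_left proj_sums[of x], of y] by (simp add: inner_proj)

lemma norm_sums: "(\<lambda>k. (norm (P k x))\<^sup>2) sums (norm x)\<^sup>2"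
  using inner_sums[of x x] by (simp add: power2_norm_eq_inner)

text \<open>The maximal domain: \<open>x\<close> belongs to it when the scaled components are those
  of some vector. By \<open>exists_sums\<close> and \<open>summable_norm_proj\<close> this is square
  summability of \<open>a k *\<^sub>R P k x\<close>.\<close>

definition diag :: "(nat \<Rightarrow> real) \<Rightarrow> 'a \<rightharpoonup> 'a" where
  "diag a x = (if \<exists>y. \<forall>k. P k y = a k *\<^sub>R P k x then Some (THE y. \<forall>k. P k y = a k *\<^sub>R P k x) else None)"

lemma diag_eq_Some_iff: "diag a x = Some y \<longleftrightarrow> (\<forall>k. P k y = a k *\<^sub>R P k x)"
proof -
  have "(THE y. \<forall>k. P k y = a k *\<^sub>R P k x) = y" if "\<forall>k. P k y = a k *\<^sub>R P k x" for y
    using that by (intro the_equality) (auto intro: proj_eqI)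
  then show ?thesis unfolding diag_def by auto
qed

lemma proj_diag: "x \<in> dom (diag a) \<Longrightarrow> P k (the (diag a x)) = a k *\<^sub>R P k x"
  by (metis diag_eq_Some_iff domD option.sel)

lemma diag_proj: "diag a (P k x) = Some (a k *\<^sub>R P k x)"
  unfolding diag_eq_Some_iff
proof
  show "P j (a k *\<^sub>R P k x) = a j *\<^sub>R P j (P k x)" for j
    by (cases "j = k") (simp_all add: linear_scale[OF linear] idem orth)
qed

lemma diag_linear: "linear_operator (diag a)"
proof -
  have add: "diag a (x + y) = Some (the (diag a x) + the (diag a y))"
    if "x \<in> dom (diag a)" "y \<in> dom (diag a)" for x y
    using that by (simp add: diag_eq_Some_iff linear_add[OF linear] proj_diag algebra_simps)
  have scale: "diag a (c *\<^sub>R x) = Some (c *\<^sub>R the (diag a x))" if "x \<in> dom (diag a)" for c x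
    using that by (simp add: diag_eq_Some_iff linear_scale[OF linear] proj_diag)
  have "0 \<in> dom (diag a)"
    using diag_eq_Some_iff[of a 0 0] by (auto simp: linear_0[OF linear])
  then show ?thesis
    unfolding linear_operator_def subspace_def using add scale by (auto simp: domIff)
qed

lemma diag_dense: "closure (dom (diag a)) = UNIV"
proof -
  have sub: "subspace (dom (diag a))" using diag_linear unfolding linear_operator_def by blast
  have "x \<in> closure (dom (diag a))" for x
    unfolding closure_sequential
  proof (intro exI conjI allI)
    show "(\<lambda>n. \<Sum>k<n. P k x) \<longlonglongrightarrow> x" using proj_sums unfolding sums_def .
    show "(\<Sum>k<n. P k x) \<in> dom (diag a)" for n
      using diag_proj by (intro subspace_sum[OF sub]) auto
  qed
  then show ?thesis by blast
qed

text \<open>Testing the adjoint relation with the vectors \<open>P k w\<close> determines every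
  component of \<open>z\<close>; the converse is Parseval's identity. Maximality of the domain makes
  the operator equal to its adjoint and not merely symmetric.\<close>

lemma diag_selfadjoint: "selfadjoint_operator (diag a)"
proof -
  have iff: "adjoint_operator (diag a) y = Some z \<longleftrightarrow> diag a y = Some z" for y z
  proof -
    have "(\<forall>x\<in>dom (diag a). the (diag a x) \<bullet> y = x \<bullet> z) \<longleftrightarrow> (\<forall>k. P k z = a k *\<^sub>R P k y)"
    proof (intro iffI allI ballI)
      fix k assume L: "\<forall>x\<in>dom (diag a). the (diag a x) \<bullet> y = x \<bullet> z"
      have "w \<bullet> (P k z - a k *\<^sub>R P k y) = 0" for w
      proof -
        have "the (diag a (P k w)) \<bullet> y = P k w \<bullet> z" using L diag_proj by blast
        then show ?thesis by (simp add: diag_proj inner_diff_right sym)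
      qed
      then have "P k z - a k *\<^sub>R P k y = 0" by (metis inner_eq_zero_iff)
      then show "P k z = a k *\<^sub>R P k y" by simp
    next
      fix x assume R: "\<forall>k. P k z = a k *\<^sub>R P k y" and x: "x \<in> dom (diag a)"
      show "the (diag a x) \<bullet> y = x \<bullet> z"
        using inner_sums[of "the (diag a x)" y] inner_sums[of x z] R
        by (simp add: proj_diag[OF x] sums_unique2)
    qed
    then show ?thesis unfolding diag_eq_Some_iff using adjoint_operator_eq_Some_iff[OF diag_dense] by simp
  qed
  have "adjoint_operator (diag a) y = diag a y" for y
    using iff[of y] by (cases "diag a y"; cases "adjoint_operator (diag a) y") auto
  then have "adjoint_operator (diag a) = diag a" by (rule ext)
  then show ?thesis unfolding selfadjoint_operator_def using diag_linear diag_dense by blast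
qed

lemma diag_nonneg: assumes "\<And>k. a k \<ge> 0" shows "nonneg_operator (diag a)"
  unfolding nonneg_operator_def
proof
  fix x assume "x \<in> dom (diag a)"
  then have "0 \<le> P k (the (diag a x)) \<bullet> P k x" for k using assms by (simp add: proj_diag)
  then show "0 \<le> the (diag a x) \<bullet> x" by (rule sums_le[OF _ sums_zero inner_sums])
qed

lemma diag_compose: "diag a \<circ>\<^sub>m diag a = diag (\<lambda>k. (a k)\<^sup>2)"
proof
  fix x
  have "(diag a \<circ>\<^sub>m diag a) x = Some z \<longleftrightarrow> diag (\<lambda>k. (a k)\<^sup>2) x = Some z" for z
  proof
    assume "(diag a \<circ>\<^sub>m diag a) x = Some z"
    then obtain y where "diag a x = Some y" "diag a y = Some z" by (auto simp: map_comp_Some_iff)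
    then show "diag (\<lambda>k. (a k)\<^sup>2) x = Some z" by (simp add: diag_eq_Some_iff power2_eq_square)
  next
    assume "diag (\<lambda>k. (a k)\<^sup>2) x = Some z"
    then have z: "\<And>k. P k z = (a k)\<^sup>2 *\<^sub>R P k x" by (simp add: diag_eq_Some_iff)
    \<comment> \<open>The squared norms of the intermediate components are terms of the series for
      \<open>z \<bullet> x\<close>, hence summable. This puts \<open>x\<close> into the domain of
      the inner factor.\<close>
    have "(norm (a k *\<^sub>R P k x))\<^sup>2 = P k z \<bullet> P k x" for k
      unfolding z by (simp add: power_mult_distrib flip: power2_norm_eq_inner)
    then have "summable (\<lambda>k. (norm (a k *\<^sub>R P k x))\<^sup>2)"
      using inner_sums[of z x] by (simp add: sums_iff)
    moreover have "P k (a k *\<^sub>R P k x) = a k *\<^sub>R P k x" for k by (simp add: linear_scale[OF linear] idem)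
    ultimately obtain y where "\<forall>k. P k y = a k *\<^sub>R P k x"
      using exists_sums[of "\<lambda>k. a k *\<^sub>R P k x"] by blast
    then have "diag a x = Some y" "diag a y = Some z" using z by (simp_all add: diag_eq_Some_iff power2_eq_square)
    then show "(diag a \<circ>\<^sub>m diag a) x = Some z" by (auto simp: map_comp_Some_iff)
  qed
  then show "(diag a \<circ>\<^sub>m diag a) x = diag (\<lambda>k. (a k)\<^sup>2) x" by (metis not_None_eq)
qed

text \<open>Symmetry of \<open>B\<close> against the vectors \<open>P k w\<close> fixes the
  components of \<open>B x\<close>, so \<open>diag a\<close> extends \<open>B\<close>, and
  self-adjoint operators have no proper self-adjoint extension.\<close>

lemma selfadjoint_eq_diag:
  assumes B: "selfadjoint_operator B" and B_proj: "\<And>k w. B (P k w) = Some (a k *\<^sub>R P k w)"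
  shows "B = diag a"
proof (rule selfadjoint_extension_eq[OF B diag_selfadjoint])
  interpret B: selfadjoint_op B using B by unfold_locales
  fix x y assume xy: "B x = Some y"
  have "(P k y - a k *\<^sub>R P k x) \<bullet> w = 0" for k w
  proof -
    have "y \<bullet> P k w = x \<bullet> (a k *\<^sub>R P k w)"
      using B.op_sym[of x "P k w"] xy B_proj[of k w] by (auto simp: domIff)
    then show ?thesis by (simp add: inner_diff_left sym)
  qed
  then have "P k y - a k *\<^sub>R P k x = 0" for k by (metis inner_eq_zero_iff)
  then show "diag a x = Some y" by (simp add: diag_eq_Some_iff)
qed

text \<open>On the range of \<open>P k\<close> a nonnegative square root \<open>B\<close> satisfies \<open>(B + a k) (B - a k) = 0\<close>, hence
  \<open>B = a k\<close>.\<close>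

lemma operator_sqrt_diag:
  assumes a: "\<And>k. a k > 0"
  shows "operator_sqrt (diag (\<lambda>k. (a k)\<^sup>2)) = diag a"
  unfolding operator_sqrt_def
proof (rule the_equality)
  show "selfadjoint_operator (diag a) \<and> nonneg_operator (diag a) \<and> diag a \<circ>\<^sub>m diag a = diag (\<lambda>k. (a k)\<^sup>2)"
    using diag_selfadjoint diag_nonneg diag_compose a by (simp add: less_imp_le)
next
  fix B assume B: "selfadjoint_operator B \<and> nonneg_operator B \<and> B \<circ>\<^sub>m B = diag (\<lambda>k. (a k)\<^sup>2)"
  interpret B: selfadjoint_op B using B by unfold_locales blast
  have B_proj: "B (P k w) = Some (a k *\<^sub>R P k w)" for k w
  proof -
    define e where "e = P k w"
    have "(B \<circ>\<^sub>m B) e = Some ((a k)\<^sup>2 *\<^sub>R e)" using B diag_proj unfolding e_def by metis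
    then obtain f where f: "B e = Some f" "B f = Some ((a k)\<^sup>2 *\<^sub>R e)" by (auto simp: map_comp_Some_iff)
    define y where "y = f - a k *\<^sub>R e"
    have dom: "e \<in> dom B" "f \<in> dom B" using f by auto
    have dom': "a k *\<^sub>R e \<in> dom B" by (rule subspace_scale[OF B.dom_subspace dom(1)])
    have y: "y \<in> dom B" unfolding y_def by (rule subspace_diff[OF B.dom_subspace dom(2) dom'])
    have "B.op y = (a k)\<^sup>2 *\<^sub>R e - a k *\<^sub>R f" unfolding y_def using dom dom' f by (simp add: B.op_diff B.op_scale)
    then have "B.op y = - a k *\<^sub>R y" unfolding y_def by (simp add: algebra_simps power2_eq_square)
    then have "0 \<le> - a k * (y \<bullet> y)" using B y unfolding nonneg_operator_def by (metis inner_scaleR_left)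
    then have "y \<bullet> y \<le> 0" using a[of k] by (simp add: mult_le_0_iff)
    then have "y = 0" using inner_ge_zero[of y] inner_eq_zero_iff[of y] by linarith
    then have "f = a k *\<^sub>R e" unfolding y_def by simp
    then show ?thesis using f e_def by simp
  qed
  show "B = diag a" using B B_proj by (intro selfadjoint_eq_diag) auto
qed

end

section \<open>Absolutely continuous functions\<close>

text \<open>A gauge handles both kinds of points in one tagged division. Around a tag in
  \<open>N\<close> it stays inside an open set of measure below \<eta>, where absolute continuity
  bounds the total increment by \<epsilon>; around any other tag the zero derivative bounds each
  increment by \<epsilon> times the length.\<close>

lemma abs_continuous_zero_derivative:
  assumes ac: "abs_continuous_on_Icc a b f" and "a \<le> b" and N: "negligible N"
    and deriv: "\<And>x. x \<in> {a..b} - N \<Longrightarrow> (f has_real_derivative 0) (at x within {a..b})"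
  shows "f b = f a"
proof -
  have bound: "\<bar>f b - f a\<bar> \<le> \<epsilon> * (1 + (b - a))" if \<epsilon>: "\<epsilon> > 0" for \<epsilon>
  proof -
    obtain \<eta> where \<eta>: "\<eta> > 0" and ac': "\<And>P. finite P \<Longrightarrow> (\<And>c d. (c, d) \<in> P \<Longrightarrow> a \<le> c \<and> c \<le> d \<and> d \<le> b) \<Longrightarrow>
        disjoint_family_on (\<lambda>(c, d). {c<..<d}) P \<Longrightarrow> (\<Sum>(c, d)\<in>P. d - c) < \<eta> \<Longrightarrow>
        (\<Sum>(c, d)\<in>P. \<bar>f d - f c\<bar>) < \<epsilon>"
      using ac \<epsilon> unfolding abs_continuous_on_Icc_def by (metis (no_types, lifting) case_prodI2)
    obtain U where U: "open U" "N \<subseteq> U" "U - N \<in> lmeasurable" "emeasure lebesgue (U - N) < ennreal \<eta>"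
      using sets_lebesgue_outer_open[OF negligible_imp_sets[OF N] \<eta>] by blast
    have "U = (U - N) \<union> N" using U(2) by blast
    then have U': "U \<in> lmeasurable" "measure lebesgue U < \<eta>"
      using U(3,4) negligible_imp_measurable[OF N] negligible_imp_measure0[OF N] \<eta>
        measure_Un_le[of "U - N" lebesgue N] fmeasurable.Un[of "U - N" lebesgue N]
      by (auto simp: emeasure_eq_measure2 ennreal_less_iff)
    have "\<exists>r>0. if x \<in> N then ball x r \<subseteq> U
        else x \<in> {a..b} \<longrightarrow> (\<forall>y\<in>{a..b} \<inter> ball x r. \<bar>f y - f x\<bar> \<le> \<epsilon> * \<bar>y - x\<bar>)" for x
    proof (cases "x \<in> N")
      case True
      then show ?thesis using U(1,2) open_contains_ball by auto
    next
      case False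
      show ?thesis
      proof (cases "x \<in> {a..b}")
        case True
        then have "(f has_derivative (*) 0) (at x within {a..b})"
          using deriv False by (simp add: has_field_derivative_def)
        then obtain r where "r > 0" "\<And>y. y \<in> {a..b} \<Longrightarrow> norm (y - x) < r \<Longrightarrow> norm (f y - f x - 0 * (y - x)) \<le> \<epsilon> * norm (y - x)"
          using \<epsilon> unfolding has_derivative_within_alt by blast
        then show ?thesis using False by (intro exI[of _ r]) (auto simp: dist_real_def abs_minus_commute)
      qed (use False in \<open>auto intro: exI[of _ 1]\<close>)
    qed
    then obtain r where r: "\<And>x. r x > 0" "\<And>x. x \<in> N \<Longrightarrow> ball x (r x) \<subseteq> U"
      "\<And>x y. x \<notin> N \<Longrightarrow> x \<in> {a..b} \<Longrightarrow> y \<in> {a..b} \<Longrightarrow> y \<in> ball x (r x) \<Longrightarrow> \<bar>f y - f x\<bar> \<le> \<epsilon> * \<bar>y - x\<bar>"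
      by (metis IntI)
    have "gauge (\<lambda>x. ball x (r x))" using r(1) by (intro gauge_ball_dependent) auto
    then obtain p where p: "p tagged_division_of {a..b}" "(\<lambda>x. ball x (r x)) fine p"
      using fine_division_exists_real by blast
    have fin: "finite p" using p(1) by blast
    have K: "\<exists>c d. K = {c..d} \<and> a \<le> c \<and> c \<le> x \<and> x \<le> d \<and> d \<le> b" if xK: "(x, K) \<in> p" for x K
    proof -
      obtain c d where cd: "K = cbox c d" using tagged_division_ofD(4)[OF p(1) xK] by blast
      moreover have "x \<in> K" "K \<subseteq> {a..b}" using tagged_division_ofD(2,3)[OF p(1) xK] by auto
      ultimately show ?thesis by (intro exI[of _ c] exI[of _ d]) (auto simp: cbox_interval)
    qed
    define inc where "inc = (\<lambda>(x::real, K). f (Sup K) - f (Inf K))"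
    \<comment> \<open>Degenerate intervals contribute no increment. Without them distinct tagged
      intervals have distinct endpoints, so their sum can be rewritten over pairs of endpoints as
      absolute continuity requires.\<close>
    define p1 where "p1 = {(x, K) \<in> p. x \<in> N \<and> Inf K < Sup K}"
    define p2 where "p2 = {(x, K) \<in> p. x \<notin> N}"
    have fin12: "finite p1" "finite p2" using fin unfolding p1_def p2_def by (auto intro: rev_finite_subset)
    have "\<bar>f b - f a\<bar> = \<bar>sum inc p\<bar>"
      using additive_tagged_division_1[OF \<open>a \<le> b\<close> p(1), of f] unfolding inc_def by simp
    also have "sum inc p = sum inc (p1 \<union> p2)"
    proof (rule sum.mono_neutral_right[OF fin])
      show "\<forall>i\<in>p - (p1 \<union> p2). inc i = 0"
      proof
        fix i assume i: "i \<in> p - (p1 \<union> p2)"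
        obtain x L where xL: "i = (x, L)" by (cases i)
        with i K[of x L] have "Sup L = Inf L" unfolding p1_def p2_def by fastforce
        then show "inc i = 0" unfolding inc_def xL by simp
      qed
    qed (auto simp: p1_def p2_def)
    also have "\<bar>\<dots>\<bar> \<le> (\<Sum>i\<in>p1 \<union> p2. \<bar>inc i\<bar>)" by (rule sum_abs)
    also have "\<dots> = (\<Sum>i\<in>p1. \<bar>inc i\<bar>) + (\<Sum>i\<in>p2. \<bar>inc i\<bar>)"
      using fin12 by (intro sum.union_disjoint) (auto simp: p1_def p2_def)
    also have "(\<Sum>i\<in>p1. \<bar>inc i\<bar>) \<le> \<epsilon>"
    proof -
      define h where "h = (\<lambda>(x::real, K::real set). (Inf K, Sup K))"
      have p1D: "\<exists>c d. L = {c..d} \<and> a \<le> c \<and> c \<le> x \<and> x \<le> d \<and> d \<le> b \<and> c < d \<and> x \<in> N \<and> (x, L) \<in> p \<and> {c..d} \<subseteq> U" 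
        if xL: "(x, L) \<in> p1" for x L
      proof -
        have "(x, L) \<in> p" "x \<in> N" using xL unfolding p1_def by auto
        then have "L \<subseteq> U" using fineD[OF p(2)] r(2) by blast
        then show ?thesis using K[of x L] xL unfolding p1_def by fastforce
      qed
      have disj: "{Inf L<..<Sup L} \<inter> {Inf L'<..<Sup L'} = {}"
        if i: "(x, L) \<in> p1" and j: "(x', L') \<in> p1" and ij: "(x, L) \<noteq> (x', L')" for x L x' L'
      proof -
        obtain c d where cd: "L = {c..d}" "c < d" "(x, L) \<in> p" using p1D[OF i] by blast
        obtain c' d' where cd': "L' = {c'..d'}" "c' < d'" "(x', L') \<in> p" using p1D[OF j] by blast
        have "interior L \<inter> interior L' = {}"
          using tagged_division_ofD(5)[OF p(1) cd(3) cd'(3)] ij by blast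
        then show ?thesis using cd cd' by simp
      qed
      have inj: "inj_on h p1"
      proof (rule inj_onI, rule ccontr)
        fix i j assume ij: "i \<in> p1" "j \<in> p1" "h i = h j" "i \<noteq> j"
        obtain x L x' L' where e: "i = (x, L)" "j = (x', L')" by (cases i; cases j)
        obtain c d where "L = {c..d}" "c < d" using p1D[of x L] ij e by blast
        then show False using disj[of x L x' L'] ij e unfolding h_def by simp
      qed
      have disjoint: "disjoint_family_on (\<lambda>(c, d). {c<..<d}) (h ` p1)"
        unfolding disjoint_family_on_def h_def using disj by fastforce
      have range: "a \<le> c \<and> c \<le> d \<and> d \<le> b \<and> {c<..<d} \<subseteq> U" if cd: "(c, d) \<in> h ` p1" for c d
      proof -
        obtain x L where "(x, L) \<in> p1" "c = Inf L" "d = Sup L" using cd unfolding h_def by auto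
        moreover obtain c' d' where "L = {c'..d'}" "a \<le> c'" "d' \<le> b" "c' < d'" "{c'..d'} \<subseteq> U"
          using p1D[of x L] calculation(1) by blast
        ultimately show ?thesis by fastforce
      qed
      have "(\<Sum>(c, d)\<in>h ` p1. d - c) = (\<Sum>i\<in>h ` p1. measure lebesgue ((\<lambda>(c, d). {c<..<d}) i))"
        using range by (intro sum.cong) auto
      also have "\<dots> = measure lebesgue (\<Union>i\<in>h ` p1. (\<lambda>(c, d). {c<..<d}) i)"
        using fin12 disjoint range by (intro measure_finite_Union[symmetric]) auto
      also have "\<dots> \<le> measure lebesgue U"
      proof (rule measure_mono_fmeasurable[OF _ _ U'(1)])
        show "(\<Union>i\<in>h ` p1. (\<lambda>(c, d). {c<..<d}) i) \<subseteq> U"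
        proof (rule UN_least)
          show "(\<lambda>(c, d). {c<..<d}) i \<subseteq> U" if "i \<in> h ` p1" for i using range that by (cases i) auto
        qed
        show "(\<Union>i\<in>h ` p1. (\<lambda>(c, d). {c<..<d}) i) \<in> sets lebesgue"
          using fin12 by (intro sets.finite_UN) (auto split: prod.split)
      qed
      finally have "(\<Sum>(c, d)\<in>h ` p1. d - c) < \<eta>" using U'(2) by simp
      then have "(\<Sum>(c, d)\<in>h ` p1. \<bar>f d - f c\<bar>) < \<epsilon>"
        using fin12 disjoint range by (intro ac') auto
      also have "(\<Sum>(c, d)\<in>h ` p1. \<bar>f d - f c\<bar>) = (\<Sum>i\<in>p1. \<bar>inc i\<bar>)"
        by (subst sum.reindex[OF inj]) (auto simp: h_def inc_def intro!: sum.cong)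
      finally show ?thesis by simp
    qed
    also have "(\<Sum>i\<in>p2. \<bar>inc i\<bar>) \<le> (\<Sum>(x, K)\<in>p2. \<epsilon> * measure lborel K)"
    proof (rule sum_mono, clarify)
      fix x L assume xL: "(x, L) \<in> p2"
      then have xp: "(x, L) \<in> p" "x \<notin> N" unfolding p2_def by auto
      then obtain c d where cd: "L = {c..d}" "a \<le> c" "c \<le> x" "x \<le> d" "d \<le> b" using K by blast
      have "{c..d} \<subseteq> ball x (r x)" using fineD[OF p(2) xp(1)] cd by simp
      moreover have "c \<in> {c..d}" "d \<in> {c..d}" using cd by auto
      ultimately have "c \<in> ball x (r x)" "d \<in> ball x (r x)" by blast+
      then have "\<bar>f c - f x\<bar> \<le> \<epsilon> * \<bar>c - x\<bar>" "\<bar>f d - f x\<bar> \<le> \<epsilon> * \<bar>d - x\<bar>"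
        using r(3)[OF xp(2), of c] r(3)[OF xp(2), of d] cd by auto
      moreover have "\<epsilon> * \<bar>c - x\<bar> + \<epsilon> * \<bar>d - x\<bar> = \<epsilon> * (d - c)" using cd by (simp add: algebra_simps)
      ultimately have "\<bar>f d - f c\<bar> \<le> \<epsilon> * (d - c)" by linarith
      then show "\<bar>inc (x, L)\<bar> \<le> \<epsilon> * measure lborel L" unfolding inc_def using cd by simp
    qed
    also have "\<dots> \<le> (\<Sum>(x, K)\<in>p. \<epsilon> * measure lborel K)"
      using fin \<epsilon> by (intro sum_mono2) (auto simp: p2_def)
    also have "\<dots> = \<epsilon> * (b - a)"
      using additive_content_tagged_division[of p a b] p(1) \<open>a \<le> b\<close>
      by (simp add: sum_distrib_left[symmetric] split_def cbox_interval)
    finally show ?thesis by (simp add: algebra_simps)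
  qed
  have "\<bar>f b - f a\<bar> \<le> 0"
  proof (rule field_le_epsilon)
    fix e :: real assume "e > 0"
    then show "\<bar>f b - f a\<bar> \<le> 0 + e"
      using bound[of "e / (1 + (b - a))"] \<open>a \<le> b\<close> by simp
  qed
  then show ?thesis by simp
qed

lemma abs_continuous_diff_lipschitz:
  assumes ac: "abs_continuous_on_Icc a b f" and L: "L-lipschitz_on {a..b} g"
  shows "abs_continuous_on_Icc a b (\<lambda>x. f x - g x)"
  unfolding abs_continuous_on_Icc_def
proof (intro allI impI)
  fix \<epsilon> :: real assume \<epsilon>: "\<epsilon> > 0"
  have "L \<ge> 0" using L by (rule lipschitz_on_nonneg)
  have "\<epsilon> / 2 > 0" using \<epsilon> by simp
  then obtain \<eta> where \<eta>: "\<eta> > 0" and ac': "\<forall>P. finite P \<and> (\<forall>(c, d)\<in>P. a \<le> c \<and> c \<le> d \<and> d \<le> b) \<and>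
      disjoint_family_on (\<lambda>(c, d). {c<..<d}) P \<and> (\<Sum>(c, d)\<in>P. d - c) < \<eta> \<longrightarrow>
      (\<Sum>(c, d)\<in>P. \<bar>f d - f c\<bar>) < \<epsilon> / 2"
    using ac unfolding abs_continuous_on_Icc_def by blast
  show "\<exists>\<eta>>0. \<forall>P. finite P \<and> (\<forall>(c, d)\<in>P. a \<le> c \<and> c \<le> d \<and> d \<le> b) \<and>
      disjoint_family_on (\<lambda>(c, d). {c<..<d}) P \<and> (\<Sum>(c, d)\<in>P. d - c) < \<eta> \<longrightarrow>
      (\<Sum>(c, d)\<in>P. \<bar>f d - g d - (f c - g c)\<bar>) < \<epsilon>"
  proof (intro exI[of _ "min \<eta> (\<epsilon> / (2 * (L + 1)))"] conjI allI impI)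
    show "0 < min \<eta> (\<epsilon> / (2 * (L + 1)))" using \<eta> \<epsilon> \<open>L \<ge> 0\<close> by simp
    fix P :: "(real \<times> real) set" assume P: "finite P \<and> (\<forall>(c, d)\<in>P. a \<le> c \<and> c \<le> d \<and> d \<le> b) \<and>
      disjoint_family_on (\<lambda>(c, d). {c<..<d}) P \<and> (\<Sum>(c, d)\<in>P. d - c) < min \<eta> (\<epsilon> / (2 * (L + 1)))"
    have "(\<Sum>(c, d)\<in>P. \<bar>f d - g d - (f c - g c)\<bar>) \<le> (\<Sum>(c, d)\<in>P. \<bar>f d - f c\<bar> + L * (d - c))"
    proof (rule sum_mono, clarify)
      fix c d assume "(c, d) \<in> P"
      then have "dist (g c) (g d) \<le> L * dist c d" "c \<le> d" using P by (auto intro!: lipschitz_onD[OF L])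
      then show "\<bar>f d - g d - (f c - g c)\<bar> \<le> \<bar>f d - f c\<bar> + L * (d - c)"
        unfolding dist_real_def by (smt (verit))
    qed
    also have "\<dots> = (\<Sum>(c, d)\<in>P. \<bar>f d - f c\<bar>) + L * (\<Sum>(c, d)\<in>P. d - c)"
      by (simp add: split_def sum.distrib sum_distrib_left)
    also have "\<dots> < \<epsilon> / 2 + \<epsilon> / 2"
    proof (rule add_less_le_mono)
      show "(\<Sum>(c, d)\<in>P. \<bar>f d - f c\<bar>) < \<epsilon> / 2" using P by (intro ac'[rule_format]) auto
      have "L * (\<Sum>(c, d)\<in>P. d - c) \<le> L * (\<epsilon> / (2 * (L + 1)))"
        using P \<open>L \<ge> 0\<close> by (intro mult_left_mono) auto
      also have "\<dots> \<le> \<epsilon> / 2" using \<epsilon> \<open>L \<ge> 0\<close> by (simp add: field_simps)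
      finally show "L * (\<Sum>(c, d)\<in>P. d - c) \<le> \<epsilon> / 2" .
    qed
    finally show "(\<Sum>(c, d)\<in>P. \<bar>f d - g d - (f c - g c)\<bar>) < \<epsilon>" by simp
  qed
qed

lemma abs_continuous_subset:
  assumes "abs_continuous_on_Icc a b f" "a \<le> c" "d \<le> b"
  shows "abs_continuous_on_Icc c d f"
  unfolding abs_continuous_on_Icc_def
proof (intro allI impI)
  fix \<epsilon> :: real assume "\<epsilon> > 0"
  then obtain \<eta> where \<eta>: "\<eta> > 0" "\<forall>P. finite P \<and> (\<forall>(c, d)\<in>P. a \<le> c \<and> c \<le> d \<and> d \<le> b) \<and>
      disjoint_family_on (\<lambda>(c, d). {c<..<d}) P \<and> (\<Sum>(c, d)\<in>P. d - c) < \<eta> \<longrightarrow>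
      (\<Sum>(c, d)\<in>P. \<bar>f d - f c\<bar>) < \<epsilon>"
    using assms(1) unfolding abs_continuous_on_Icc_def by blast
  show "\<exists>\<eta>>0. \<forall>P. finite P \<and> (\<forall>(x, y)\<in>P. c \<le> x \<and> x \<le> y \<and> y \<le> d) \<and>
      disjoint_family_on (\<lambda>(c, d). {c<..<d}) P \<and> (\<Sum>(c, d)\<in>P. d - c) < \<eta> \<longrightarrow>
      (\<Sum>(c, d)\<in>P. \<bar>f d - f c\<bar>) < \<epsilon>"
  proof (intro exI[of _ \<eta>] conjI allI impI)
    fix P :: "(real \<times> real) set" assume P: "finite P \<and> (\<forall>(x, y)\<in>P. c \<le> x \<and> x \<le> y \<and> y \<le> d) \<and>
      disjoint_family_on (\<lambda>(c, d). {c<..<d}) P \<and> (\<Sum>(c, d)\<in>P. d - c) < \<eta>"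
    then have "\<forall>(x, y)\<in>P. a \<le> x \<and> x \<le> y \<and> y \<le> b" using assms(2,3) by fastforce
    then show "(\<Sum>(c, d)\<in>P. \<bar>f d - f c\<bar>) < \<epsilon>" using P \<eta>(2) by blast
  qed (rule \<eta>(1))
qed

text \<open>The primitive \<open>G\<close> of the continuous \<open>g\<close> is Lipschitz, so
  \<open>f - G\<close> is absolutely continuous with zero derivative almost everywhere, hence
  constant. Thus the almost everywhere derivative is a derivative at every interior point.\<close>

lemma abs_continuous_has_derivative:
  fixes f g :: "real \<Rightarrow> real"
  assumes ac: "abs_continuous_on_Icc a b f" and g: "continuous_on {a..b} g"
    and ae: "AE t in lebesgue. t \<in> {a<..<b} \<longrightarrow> (f has_real_derivative g t) (at t)"
    and t: "t \<in> {a<..<b}"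
  shows "(f has_real_derivative g t) (at t)"
proof -
  define G where "G s = integral {a..s} g" for s
  have G: "(G has_real_derivative g s) (at s within {a..b})" if "s \<in> {a..b}" for s
    unfolding G_def has_real_derivative_iff_has_vector_derivative
    using integral_has_vector_derivative[OF g] that by auto
  obtain L where L: "\<And>s. s \<in> {a..b} \<Longrightarrow> norm (g s) \<le> L" "L \<ge> 0"
  proof -
    have "bounded (g ` {a..b})" using g by (intro compact_imp_bounded compact_continuous_image) auto
    then show ?thesis using that unfolding bounded_pos by (metis image_eqI less_imp_le)
  qed
  have "L-lipschitz_on {a..b} G"
    using G L by (intro bounded_derivative_imp_lipschitz[of "{a..b}" G "\<lambda>s h. g s * h"])
      (auto simp: has_field_derivative_def abs_mult intro!: onorm_bound mult_right_mono)
  then have ac_diff: "abs_continuous_on_Icc a b (\<lambda>x. f x - G x)" by (rule abs_continuous_diff_lipschitz[OF ac])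
  obtain N where N: "negligible N" "\<And>s. s \<in> {a<..<b} - N \<Longrightarrow> (f has_real_derivative g s) (at s)"
  proof -
    from AE_E[OF ae] obtain N where "{s \<in> space lebesgue. \<not> (s \<in> {a<..<b} \<longrightarrow> (f has_real_derivative g s) (at s))} \<subseteq> N"
      "emeasure lebesgue N = 0" "N \<in> sets lebesgue" .
    then show ?thesis by (intro that[of N]) (auto simp: negligible_iff_null_sets)
  qed
  have eq: "f s = f a + G s" if s: "s \<in> {a..b}" for s
  proof -
    have "f s - G s = f a - G a"
    proof (rule abs_continuous_zero_derivative[of a s "\<lambda>x. f x - G x" "N \<union> {a, b}"])
      show "abs_continuous_on_Icc a s (\<lambda>x. f x - G x)" using s by (intro abs_continuous_subset[OF ac_diff]) auto
      show "negligible (N \<union> {a, b})" using N by (intro negligible_Un) auto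
      fix x assume x: "x \<in> {a..s} - (N \<union> {a, b})"
      then have xab: "x \<in> {a<..<b} - N" "x \<in> {a..b}" using s by auto
      have "(f has_real_derivative g x) (at x within {a..b})" using N(2)[OF xab(1)] by (rule has_field_derivative_at_within)
      from DERIV_diff[OF this G[OF xab(2)]]
      show "((\<lambda>x. f x - G x) has_real_derivative 0) (at x within {a..s})"
        using s by (auto intro: DERIV_subset)
    qed (use s in auto)
    then show ?thesis unfolding G_def by simp
  qed
  have "((\<lambda>s. f a + G s) has_real_derivative 0 + g t) (at t within {a..b})"
    using t by (intro DERIV_add DERIV_const G) auto
  then have "(f has_real_derivative g t) (at t within {a..b})"
    unfolding add_0
    by (rule has_field_derivative_transform_within[where d = 1]) (use t in \<open>auto intro: eq[symmetric]\<close>)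
  moreover have "at t within {a..b} = at t" using t by (intro at_within_interior) auto
  ultimately show ?thesis by (simp only:)
qed

text \<open>The intermediate point of the mean value theorem depends on the test vector, but norm
  continuity of \<open>g\<close> at \<open>t\<close> controls all nearby points uniformly. Hence the
  remainder itself may serve as test vector.\<close>

lemma weak_derivative_imp_has_vector_derivative:
  fixes f g :: "real \<Rightarrow> 'a::real_inner"
  assumes r: "r > 0" and deriv: "\<And>s w. s \<in> ball t r \<Longrightarrow> ((\<lambda>s. f s \<bullet> w) has_real_derivative g s \<bullet> w) (at s)"
    and g: "isCont g t"
  shows "(f has_vector_derivative g t) (at t)"
  unfolding has_vector_derivative_def has_derivative_within_alt
proof (intro conjI allI impI)
  show "bounded_linear (\<lambda>x. x *\<^sub>R g t)" by (rule bounded_linear_scaleR_left)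
  fix e :: real assume e: "e > 0"
  then obtain d where d: "d > 0" "\<And>s. dist s t < d \<Longrightarrow> dist (g s) (g t) < e"
    using g unfolding continuous_at_eps_delta by blast
  have "norm (f s - f t - (s - t) *\<^sub>R g t) \<le> e * norm (s - t)" if s: "norm (s - t) < min d r" for s
  proof -
    define w where "w = f s - f t - (s - t) *\<^sub>R g t"
    have mvt: "\<exists>z>p. z < q \<and> f q \<bullet> w - f p \<bullet> w = (q - p) * (g z \<bullet> w)"
      if "p < q" "{p..q} \<subseteq> ball t r" for p q
      using that by (intro MVT2 deriv) auto
    have "\<exists>z. \<bar>z - t\<bar> \<le> \<bar>s - t\<bar> \<and> f s \<bullet> w - f t \<bullet> w = (s - t) * (g z \<bullet> w)"
    proof (cases s t rule: linorder_cases)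
      case less
      then obtain z where "s < z" "z < t" "f t \<bullet> w - f s \<bullet> w = (t - s) * (g z \<bullet> w)"
        using mvt[of s t] s by (auto simp: dist_real_def subset_iff)
      moreover from this(3) have "f s \<bullet> w - f t \<bullet> w = (s - t) * (g z \<bullet> w)" by (simp add: algebra_simps)
      ultimately show ?thesis by (intro exI[of _ z]) auto
    next
      case greater
      then obtain z where "t < z" "z < s" "f s \<bullet> w - f t \<bullet> w = (s - t) * (g z \<bullet> w)"
        using mvt[of t s] s by (auto simp: dist_real_def subset_iff)
      then show ?thesis by (intro exI[of _ z]) auto
    qed auto
    then obtain z where z: "\<bar>z - t\<bar> \<le> \<bar>s - t\<bar>" "f s \<bullet> w - f t \<bullet> w = (s - t) * (g z \<bullet> w)" by blast
    have gz: "norm (g z - g t) \<le> e" using d(2)[of z] z(1) s by (simp add: dist_norm)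
    have "(norm w)\<^sup>2 = (s - t) * ((g z - g t) \<bullet> w)"
      using z(2) unfolding power2_norm_eq_inner by (subst (1) w_def) (simp add: inner_diff_left algebra_simps)
    also have "\<dots> \<le> \<bar>s - t\<bar> * \<bar>(g z - g t) \<bullet> w\<bar>" by (metis abs_ge_self abs_mult)
    also have "\<dots> \<le> \<bar>s - t\<bar> * (e * norm w)"
      using Cauchy_Schwarz_ineq2[of "g z - g t" w] mult_right_mono[OF gz, of "norm w"]
      by (intro mult_left_mono) auto
    finally have "norm w * norm w \<le> (e * \<bar>s - t\<bar>) * norm w" by (simp add: power2_eq_square mult_ac)
    then have "norm w \<le> e * \<bar>s - t\<bar>" using e by (cases "w = 0") auto
    then show ?thesis unfolding w_def by simp
  qed
  then show "\<exists>d>0. \<forall>y\<in>UNIV. norm (y - t) < d \<longrightarrow> norm (f y - f t - (y - t) *\<^sub>R g t) \<le> e * norm (y - t)"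
    using d(1) r by (intro exI[of _ "min d r"]) auto
qed

section \<open>Reduction to ordinary differential equations\<close>

text \<open>The system satisfied by \<open>x = l\<^sup>2 |v|\<^sup>2\<close>, \<open>y = |v'|\<^sup>2\<close>, \<open>c = l \<langle>v, v'\<rangle>\<close> when
  \<open>v'' + 2 \<delta> v' + l\<^sup>2 v = 0\<close>.\<close>

definition damped_mode ::
  "real \<Rightarrow> (real \<Rightarrow> real) \<Rightarrow> (real \<Rightarrow> real) \<Rightarrow> (real \<Rightarrow> real) \<Rightarrow> (real \<Rightarrow> real) \<Rightarrow> bool" where
  "damped_mode l \<delta> x y c \<longleftrightarrow>
     continuous_on {0..} x \<and> continuous_on {0..} y \<and> continuous_on {0..} c \<and>
     (\<forall>t\<ge>0. 0 \<le> x t \<and> 0 \<le> y t \<and> 2 * \<bar>c t\<bar> \<le> x t + y t) \<and>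
     (\<forall>T>0. \<exists>S. finite S \<and> (\<forall>t\<in>{0<..<T} - S.
        (x has_real_derivative 2 * l * c t) (at t) \<and>
        (y has_real_derivative - 4 * \<delta> t * y t - 2 * l * c t) (at t) \<and>
        (c has_real_derivative l * y t - 2 * \<delta> t * c t - l * x t) (at t)))"

context complete_projections
begin

lemma energy_sums:
  assumes sol: "weak_solution (diag (\<lambda>k. (a k)\<^sup>2)) \<delta> u u'" and a: "\<And>k. a k > 0" and t: "t \<ge> 0"
  shows "(\<lambda>k. (norm (a k *\<^sub>R P k (u t)))\<^sup>2 + (norm (P k (u' t)))\<^sup>2) sums energy (diag (\<lambda>k. (a k)\<^sup>2)) u u' t"
proof -
  have "u t \<in> dom (diag a)" using sol t unfolding weak_solution_def operator_sqrt_diag[OF a] by blast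
  then show ?thesis
    unfolding energy_def operator_sqrt_diag[OF a]
    using sums_add[OF norm_sums[of "the (diag a (u t))"] norm_sums[of "u' t"]]
    by (simp add: proj_diag add.commute)
qed

text \<open>The test vectors are \<open>P k z\<close>, on which the root of the operator acts as
  multiplication by \<open>a k\<close>; the weak equation becomes a scalar equation for
  \<open>P k (u' t) \<bullet> z\<close>. Where \<delta> is continuous its right side is continuous,
  so it holds everywhere on \<open>U\<close>, and letting \<open>z\<close> vary gives the norm
  derivative.\<close>

lemma weak_solution_has_derivative:
  fixes k :: nat
  assumes sol: "weak_solution (diag (\<lambda>k. (a k)\<^sup>2)) \<delta> u u'" and a: "\<And>k. a k > 0"
    and U: "open U" "U \<subseteq> {0<..}" "\<And>t. t \<in> U \<Longrightarrow> isCont \<delta> t" and t: "t \<in> U"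
  defines "g \<equiv> \<lambda>t. (- 2 * \<delta> t) *\<^sub>R P k (u' t) - (a k)\<^sup>2 *\<^sub>R P k (u t)"
  shows "((\<lambda>t. P k (u' t)) has_vector_derivative g t) (at t)"
proof -
  note w = sol[unfolded weak_solution_def operator_sqrt_diag[OF a]]
  have cont: "isCont (\<lambda>t. P k (u t)) s" "isCont (\<lambda>t. P k (u' t)) s" if "s > 0" for s
  proof -
    have "continuous_on {0<..} u" "continuous_on {0<..} u'" using w by (auto intro: continuous_on_subset)
    then have "continuous_on {0<..} (\<lambda>t. P k (u t))" "continuous_on {0<..} (\<lambda>t. P k (u' t))"
      by (auto intro: bounded_linear.continuous_on[OF proj_bounded_linear])
    then show "isCont (\<lambda>t. P k (u t)) s" "isCont (\<lambda>t. P k (u' t)) s"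
      using that by (auto simp: continuous_on_eq_continuous_at)
  qed
  have g: "isCont g s" if "s \<in> U" for s
    unfolding g_def using cont[of s] U(2,3) that by (intro continuous_intros) auto
  obtain r where r: "r > 0" "ball t r \<subseteq> U" using U(1) t open_contains_ball by blast
  show ?thesis
  proof (rule weak_derivative_imp_has_vector_derivative[OF r(1) _ g[OF t]])
    fix s z assume "s \<in> ball t r"
    then obtain e where e: "e > 0" "cball s e \<subseteq> U" using r(2) U(1) open_contains_cball by (metis subsetD)
    define p where "p = P k z"
    have p: "p \<in> dom (diag a)" "the (diag a p) = a k *\<^sub>R p" unfolding p_def using diag_proj[of a k z] by auto
    have cball: "{s - e..s + e} \<subseteq> U" using e(2) by (simp add: cball_eq_atLeastAtMost)
    have eq: "(the (diag a (u \<tau>))) \<bullet> (a k *\<^sub>R p) = (a k)\<^sup>2 * (P k (u \<tau>) \<bullet> z)" if "\<tau> \<ge> 0" for \<tau>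
    proof -
      have "u \<tau> \<in> dom (diag a)" using w that by blast
      then show ?thesis unfolding p_def by (simp add: sym[symmetric] proj_diag power2_eq_square)
    qed
    have AE: "AE \<tau> in lebesgue. 0 \<le> \<tau> \<longrightarrow> (\<exists>d. ((\<lambda>s. u' s \<bullet> p) has_real_derivative d) (at \<tau> within {0..}) \<and>
                d + 2 * \<delta> \<tau> * (u' \<tau> \<bullet> p) + the (diag a (u \<tau>)) \<bullet> the (diag a p) = 0)"
      using w p(1) by blast
    have "((\<lambda>s. u' s \<bullet> p) has_real_derivative g s \<bullet> z) (at s)"
    proof (rule abs_continuous_has_derivative[of "s - e" "s + e" _ "\<lambda>s. g s \<bullet> z"])
      have pos: "s + e > 0" "s - e > 0" using cball U(2) e(1) by (auto dest!: subsetD[of _ _ "s - e"])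
      then have "abs_continuous_on_Icc 0 (s + e) (\<lambda>s. u' s \<bullet> p)" using w p(1) by blast
      from abs_continuous_subset[OF this, of "s - e" "s + e"] pos
      show "abs_continuous_on_Icc (s - e) (s + e) (\<lambda>s. u' s \<bullet> p)" by simp
      show "continuous_on {s - e..s + e} (\<lambda>s. g s \<bullet> z)"
        using g cball by (intro continuous_at_imp_continuous_on ballI continuous_intros) auto
      show "AE \<tau> in lebesgue. \<tau> \<in> {s - e<..<s + e} \<longrightarrow> ((\<lambda>s. u' s \<bullet> p) has_real_derivative g \<tau> \<bullet> z) (at \<tau>)"
        using AE
      proof (rule AE_mp, intro AE_I2 impI)
        fix \<tau> assume \<tau>: "\<tau> \<in> {s - e<..<s + e}" and L: "0 \<le> \<tau> \<longrightarrow>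
          (\<exists>d. ((\<lambda>s. u' s \<bullet> p) has_real_derivative d) (at \<tau> within {0..}) \<and>
               d + 2 * \<delta> \<tau> * (u' \<tau> \<bullet> p) + the (diag a (u \<tau>)) \<bullet> the (diag a p) = 0)"
        have pos: "\<tau> > 0" using \<tau> cball U(2) by (auto dest!: subsetD[of _ _ \<tau>])
        then obtain d where d: "((\<lambda>s. u' s \<bullet> p) has_real_derivative d) (at \<tau> within {0..})"
          "d + 2 * \<delta> \<tau> * (u' \<tau> \<bullet> p) + the (diag a (u \<tau>)) \<bullet> the (diag a p) = 0"
          using L by auto
        have "d = - 2 * \<delta> \<tau> * (u' \<tau> \<bullet> p) - (a k)\<^sup>2 * (P k (u \<tau>) \<bullet> z)"
          using d(2) eq[of \<tau>] pos unfolding p(2) by linarith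
        also have "\<dots> = g \<tau> \<bullet> z"
          unfolding g_def p_def by (simp add: sym[symmetric] inner_diff_left)
        finally have "d = g \<tau> \<bullet> z" .
        moreover have "at \<tau> within {0..} = at \<tau>" using pos by (intro at_within_interior) (simp add: interior_Ici)
        ultimately show "((\<lambda>s. u' s \<bullet> p) has_real_derivative g \<tau> \<bullet> z) (at \<tau>)" using d(1) by simp
      qed
    qed (use e(1) in auto)
    then show "((\<lambda>s. P k (u' s) \<bullet> z) has_real_derivative g s \<bullet> z) (at s)" unfolding p_def sym .
  qed
qed

text \<open>Where \<delta> is continuous the components solve the equation classically, and the
  product rule closes up in three scalar quantities. The bound on the third is the Cauchy-Schwarz
  inequality.\<close>

lemma weak_solution_damped_mode:
  assumes sol: "weak_solution (diag (\<lambda>k. (a k)\<^sup>2)) \<delta> u u'" and a: "\<And>k. a k > 0"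
    and \<delta>: "\<And>T. T > 0 \<Longrightarrow> \<exists>S. finite S \<and> (\<forall>t\<in>{0<..<T} - S. isCont \<delta> t)"
  shows "damped_mode (a k) \<delta> (\<lambda>t. (norm (a k *\<^sub>R P k (u t)))\<^sup>2) (\<lambda>t. (norm (P k (u' t)))\<^sup>2)
    (\<lambda>t. a k * (P k (u t) \<bullet> P k (u' t)))"
  unfolding damped_mode_def
proof (intro conjI allI impI)
  note w = sol[unfolded weak_solution_def operator_sqrt_diag[OF a]]
  have "continuous_on {0..} (\<lambda>t. P k (u t))" "continuous_on {0..} (\<lambda>t. P k (u' t))"
    using w by (auto intro: bounded_linear.continuous_on[OF proj_bounded_linear])
  then show "continuous_on {0..} (\<lambda>t. (norm (a k *\<^sub>R P k (u t)))\<^sup>2)"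
    "continuous_on {0..} (\<lambda>t. (norm (P k (u' t)))\<^sup>2)"
    "continuous_on {0..} (\<lambda>t. a k * (P k (u t) \<bullet> P k (u' t)))"
    by (auto intro!: continuous_intros)
  show "2 * \<bar>a k * (P k (u t) \<bullet> P k (u' t))\<bar> \<le> (norm (a k *\<^sub>R P k (u t)))\<^sup>2 + (norm (P k (u' t)))\<^sup>2" for t
  proof -
    have "\<bar>a k * (P k (u t) \<bullet> P k (u' t))\<bar> \<le> norm (a k *\<^sub>R P k (u t)) * norm (P k (u' t))"
      using Cauchy_Schwarz_ineq2[of "a k *\<^sub>R P k (u t)" "P k (u' t)"] by simp
    also have "2 * \<dots> \<le> (norm (a k *\<^sub>R P k (u t)))\<^sup>2 + (norm (P k (u' t)))\<^sup>2"
      by (metis (no_types) sum_squares_bound mult.assoc)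
    finally show ?thesis by simp
  qed
  fix T :: real assume "T > 0"
  then obtain S where S: "finite S" "\<forall>t\<in>{0<..<T} - S. isCont \<delta> t" using \<delta> by blast
  show "\<exists>S. finite S \<and> (\<forall>t\<in>{0<..<T} - S.
      ((\<lambda>t. (norm (a k *\<^sub>R P k (u t)))\<^sup>2) has_real_derivative 2 * a k * (a k * (P k (u t) \<bullet> P k (u' t)))) (at t) \<and>
      ((\<lambda>t. (norm (P k (u' t)))\<^sup>2) has_real_derivative
         - 4 * \<delta> t * (norm (P k (u' t)))\<^sup>2 - 2 * a k * (a k * (P k (u t) \<bullet> P k (u' t)))) (at t) \<and>
      ((\<lambda>t. a k * (P k (u t) \<bullet> P k (u' t))) has_real_derivative
         a k * (norm (P k (u' t)))\<^sup>2 - 2 * \<delta> t * (a k * (P k (u t) \<bullet> P k (u' t))) -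
         a k * (norm (a k *\<^sub>R P k (u t)))\<^sup>2) (at t))"
  proof (intro exI[of _ S] conjI ballI S(1))
    fix t assume t: "t \<in> {0<..<T} - S"
    define v v' where "v = (\<lambda>t. P k (u t))" and "v' = (\<lambda>t. P k (u' t))"
    define d where "d = (- 2 * \<delta> t) *\<^sub>R v' t - (a k)\<^sup>2 *\<^sub>R v t"
    have d: "(v' has_vector_derivative d) (at t)"
      unfolding d_def v_def v'_def using S t
      by (intro weak_solution_has_derivative[OF sol a, of "{0<..<T} - S"])
         (auto intro!: open_Diff finite_imp_closed)
    have "(u has_vector_derivative u' t) (at t within {0..})" using w t by auto
    moreover have "at t within {0..} = at t" using t by (intro at_within_interior) (simp add: interior_Ici)
    ultimately have d': "(v has_vector_derivative v' t) (at t)"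
      unfolding v_def v'_def by (metis bounded_linear.has_vector_derivative proj_bounded_linear)
    note ip = bounded_bilinear.has_vector_derivative[OF bounded_bilinear_inner, folded has_real_derivative_iff_has_vector_derivative]
    have "((\<lambda>t. (a k)\<^sup>2 * (v t \<bullet> v t)) has_real_derivative (a k)\<^sup>2 * (v t \<bullet> v' t + v' t \<bullet> v t)) (at t)"
      by (intro DERIV_cmult ip d')
    then show "((\<lambda>t. (norm (a k *\<^sub>R P k (u t)))\<^sup>2) has_real_derivative 2 * a k * (a k * (P k (u t) \<bullet> P k (u' t)))) (at t)"
      unfolding v_def v'_def
      by (simp add: power_mult_distrib power2_norm_eq_inner inner_commute power2_eq_square[of "a k"] algebra_simps)
    have "((\<lambda>t. v' t \<bullet> v' t) has_real_derivative (v' t \<bullet> d + d \<bullet> v' t)) (at t)"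
      by (intro ip d)
    then show "((\<lambda>t. (norm (P k (u' t)))\<^sup>2) has_real_derivative
         - 4 * \<delta> t * (norm (P k (u' t)))\<^sup>2 - 2 * a k * (a k * (P k (u t) \<bullet> P k (u' t)))) (at t)"
      unfolding v_def v'_def d_def
      by (simp add: power2_norm_eq_inner inner_diff_left inner_diff_right inner_commute power2_eq_square[of "a k"] algebra_simps)
    have "((\<lambda>t. a k * (v t \<bullet> v' t)) has_real_derivative a k * (v t \<bullet> d + v' t \<bullet> v' t)) (at t)"
      by (intro DERIV_cmult ip d d')
    then show "((\<lambda>t. a k * (P k (u t) \<bullet> P k (u' t))) has_real_derivative
         a k * (norm (P k (u' t)))\<^sup>2 - 2 * \<delta> t * (a k * (P k (u t) \<bullet> P k (u' t))) -
         a k * (norm (a k *\<^sub>R P k (u t)))\<^sup>2) (at t)"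
      unfolding v_def v'_def d_def
      by (simp add: power_mult_distrib power2_norm_eq_inner inner_diff_right inner_commute power2_eq_square[of "a k"] algebra_simps)
  qed
qed auto

end

section \<open>Damped oscillations\<close>

lemma nonincreasing_off_finite:
  fixes f :: "real \<Rightarrow> real"
  assumes "finite S" "a \<le> b" "continuous_on {a..b} f"
    and deriv: "\<And>t. t \<in> {a<..<b} - S \<Longrightarrow> \<exists>d\<le>0. (f has_real_derivative d) (at t)"
  shows "f b \<le> f a"
proof -
  \<comment> \<open>The default 0 keeps \<open>f'\<close> nonpositive at the exceptional points,
    which do not affect the integral.\<close>
  define f' where "f' t = (if t \<in> {a<..<b} - S then SOME d. d \<le> 0 \<and> (f has_real_derivative d) (at t) else 0)" for t
  have f': "f' t \<le> 0 \<and> (f has_real_derivative f' t) (at t)" if "t \<in> {a<..<b} - S" for t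
    using someI_ex[OF deriv[OF that]] that unfolding f'_def by simp
  have "(f' has_integral (f b - f a)) {a..b}"
    using assms(1-3) f'
    by (intro fundamental_theorem_of_calculus_interior_strong[where S = S])
       (auto simp flip: has_real_derivative_iff_has_vector_derivative)
  moreover have "f' t \<le> 0" for t using f'[of t] by (cases "t \<in> {a<..<b} - S") (auto simp: f'_def)
  ultimately have "f b - f a \<le> 0" using has_integral_le[OF _ has_integral_0, of f' "f b - f a" "{a..b}"] by auto
  then show ?thesis by simp
qed

lemma damped_mode_shift:
  assumes mode: "damped_mode l \<delta> x y c" and s: "s \<ge> 0" and \<delta>: "\<And>t. t \<ge> 0 \<Longrightarrow> \<delta> (t + s) = \<delta> t"
  shows "damped_mode l \<delta> (\<lambda>t. x (t + s)) (\<lambda>t. y (t + s)) (\<lambda>t. c (t + s))"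
  unfolding damped_mode_def
proof (intro conjI allI impI)
  note m = mode[unfolded damped_mode_def]
  have cont: "continuous_on {0..} (\<lambda>t. f (t + s))" if "continuous_on {0..} f" for f :: "real \<Rightarrow> real"
    by (rule continuous_on_compose2[OF that]) (use s in \<open>auto intro!: continuous_intros\<close>)
  show "continuous_on {0..} (\<lambda>t. x (t + s))" "continuous_on {0..} (\<lambda>t. y (t + s))"
    "continuous_on {0..} (\<lambda>t. c (t + s))" using m cont by auto
  show "0 \<le> x (t + s)" "0 \<le> y (t + s)" "2 * \<bar>c (t + s)\<bar> \<le> x (t + s) + y (t + s)" if "t \<ge> 0" for t
    using m that s by auto
  fix T :: real assume "T > 0"
  then obtain S where S: "finite S" "\<And>t. t \<in> {0<..<T + s} - S \<Longrightarrow>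
        (x has_real_derivative 2 * l * c t) (at t) \<and>
        (y has_real_derivative - 4 * \<delta> t * y t - 2 * l * c t) (at t) \<and>
        (c has_real_derivative l * y t - 2 * \<delta> t * c t - l * x t) (at t)"
    using m s by (metis add_pos_nonneg)
  show "\<exists>S. finite S \<and> (\<forall>t\<in>{0<..<T} - S.
      ((\<lambda>t. x (t + s)) has_real_derivative 2 * l * c (t + s)) (at t) \<and>
      ((\<lambda>t. y (t + s)) has_real_derivative - 4 * \<delta> t * y (t + s) - 2 * l * c (t + s)) (at t) \<and>
      ((\<lambda>t. c (t + s)) has_real_derivative l * y (t + s) - 2 * \<delta> t * c (t + s) - l * x (t + s)) (at t))"
  proof (intro exI[of _ "(\<lambda>t. t - s) ` S"] conjI[OF finite_imageI[OF S(1)]] ballI)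
    fix t assume t: "t \<in> {0<..<T} - (\<lambda>t. t - s) ` S"
    then have "t + s \<in> {0<..<T + s} - S" using s by force
    from S(2)[OF this] \<delta>[of t] t
    show "((\<lambda>t. x (t + s)) has_real_derivative 2 * l * c (t + s)) (at t) \<and>
      ((\<lambda>t. y (t + s)) has_real_derivative - 4 * \<delta> t * y (t + s) - 2 * l * c (t + s)) (at t) \<and>
      ((\<lambda>t. c (t + s)) has_real_derivative l * y (t + s) - 2 * \<delta> t * c (t + s) - l * x (t + s)) (at t)"
      by (simp add: DERIV_shift)
  qed
qed

section \<open>Lyapunov estimates for a single frequency\<close>

locale mode =
  fixes l :: real and \<delta> x y c :: "real \<Rightarrow> real"
  assumes mode: "damped_mode l \<delta> x y c" and l_pos: "l > 0" and damping_nonneg: "\<And>t. t \<ge> 0 \<Longrightarrow> \<delta> t \<ge> 0"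
begin

lemma nonneg: "t \<ge> 0 \<Longrightarrow> 0 \<le> x t" "t \<ge> 0 \<Longrightarrow> 0 \<le> y t"
  and abs_c_le: "t \<ge> 0 \<Longrightarrow> 2 * \<bar>c t\<bar> \<le> x t + y t"
  using mode unfolding damped_mode_def by auto

lemma continuous:
  assumes "0 \<le> p"
  shows "continuous_on {p..q} x" "continuous_on {p..q} y" "continuous_on {p..q} c"
  using mode assms unfolding damped_mode_def by (auto intro: continuous_on_subset)

text \<open>The common interface for Lyapunov functions: exceptional points are removed here once,
  and later proofs only differentiate along the system.\<close>

lemma nonincreasing:
  assumes pq: "0 \<le> p" "p \<le> q" and f: "continuous_on {p..q} f"
    and deriv: "\<And>t. t \<in> {p<..<q} \<Longrightarrow> (x has_real_derivative 2 * l * c t) (at t) \<Longrightarrow>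
        (y has_real_derivative - 4 * \<delta> t * y t - 2 * l * c t) (at t) \<Longrightarrow>
        (c has_real_derivative l * y t - 2 * \<delta> t * c t - l * x t) (at t) \<Longrightarrow>
        \<exists>d\<le>0. (f has_real_derivative d) (at t)"
  shows "f q \<le> f p"
proof -
  \<comment> \<open>The endpoint \<open>q + 1\<close> is positive even when \<open>q = 0\<close>, as
    \<open>damped_mode\<close> demands.\<close>
  have "\<exists>S. finite S \<and> (\<forall>t\<in>{0<..<q + 1} - S.
        (x has_real_derivative 2 * l * c t) (at t) \<and>
        (y has_real_derivative - 4 * \<delta> t * y t - 2 * l * c t) (at t) \<and>
        (c has_real_derivative l * y t - 2 * \<delta> t * c t - l * x t) (at t))"
    using mode pq unfolding damped_mode_def by simp
  then obtain S where "finite S" "\<And>t. t \<in> {0<..<q + 1} - S \<Longrightarrow>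
        (x has_real_derivative 2 * l * c t) (at t) \<and>
        (y has_real_derivative - 4 * \<delta> t * y t - 2 * l * c t) (at t) \<and>
        (c has_real_derivative l * y t - 2 * \<delta> t * c t - l * x t) (at t)" by blast
  then show ?thesis
    using pq by (intro nonincreasing_off_finite[OF _ pq(2) f, of S] deriv) auto
qed

lemma energy_antimono:
  assumes "0 \<le> p" "p \<le> q"
  shows "x q + y q \<le> x p + y p"
proof (rule nonincreasing[OF assms])
  show "continuous_on {p..q} (\<lambda>t. x t + y t)" by (intro continuous_intros continuous assms)
  fix t assume t: "t \<in> {p<..<q}"
    and d: "(x has_real_derivative 2 * l * c t) (at t)" "(y has_real_derivative - 4 * \<delta> t * y t - 2 * l * c t) (at t)"
  show "\<exists>d\<le>0. ((\<lambda>t. x t + y t) has_real_derivative d) (at t)"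
    using DERIV_add[OF d] t assms nonneg(2)[of t] damping_nonneg[of t]
    by (intro exI[of _ "2 * l * c t + (- 4 * \<delta> t * y t - 2 * l * c t)"]) simp
qed

text \<open>Damping can only lower \<open>y\<close>, and the exchange term \<open>2 l c\<close> is
  at most \<open>l\<close> times the initial energy. This crude bound serves on short intervals
  where nothing is known about \<delta>, such as the ramps of the pulses.\<close>

lemma growth:
  assumes "0 \<le> p" "p \<le> q"
  shows "x q \<le> x p + l * (x p + y p) * (q - p)" "y q \<le> y p + l * (x p + y p) * (q - p)"
proof -
  have c: "2 * l * \<bar>c t\<bar> \<le> l * (x p + y p)" if "t \<in> {p<..<q}" for t
    using mult_left_mono[of "2 * \<bar>c t\<bar>" "x p + y p" l] abs_c_le[of t] energy_antimono[of p t] assms that l_pos by simp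
  have c': "2 * l * c t \<le> l * (x p + y p)" "- (2 * l * c t) \<le> l * (x p + y p)" if "t \<in> {p<..<q}" for t
  proof -
    have "\<bar>2 * l * c t\<bar> = 2 * l * \<bar>c t\<bar>" using l_pos by (simp add: abs_mult)
    then show "2 * l * c t \<le> l * (x p + y p)" "- (2 * l * c t) \<le> l * (x p + y p)"
      using c[OF that] by linarith+
  qed
  have "x q - l * (x p + y p) * q \<le> x p - l * (x p + y p) * p"
  proof (rule nonincreasing[OF assms])
    show "continuous_on {p..q} (\<lambda>t. x t - l * (x p + y p) * t)" by (intro continuous_intros continuous assms)
    fix t assume t: "t \<in> {p<..<q}" and d: "(x has_real_derivative 2 * l * c t) (at t)"
    show "\<exists>d\<le>0. ((\<lambda>t. x t - l * (x p + y p) * t) has_real_derivative d) (at t)"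
      using c'(1)[OF t] by (intro exI[of _ "2 * l * c t - l * (x p + y p) * 1"] conjI)
        (auto intro!: DERIV_diff d DERIV_cmult DERIV_ident)
  qed
  then show "x q \<le> x p + l * (x p + y p) * (q - p)" by (simp add: algebra_simps)
  have "y q - l * (x p + y p) * q \<le> y p - l * (x p + y p) * p"
  proof (rule nonincreasing[OF assms])
    show "continuous_on {p..q} (\<lambda>t. y t - l * (x p + y p) * t)" by (intro continuous_intros continuous assms)
    fix t assume t: "t \<in> {p<..<q}" and d: "(y has_real_derivative - 4 * \<delta> t * y t - 2 * l * c t) (at t)"
    have "0 \<le> 4 * \<delta> t * y t" using t assms nonneg(2)[of t] damping_nonneg[of t] by simp
    then have "- 4 * \<delta> t * y t - 2 * l * c t - l * (x p + y p) * 1 \<le> 0" using c'(2)[OF t] by simp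
    moreover have "((\<lambda>t. y t - l * (x p + y p) * t) has_real_derivative
        - 4 * \<delta> t * y t - 2 * l * c t - l * (x p + y p) * 1) (at t)"
      by (intro DERIV_diff d DERIV_cmult DERIV_ident)
    ultimately show "\<exists>d\<le>0. ((\<lambda>t. y t - l * (x p + y p) * t) has_real_derivative d) (at t)" by blast
  qed
  then show "y q \<le> y p + l * (x p + y p) * (q - p)" by (simp add: algebra_simps)
qed

text \<open>Gronwall's argument for \<open>y' <= - 4 h y + e\<close>, where \<open>e\<close> bounds
  the exchange term. The response to \<open>e\<close> is overestimated by \<open>e (t - p)\<close>,
  which suffices because pulses are short.\<close>

lemma strong_damping:
  assumes "0 \<le> p" "p \<le> q" and h: "h \<ge> 0" "\<And>t. t \<in> {p<..<q} \<Longrightarrow> h \<le> \<delta> t"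
  shows "y q \<le> exp (- 4 * h * (q - p)) * y p + l * (x p + y p) * (q - p)"
proof -
  define e where "e = l * (x p + y p)"
  have e: "e \<ge> 0" unfolding e_def using nonneg[of p] assms(1) l_pos by simp
  have "(y q - e * (q - p)) * exp (4 * h * (q - p)) \<le> (y p - e * (p - p)) * exp (4 * h * (p - p))"
  proof (rule nonincreasing[OF assms(1,2)])
    show "continuous_on {p..q} (\<lambda>t. (y t - e * (t - p)) * exp (4 * h * (t - p)))"
      by (intro continuous_intros continuous assms)
    fix t assume t: "t \<in> {p<..<q}" and d: "(y has_real_derivative - 4 * \<delta> t * y t - 2 * l * c t) (at t)"
    have D: "((\<lambda>t. (y t - e * (t - p)) * exp (4 * h * (t - p))) has_real_derivative
        ((- 4 * \<delta> t * y t - 2 * l * c t) - e) * exp (4 * h * (t - p)) + (4 * h * exp (4 * h * (t - p))) * (y t - e * (t - p))) (at t)"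
      by (auto intro!: derivative_eq_intros d)
    have eq: "((- 4 * \<delta> t * y t - 2 * l * c t) - e) * exp (4 * h * (t - p)) + (4 * h * exp (4 * h * (t - p))) * (y t - e * (t - p))
        = exp (4 * h * (t - p)) * (- (4 * ((\<delta> t - h) * y t)) + (- (2 * l * c t) - e) - 4 * (h * (e * (t - p))))"
      by (simp add: algebra_simps)
    have le: "exp (4 * h * (t - p)) * (- (4 * ((\<delta> t - h) * y t)) + (- (2 * l * c t) - e) - 4 * (h * (e * (t - p)))) \<le> 0"
    proof -
      have "- (2 * l * c t) \<le> l * (2 * \<bar>c t\<bar>)" using l_pos mult_left_mono[of "- c t" "\<bar>c t\<bar>" l] by simp
      also have "\<dots> \<le> e" unfolding e_def
        using abs_c_le[of t] energy_antimono[of p t] assms(1) t l_pos by (intro mult_left_mono) auto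
      finally have "- (2 * l * c t) - e \<le> 0" by simp
      moreover have "0 \<le> (\<delta> t - h) * y t" using h(2)[OF t] nonneg(2)[of t] t assms(1) by simp
      moreover have "0 \<le> h * (e * (t - p))" using h(1) e t by simp
      ultimately show ?thesis by (intro mult_nonneg_nonpos) auto
    qed
    show "\<exists>d\<le>0. ((\<lambda>t. (y t - e * (t - p)) * exp (4 * h * (t - p))) has_real_derivative d) (at t)"
      using D[unfolded eq] le by blast
  qed
  then have "(y q - e * (q - p)) * exp (4 * h * (q - p)) \<le> y p" by simp
  then have "(y q - e * (q - p)) * exp (4 * h * (q - p)) * exp (- 4 * h * (q - p)) \<le> y p * exp (- 4 * h * (q - p))"
    by (rule mult_right_mono) simp
  moreover have "exp (4 * h * (q - p)) * exp (- 4 * h * (q - p)) = 1" by (simp flip: exp_add)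
  ultimately have "y q - e * (q - p) \<le> y p * exp (- 4 * h * (q - p))"
    by (simp only: mult.assoc mult_1_right)
  moreover have "exp (- 4 * h * (q - p)) * y p = y p * exp (- 4 * h * (q - p))" by (rule mult.commute)
  ultimately show ?thesis unfolding e_def[symmetric] by linarith
qed

text \<open>A quarter of an oscillation exchanges kinetic and potential energy.\<close>

lemma quarter_oscillation:
  assumes "0 \<le> p" and q: "q = p + pi / (2 * l)" and \<delta>: "\<And>t. t \<in> {p<..<q} \<Longrightarrow> \<delta> t = 0"
  shows "x q \<le> y p"
proof -
  have pq: "p \<le> q" using q l_pos by simp
  \<comment> \<open>Without damping the vector with entries \<open>x - y\<close> and
    \<open>2 c\<close> rotates with angular velocity \<open>2 l\<close>, and \<open>f\<close> is one
    of its coordinates in the rotating frame. After the angle \<pi> the sign of \<open>x - y\<close>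
    is reversed.\<close>
  define f where "f t = 2 * c t * sin (2 * l * (t - p)) - (x t - y t) * cos (2 * l * (t - p))" for t
  have "f q \<le> f p"
  proof (rule nonincreasing[OF assms(1) pq])
    show "continuous_on {p..q} f" unfolding f_def by (intro continuous_intros continuous assms)
    fix t assume t: "t \<in> {p<..<q}" 
      and d: "(x has_real_derivative 2 * l * c t) (at t)" "(y has_real_derivative - 4 * \<delta> t * y t - 2 * l * c t) (at t)"
        "(c has_real_derivative l * y t - 2 * \<delta> t * c t - l * x t) (at t)"
    have "(f has_real_derivative 0) (at t)"
      unfolding f_def using d \<delta>[OF t]
      by (auto intro!: derivative_eq_intros d simp: algebra_simps)
    then show "\<exists>d\<le>0. (f has_real_derivative d) (at t)" by blast
  qed
  moreover have "2 * l * (q - p) = pi" using q l_pos by simp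
  ultimately have "x q - y q \<le> y p - x p" unfolding f_def by simp
  then show ?thesis using energy_antimono[OF assms(1) pq] by simp
qed

text \<open>Each pulse occupies the middle third of a block of length \<open>3 \<eta>\<close>, the
  outer thirds being ramps. The first block makes \<open>y\<close> at most \<open>k\<close> times
  the energy, the quarter oscillation turns this into a bound for \<open>x\<close>, and the second
  block bounds \<open>y\<close> again while \<open>x\<close> grows by at most
  \<open>3 l \<eta>\<close> times the energy. This gives the factor \<open>2 k + 3 l \<eta>\<close>
  with \<open>k = exp (- 4 h \<eta>) + 3 l \<eta>\<close>.\<close>

lemma two_pulses:
  assumes p: "0 \<le> p" and \<eta>: "\<eta> > 0" and h: "h \<ge> 0" and r: "r = p + 3 * \<eta> + pi / (2 * l)"
    and pulse1: "\<And>t. t \<in> {p + \<eta><..<p + 2 * \<eta>} \<Longrightarrow> h \<le> \<delta> t"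
    and gap: "\<And>t. t \<in> {p + 3 * \<eta><..<r} \<Longrightarrow> \<delta> t = 0"
    and pulse2: "\<And>t. t \<in> {r + \<eta><..<r + 2 * \<eta>} \<Longrightarrow> h \<le> \<delta> t"
  shows "x (r + 3 * \<eta>) + y (r + 3 * \<eta>) \<le> (2 * exp (- 4 * h * \<eta>) + 9 * l * \<eta>) * (x p + y p)"
proof -
  have pulse: "y (s + 3 * \<eta>) \<le> (exp (- 4 * h * \<eta>) + 3 * l * \<eta>) * (x s + y s)"
    if s: "s \<ge> 0" and d: "\<And>t. t \<in> {s + \<eta><..<s + 2 * \<eta>} \<Longrightarrow> h \<le> \<delta> t" for s
  proof -
    define E where "E = x s + y s"
    have mono: "l * (x t + y t) * \<eta> \<le> l * E * \<eta>" if "t \<ge> s" for t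
      unfolding E_def using energy_antimono[of s t] s that l_pos \<eta> by simp
    have "y (s + 2 * \<eta>) \<le> exp (- 4 * h * \<eta>) * y (s + \<eta>) + l * E * \<eta>"
      using strong_damping[of "s + \<eta>" "s + 2 * \<eta>" h] d s \<eta> h mono[of "s + \<eta>"] by simp
    moreover have "y (s + 3 * \<eta>) \<le> y (s + 2 * \<eta>) + l * E * \<eta>"
      using growth(2)[of "s + 2 * \<eta>" "s + 3 * \<eta>"] s \<eta> mono[of "s + 2 * \<eta>"] by simp
    moreover have "exp (- 4 * h * \<eta>) * y (s + \<eta>) \<le> exp (- 4 * h * \<eta>) * E"
      unfolding E_def using energy_antimono[of s "s + \<eta>"] nonneg(1)[of "s + \<eta>"] s \<eta> by simp
    moreover have "0 \<le> l * E * \<eta>" unfolding E_def using nonneg[OF s] l_pos \<eta> by simp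
    ultimately have "y (s + 3 * \<eta>) \<le> exp (- 4 * h * \<eta>) * E + 3 * (l * E * \<eta>)" by linarith
    then show ?thesis unfolding E_def[symmetric] by (simp add: algebra_simps)
  qed
  define E where "E = x p + y p"
  have "r \<ge> p" "r \<ge> 0" using r p \<eta> l_pos by auto
  then have Er: "x r + y r \<le> E" unfolding E_def using energy_antimono[OF p] by blast
  define k where "k = exp (- 4 * h * \<eta>) + 3 * l * \<eta>"
  have "k \<ge> 0" unfolding k_def using l_pos \<eta> by simp
  have "x r \<le> y (p + 3 * \<eta>)" using p \<eta> r gap by (intro quarter_oscillation) auto
  also have "\<dots> \<le> k * E" unfolding k_def E_def by (rule pulse[OF p pulse1])
  finally have 1: "x r \<le> k * E" .
  have "x (r + 3 * \<eta>) \<le> x r + l * (x r + y r) * (3 * \<eta>)"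
    using growth(1)[of r "r + 3 * \<eta>"] \<open>r \<ge> 0\<close> \<eta> by simp
  also have "l * (x r + y r) * (3 * \<eta>) \<le> l * E * (3 * \<eta>)" using Er l_pos \<eta> by simp
  finally have 2: "x (r + 3 * \<eta>) \<le> k * E + l * E * (3 * \<eta>)" using 1 by simp
  have "y (r + 3 * \<eta>) \<le> k * (x r + y r)" unfolding k_def by (rule pulse[OF \<open>r \<ge> 0\<close> pulse2])
  also have "\<dots> \<le> k * E" using Er \<open>k \<ge> 0\<close> by (rule mult_left_mono)
  finally have "x (r + 3 * \<eta>) + y (r + 3 * \<eta>) \<le> (2 * k + 3 * l * \<eta>) * E" using 2 by (simp add: algebra_simps)
  then show ?thesis unfolding k_def E_def by (simp add: algebra_simps)
qed

text \<open>Under constant damping \<open>D\<close> the function \<open>x + y + (2 D / l) c\<close>, which is comparable to the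
  energy, decays exactly like \<open>exp (- 2 D t)\<close>.\<close>

lemma constant_damping:
  assumes pq: "0 \<le> p" "p \<le> q" and D: "D \<ge> 0" "7 * D \<le> 5 * l" and \<delta>: "\<And>t. t \<in> {p<..<q} \<Longrightarrow> \<delta> t = D"
  shows "x q + y q \<le> 6 * exp (- 2 * D * (q - p)) * (x p + y p)"
proof -
  define F where "F t = x t + y t + (2 * D / l) * c t" for t
  \<comment> \<open>The condition \<open>7 D <= 5 l\<close> keeps the cross term below 5/7 of the
    energy, so \<open>F\<close> lies between 2/7 and 12/7 of it; the quotient of the two is the
    constant 6.\<close>
  have F: "7 * F t \<le> 12 * (x t + y t)" "2 * (x t + y t) \<le> 7 * F t" if "t \<ge> 0" for t
  proof -
    have "\<bar>(2 * D / l) * c t\<bar> = (D / l) * (2 * \<bar>c t\<bar>)" using D l_pos by (simp add: abs_mult)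
    also have "\<dots> \<le> (5 / 7) * (x t + y t)"
      using D l_pos abs_c_le[OF that] by (intro mult_mono) (auto simp: field_simps)
    finally have "7 * ((2 * D / l) * c t) \<le> 5 * (x t + y t)" "- (5 * (x t + y t)) \<le> 7 * ((2 * D / l) * c t)"
      unfolding abs_le_iff by linarith+
    then show "7 * F t \<le> 12 * (x t + y t)" "2 * (x t + y t) \<le> 7 * F t"
      unfolding F_def distrib_left by linarith+
  qed
  have "F q * exp (2 * D * (q - p)) \<le> F p * exp (2 * D * (p - p))"
  proof (rule nonincreasing[OF pq])
    show "continuous_on {p..q} (\<lambda>t. F t * exp (2 * D * (t - p)))"
      unfolding F_def by (intro continuous_intros continuous pq)
    fix t assume t: "t \<in> {p<..<q}" 
      and d: "(x has_real_derivative 2 * l * c t) (at t)" "(y has_real_derivative - 4 * \<delta> t * y t - 2 * l * c t) (at t)"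
        "(c has_real_derivative l * y t - 2 * \<delta> t * c t - l * x t) (at t)"
    have "(F has_real_derivative 2 * l * c t + (- 4 * \<delta> t * y t - 2 * l * c t) + (2 * D / l) * (l * y t - 2 * \<delta> t * c t - l * x t)) (at t)"
      unfolding F_def by (intro DERIV_add DERIV_cmult d)
    moreover have "2 * l * c t + (- 4 * \<delta> t * y t - 2 * l * c t) + (2 * D / l) * (l * y t - 2 * \<delta> t * c t - l * x t) = - 2 * D * F t"
      unfolding F_def \<delta>[OF t] using l_pos by (simp add: field_simps)
    ultimately have F': "(F has_real_derivative - 2 * D * F t) (at t)" by simp
    have "((\<lambda>t. F t * exp (2 * D * (t - p))) has_real_derivative 0) (at t)"
      by (auto intro!: derivative_eq_intros F')
    then show "\<exists>d\<le>0. ((\<lambda>t. F t * exp (2 * D * (t - p))) has_real_derivative d) (at t)" by blast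
  qed
  then have "F q * exp (2 * D * (q - p)) * exp (- 2 * D * (q - p)) \<le> F p * exp (- 2 * D * (q - p))"
    by (intro mult_right_mono) auto
  then have "F q \<le> F p * exp (- 2 * D * (q - p))" by (simp add: mult.assoc flip: exp_add)
  then have "7 * F q \<le> 7 * F p * exp (- 2 * D * (q - p))" by simp
  also have "\<dots> \<le> 12 * (x p + y p) * exp (- 2 * D * (q - p))" using F(1)[OF pq(1)] by (intro mult_right_mono) auto
  also have "\<dots> = 2 * (6 * exp (- 2 * D * (q - p)) * (x p + y p))" by simp
  finally have "7 * F q \<le> 2 * (6 * exp (- 2 * D * (q - p)) * (x p + y p))" .
  from order_trans[OF F(2)[OF order_trans[OF pq]] this] show ?thesis by simp
qed

end

text \<open>Energy is nonincreasing, so that contraction over one period suffices.\<close>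

lemma periodic_contraction_imp_decay:
  assumes mode: "damped_mode l \<delta> x y c" and l: "l > 0" and nonneg: "\<And>t. t \<ge> 0 \<Longrightarrow> \<delta> t \<ge> 0"
    and per: "\<And>t. t \<ge> 0 \<Longrightarrow> \<delta> (t + T) = \<delta> t" and T: "T > 0" and R: "R > 0"
    and contract: "\<And>x y c. damped_mode l \<delta> x y c \<Longrightarrow> x T + y T \<le> exp (- R * T) * (x 0 + y 0)"
    and t: "t \<ge> 0"
  shows "x t + y t \<le> (x 0 + y 0) * exp (- R * max (t - T) 0)"
proof -
  interpret mode l \<delta> x y c using mode l nonneg by unfold_locales
  have per': "\<delta> (t + real n * T) = \<delta> t" if "t \<ge> 0" for t n
  proof (induction n)
    case (Suc n)
    then show ?case using per[of "t + real n * T"] that T by (simp add: algebra_simps)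
  qed simp
  have iter: "x (real n * T) + y (real n * T) \<le> exp (- R * T * real n) * (x 0 + y 0)" for n
  proof (induction n)
    case (Suc n)
    have "damped_mode l \<delta> (\<lambda>t. x (t + real n * T)) (\<lambda>t. y (t + real n * T)) (\<lambda>t. c (t + real n * T))"
      using T per' by (intro damped_mode_shift[OF mode]) auto
    from contract[OF this] have "x (T + real n * T) + y (T + real n * T) \<le> exp (- R * T) * (x (real n * T) + y (real n * T))"
      by simp
    also have "\<dots> \<le> exp (- R * T) * (exp (- R * T * real n) * (x 0 + y 0))"
      using Suc by (intro mult_left_mono) auto
    also have "\<dots> = exp (- R * T * real (Suc n)) * (x 0 + y 0)"
      by (simp add: algebra_simps flip: exp_add)
    finally show ?case by (simp add: algebra_simps)
  qed simp
  \<comment> \<open>The number of completed periods; the unfinished one accounts for the delay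
    \<open>t - T\<close>.\<close>
  define n where "n = nat \<lfloor>t / T\<rfloor>"
  have n: "real n * T \<le> t" "t - T \<le> real n * T"
  proof -
    have "real n = of_int \<lfloor>t / T\<rfloor>" unfolding n_def using t T by simp
    then have "real n \<le> t / T" "t / T \<le> real n + 1" by linarith+
    then show "real n * T \<le> t" "t - T \<le> real n * T" using T by (simp_all add: field_simps)
  qed
  have "x t + y t \<le> x (real n * T) + y (real n * T)" using n T by (intro energy_antimono) auto
  also have "\<dots> \<le> exp (- R * T * real n) * (x 0 + y 0)" by (rule iter)
  also have "\<dots> \<le> exp (- R * max (t - T) 0) * (x 0 + y 0)"
  proof (rule mult_right_mono)
    have "max (t - T) 0 \<le> T * real n" using n T by (simp add: mult.commute)
    then show "exp (- R * T * real n) \<le> exp (- R * max (t - T) 0)" using R by simp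
    show "0 \<le> x 0 + y 0" using local.nonneg[of 0] by simp
  qed
  finally show ?thesis by (simp add: mult.commute)
qed

section \<open>Contraction over one period\<close>

text \<open>The smooth and the step case differ only in the bump used, so \<open>bump\<close> and
  the regularity \<open>Q\<close> are parameters. \<open>bump \<eta> a b\<close> is 1 on the plateau
  and has room \<eta> on each side for ramps. The resulting \<delta> consists of
  \<open>n + 1\<close> pulses separated by \<open>n\<close> gaps, followed by one long plateau of
  height \<open>D\<close>.\<close>

lemma exists_contracting_damping:
  fixes l :: "nat \<Rightarrow> real" and Q :: "(real \<Rightarrow> real) \<Rightarrow> bool"
    and bump :: "real \<Rightarrow> real \<Rightarrow> real \<Rightarrow> real \<Rightarrow> real"
  assumes l: "\<And>k. l k > 0" and R: "R > 0" and n: "n > 0" and T: "T = pi * (\<Sum>k<n. 1 / l k)"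
    and low: "\<And>k. k < n \<Longrightarrow> l k \<le> 2 * (R + l 0)" and high: "\<And>k. k \<ge> n \<Longrightarrow> 7 * (R + l 0) \<le> 5 * l k"
    and bump_nonneg: "\<And>\<eta> a b t. 0 < \<eta> \<Longrightarrow> \<eta> \<le> a \<Longrightarrow> a < b \<Longrightarrow> b + \<eta> \<le> T \<Longrightarrow> 0 \<le> t \<Longrightarrow> 0 \<le> bump \<eta> a b t"
    and bump_one: "\<And>\<eta> a b t. 0 < \<eta> \<Longrightarrow> \<eta> \<le> a \<Longrightarrow> a < b \<Longrightarrow> b + \<eta> \<le> T \<Longrightarrow> t \<in> {a<..<b} \<Longrightarrow> bump \<eta> a b t = 1"
    and bump_zero: "\<And>\<eta> a b t. 0 < \<eta> \<Longrightarrow> \<eta> \<le> a \<Longrightarrow> a < b \<Longrightarrow> b + \<eta> \<le> T \<Longrightarrow> t \<in> {0..T} \<Longrightarrow>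
      t \<notin> {a - \<eta><..<b + \<eta>} \<Longrightarrow> bump \<eta> a b t = 0"
    and Q_bump: "\<And>\<eta> a b. 0 < \<eta> \<Longrightarrow> \<eta> \<le> a \<Longrightarrow> a < b \<Longrightarrow> b + \<eta> \<le> T \<Longrightarrow> Q (bump \<eta> a b)"
    and Q_scale: "\<And>f r. Q f \<Longrightarrow> Q (\<lambda>t. r * f t)" and Q_add: "\<And>f g. Q f \<Longrightarrow> Q g \<Longrightarrow> Q (\<lambda>t. f t + g t)"
  shows "\<exists>\<delta>. Q \<delta> \<and> (\<forall>t\<ge>0. 0 \<le> \<delta> t) \<and>
    (\<forall>k x y c. damped_mode (l k) \<delta> x y c \<longrightarrow> x T + y T \<le> exp (- R * T) * (x 0 + y 0))"
proof -
  define D where "D = R + l 0"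
  have D: "D > 0" "l 0 \<le> D" unfolding D_def using R l[of 0] by auto
  have "1 / l 0 \<le> (\<Sum>k<n. 1 / l k)" using n l by (intro member_le_sum) (auto simp: less_imp_le)
  then have T0: "pi \<le> l 0 * T" unfolding T using l[of 0] by (simp add: field_simps)
  have "0 < l 0 * T" using T0 pi_gt_zero by linarith
  then have "T > 0" using l[of 0] by (simp add: zero_less_mult_iff)
  have "l 0 * T \<le> D * T" using D \<open>T > 0\<close> by (intro mult_right_mono) auto
  then have DT: "3 \<le> D * T" using T0 pi_gt3 by linarith
  \<comment> \<open>The first bound limits the loss caused by pulses and ramps, of total length
    \<open>(3 n + 5) \<eta>\<close>, to 1 in the exponent. The second keeps the error
    \<open>9 l k \<eta> <= 18 D \<eta>\<close> of \<open>two_pulses\<close> below half of the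
    contraction factor.\<close>
  define \<eta> where "\<eta> = min (1 / (2 * D * (3 * real n + 5))) (exp (- R * T) / (36 * D))"
  have \<eta>: "\<eta> > 0" unfolding \<eta>_def using D by simp
  have "\<eta> \<le> 1 / (2 * D * (3 * real n + 5))" unfolding \<eta>_def by simp
  moreover have "0 < 2 * D * (3 * real n + 5)" using D by simp
  ultimately have "\<eta> * (2 * D * (3 * real n + 5)) \<le> 1" by (simp only: pos_le_divide_eq)
  then have \<eta>1: "2 * D * ((3 * real n + 5) * \<eta>) \<le> 1" by (simp only: mult_ac)
  have "\<eta> \<le> exp (- R * T) / (36 * D)" unfolding \<eta>_def by simp
  then have \<eta>2: "18 * D * \<eta> \<le> exp (- R * T) / 2" using D by (simp add: field_simps)
  \<comment> \<open>Chosen so that the exponential term of \<open>two_pulses\<close> uses exactly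
    the other half of the contraction factor.\<close>
  define h where "h = (ln 4 + R * T) / (4 * \<eta>)"
  have h: "h \<ge> 0" "- 4 * h * \<eta> = - (ln 4 + R * T)" unfolding h_def using R \<open>T > 0\<close> \<eta> by auto
  have "exp (- 4 * h * \<eta>) = exp (- R * T) / exp (ln 4)" unfolding h(2) by (simp add: exp_diff exp_minus field_simps)
  then have exp_h: "2 * exp (- 4 * h * \<eta>) = exp (- R * T) / 2" by simp
  \<comment> \<open>\<open>s k\<close> is the start of block \<open>k\<close>; the gap after that
    block is a quarter oscillation for \<open>l k\<close>. All gaps together last
    \<open>T / 2\<close>, hence \<open>s n = T / 2 + 3 n \<eta>\<close>.\<close>
  define s where "s k = (\<Sum>j<k. pi / (2 * l j) + 3 * \<eta>)" for k
  have s_Suc: "s (Suc k) = s k + 3 * \<eta> + pi / (2 * l k)" for k unfolding s_def by simp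
  have s_step: "s k + 3 * \<eta> \<le> s (Suc k)" for k using l[of k] unfolding s_Suc by simp
  have s_mono: "s i \<le> s j" if "i \<le> j" for i j
    by (rule lift_Suc_mono_le[OF _ that]) (use s_step \<eta> in \<open>smt (verit)\<close>)
  have s_nonneg: "0 \<le> s k" for k using s_mono[of 0 k] by (simp add: s_def)
  have s_n: "s n = T / 2 + 3 * real n * \<eta>"
    unfolding s_def T by (simp add: sum.distrib sum_distrib_left sum_divide_distrib mult_ac)
  have "2 * D * ((3 * real n + 5) * \<eta>) < 2 * D * (T / 2)" using \<eta>1 DT by simp
  then have "(3 * real n + 5) * \<eta> < T / 2" using D by simp
  then have fits: "s n + 4 * \<eta> < T - \<eta>" unfolding s_n by (simp add: algebra_simps)
  have pulse: "0 < \<eta>" "\<eta> \<le> s i + \<eta>" "s i + \<eta> < s i + 2 * \<eta>" "(s i + 2 * \<eta>) + \<eta> \<le> T" if "i \<le> n" for i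
    using \<eta> s_nonneg[of i] s_mono[OF that] fits by auto
  have plateau: "0 < \<eta>" "\<eta> \<le> s n + 4 * \<eta>" "s n + 4 * \<eta> < T - \<eta>" "(T - \<eta>) + \<eta> \<le> T"
    using \<eta> s_nonneg[of n] fits by auto
  define P where "P i = bump \<eta> (s i + \<eta>) (s i + 2 * \<eta>)" for i
  define L where "L = bump \<eta> (s n + 4 * \<eta>) (T - \<eta>)"
  define \<delta> where "\<delta> t = (\<Sum>i\<le>n. h * P i t) + D * L t" for t
  have P_nonneg: "0 \<le> P i t" if "i \<le> n" "t \<ge> 0" for i t
    unfolding P_def using bump_nonneg[OF pulse[OF that(1)] that(2)] .
  have L_nonneg: "0 \<le> L t" if "t \<ge> 0" for t unfolding L_def using bump_nonneg[OF plateau that] .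
  have P_zero: "P i t = 0" if "i \<le> n" "t \<in> {0..T}" "t \<le> s i \<or> s i + 3 * \<eta> \<le> t" for i t
    unfolding P_def using bump_zero[OF pulse[OF that(1)] that(2)] that(3) by auto
  have Q: "Q \<delta>"
  proof -
    have "Q (\<lambda>t. (\<Sum>i\<le>m. h * P i t) + D * L t)" if "m \<le> n" for m
      using that
    proof (induction m)
      case 0
      then show ?case unfolding P_def L_def using Q_bump[OF pulse] Q_bump[OF plateau] by (auto intro!: Q_add Q_scale)
    next
      case (Suc m)
      then have "Q (\<lambda>t. ((\<Sum>i\<le>m. h * P i t) + D * L t) + h * P (Suc m) t)"
        using Q_bump[OF pulse[of "Suc m"]] unfolding P_def by (intro Q_add[OF Suc.IH[unfolded P_def]] Q_scale) auto
      then show ?case by (simp add: algebra_simps)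
    qed
    then show ?thesis unfolding \<delta>_def[abs_def] by blast
  qed
  have \<delta>_nonneg: "0 \<le> \<delta> t" if "t \<ge> 0" for t
    unfolding \<delta>_def using P_nonneg[OF _ that] L_nonneg[OF that] h D by (intro add_nonneg_nonneg sum_nonneg) auto
  have \<delta>_pulse: "h \<le> \<delta> t" if k: "k \<le> n" and t: "t \<in> {s k + \<eta><..<s k + 2 * \<eta>}" for k t
  proof -
    have "t \<ge> 0" using t s_nonneg[of k] \<eta> by simp
    have "h = h * P k t" unfolding P_def using bump_one[OF pulse[OF k] t] by simp
    also have "\<dots> \<le> (\<Sum>i\<le>n. h * P i t)" using k h P_nonneg \<open>t \<ge> 0\<close> by (intro member_le_sum) auto
    also have "\<dots> \<le> \<delta> t" unfolding \<delta>_def using L_nonneg[OF \<open>t \<ge> 0\<close>] D by simp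
    finally show ?thesis .
  qed
  have \<delta>_gap: "\<delta> t = 0" if k: "k < n" and t: "t \<in> {s k + 3 * \<eta><..<s (Suc k)}" for k t
  proof -
    have "s (Suc k) \<le> s n" using k by (intro s_mono) simp
    then have tT: "t \<in> {0..T}" using t fits s_nonneg[of k] \<eta> by auto
    have "P i t = 0" if "i \<le> n" for i
    proof (cases "i \<le> k")
      case True
      then show ?thesis using P_zero[OF that tT] s_mono[of i k] t by auto
    next
      case False
      then show ?thesis using P_zero[OF that tT] s_mono[of "Suc k" i] t by auto
    qed
    moreover have "L t = 0" unfolding L_def
      using bump_zero[OF plateau tT] t \<open>s (Suc k) \<le> s n\<close> \<eta> by auto
    ultimately show ?thesis unfolding \<delta>_def by simp
  qed
  have \<delta>_plateau: "\<delta> t = D" if t: "t \<in> {s n + 4 * \<eta><..<T - \<eta>}" for t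
  proof -
    have tT: "t \<in> {0..T}" using t s_nonneg[of n] \<eta> by auto
    have "P i t = 0" if "i \<le> n" for i using P_zero[OF that tT] s_mono[OF that] t \<eta> by auto
    moreover have "L t = 1" unfolding L_def using bump_one[OF plateau t] .
    ultimately show ?thesis unfolding \<delta>_def by simp
  qed
  have "x T + y T \<le> exp (- R * T) * (x 0 + y 0)" if dm: "damped_mode (l k) \<delta> x y c" for k x y c
  proof -
    interpret mode "l k" \<delta> x y c using dm l \<delta>_nonneg by unfold_locales auto
    have E: "x q + y q \<le> x p + y p" if "0 \<le> p" "p \<le> q" for p q using energy_antimono that .
    show ?thesis
    proof (cases "k < n")
      case True
      \<comment> \<open>A low frequency uses only the two blocks around its own gap; before and
        after them monotonicity of the energy suffices.\<close>
      have "x T + y T \<le> x (s (Suc k) + 3 * \<eta>) + y (s (Suc k) + 3 * \<eta>)"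
        using s_nonneg[of "Suc k"] s_mono[of "Suc k" n] True fits \<eta> by (intro E) auto
      also have "\<dots> \<le> (2 * exp (- 4 * h * \<eta>) + 9 * l k * \<eta>) * (x (s k) + y (s k))"
        using True by (intro two_pulses[OF s_nonneg \<eta> h(1) s_Suc] \<delta>_pulse[of k] \<delta>_pulse[of "Suc k"] \<delta>_gap[of k]) auto
      also have "\<dots> \<le> exp (- R * T) * (x (s k) + y (s k))"
      proof (rule mult_right_mono)
        have "9 * l k * \<eta> \<le> 9 * (2 * D) * \<eta>" using low[OF True] \<eta> unfolding D_def by (intro mult_right_mono mult_left_mono) auto
        then show "2 * exp (- 4 * h * \<eta>) + 9 * l k * \<eta> \<le> exp (- R * T)" using exp_h \<eta>2 by linarith
        show "0 \<le> x (s k) + y (s k)" using nonneg[OF s_nonneg] by simp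
      qed
      also have "\<dots> \<le> exp (- R * T) * (x 0 + y 0)" using E[of 0 "s k"] s_nonneg by (intro mult_left_mono) auto
      finally show ?thesis .
    next
      case False
      define p where "p = s n + 4 * \<eta>"
      define q where "q = T - \<eta>"
      have pq: "0 \<le> p" "p \<le> q" "q \<le> T" unfolding p_def q_def using s_nonneg[of n] fits \<eta> by auto
      \<comment> \<open>The plateau has length \<open>T / 2 - (3 n + 5) \<eta>\<close>. Since
        \<open>D T = R T + l 0 * T\<close> and \<open>l 0 * T >= pi > 3\<close>, a loss of at most 1
        leaves the exponent \<open>R T + 2\<close>.\<close>
      have "2 * D * (q - p) = D * T - 2 * D * ((3 * real n + 5) * \<eta>)"
        unfolding p_def q_def s_n by (simp add: algebra_simps)
      then have "R * T + 2 \<le> 2 * D * (q - p)" using \<eta>1 T0 pi_gt3 unfolding D_def distrib_right by linarith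
      then have "exp (- 2 * D * (q - p)) \<le> exp (- (R * T + 2))" by simp
      also have "\<dots> = exp (- R * T) * exp (- 2)" by (simp flip: exp_add)
      finally have e: "6 * exp (- 2 * D * (q - p)) \<le> exp (- R * T) * (6 * exp (- 2))" by simp
      \<comment> \<open>The remaining \<open>exp (- 2)\<close> absorbs the constant 6, because
        \<open>(5/2)^2 = 6.25\<close>.\<close>
      have "(5 / 2 :: real) \<le> exp 1" using exp_lower_Taylor_quadratic[of 1] by simp
      then have "(5 / 2 :: real) * (5 / 2) \<le> exp 1 * exp 1" by (intro mult_mono) auto
      then have "(6 :: real) \<le> exp 2" by (simp flip: exp_add)
      then have six: "6 * exp (- 2) \<le> (1 :: real)" by (simp add: exp_minus field_simps)
      then have e': "6 * exp (- 2 * D * (q - p)) \<le> exp (- R * T)" 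
        using order_trans[OF e mult_left_mono[OF six exp_ge_zero]] by (simp only: mult_1_right)
      have "x T + y T \<le> x q + y q" using pq by (intro E) auto
      also have "\<dots> \<le> 6 * exp (- 2 * D * (q - p)) * (x p + y p)"
        using D high[of k] False \<delta>_plateau unfolding p_def q_def D_def[symmetric]
        by (intro constant_damping[OF pq(1,2), unfolded p_def q_def]) auto
      also have "\<dots> \<le> exp (- R * T) * (x 0 + y 0)"
        using e' E[OF order_refl pq(1)] nonneg[OF pq(1)] by (intro mult_mono) auto
      finally show ?thesis .
    qed
  qed
  then show ?thesis using Q \<delta>_nonneg by blast
qed

section \<open>Periodic step functions and smooth functions\<close>

text \<open>For \<open>0 < b - a < T\<close> this is the indicator of the translates of
  \<open>[a, b)\<close> by multiples of \<open>T\<close>: the first floor jumps at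
  \<open>a + i T\<close>, the second at \<open>b + i T\<close>.\<close>

definition step_bump :: "real \<Rightarrow> real \<Rightarrow> real \<Rightarrow> real \<Rightarrow> real" where
  "step_bump T a b t = of_int (\<lfloor>(t - a) / T\<rfloor> - \<lfloor>(t - b) / T\<rfloor>)"

text \<open>The constancy intervals of a step function are the level sets of a monotone integer-valued
  function; sums of such functions provide the common refinements.\<close>

definition step_function :: "(real \<Rightarrow> real) \<Rightarrow> bool" where
  "step_function f \<longleftrightarrow> (\<exists>k :: real \<Rightarrow> int. mono k \<and> (\<forall>s t. k s = k t \<longrightarrow> f s = f t))"

lemma step_function_add:
  assumes "step_function f" "step_function g"
  shows "step_function (\<lambda>t. f t + g t)"
proof -
  obtain j k :: "real \<Rightarrow> int" where j: "mono j" "\<forall>s t. j s = j t \<longrightarrow> f s = f t"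
    and k: "mono k" "\<forall>s t. k s = k t \<longrightarrow> g s = g t"
    using assms unfolding step_function_def by blast
  have "mono (\<lambda>t. j t + k t)" using j(1) k(1) by (simp add: mono_def add_mono)
  moreover have "f s + g s = f t + g t" if "j s + k s = j t + k t" for s t
  proof -
    \<comment> \<open>Both functions change in the same direction between \<open>s\<close> and
      \<open>t\<close>, so equal sums force equal summands.\<close>
    have "j s = j t \<and> k s = k t"
      using that monoD[OF j(1), of s t] monoD[OF j(1), of t s] monoD[OF k(1), of s t] monoD[OF k(1), of t s]
      by linarith
    then show ?thesis using j(2) k(2) by metis
  qed
  ultimately show ?thesis unfolding step_function_def by (intro exI[of _ "\<lambda>t. j t + k t"]) blast
qed

lemma step_function_scale: "step_function f \<Longrightarrow> step_function (\<lambda>t. r * f t)"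
  unfolding step_function_def by metis

lemma step_function_bump:
  assumes "T > 0"
  shows "step_function (step_bump T a b)"
proof -
  have floor: "step_function (\<lambda>t. of_int \<lfloor>(t - c) / T\<rfloor>)" for c
    unfolding step_function_def using assms
    by (intro exI[of _ "\<lambda>t. \<lfloor>(t - c) / T\<rfloor>"]) (auto intro!: monoI floor_mono divide_right_mono)
  show ?thesis
    using step_function_add[OF floor[of a] step_function_scale[OF floor[of b], of "-1"]]
    by (simp add: step_bump_def[abs_def])
qed

lemma step_function_piecewise_constant:
  assumes "step_function f"
  shows "piecewise_constant_on_halfline f"
  unfolding piecewise_constant_on_halfline_def
proof (intro allI impI)
  fix T :: real assume "T > 0"
  obtain k :: "real \<Rightarrow> int" where k: "mono k" "\<And>s t. k s = k t \<Longrightarrow> f s = f t"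
    using assms unfolding step_function_def by blast
  define I where "I j = {t \<in> {0..T}. k t = j}" for j
  define P where "P = I ` (k ` {0..T})"
  \<comment> \<open>Monotonicity confines the integer levels on the interval to finitely many
    values.\<close>
  have "k ` {0..T} \<subseteq> {k 0..k T}" using k(1) by (auto simp: mono_def)
  then have "finite (k ` {0..T})" by (rule finite_subset) simp
  then have "finite P" unfolding P_def by (rule finite_imageI)
  moreover have "partition_on {0..T} P"
    unfolding partition_on_def disjoint_def P_def I_def by auto
  moreover have "is_interval J \<and> f constant_on J" if JP: "J \<in> P" for J
  proof
    obtain j where J: "J = I j" using JP unfolding P_def by blast
    have "s \<in> J" if "r \<in> J" "t \<in> J" "r \<le> s" "s \<le> t" for r s t
      using that monoD[OF k(1), of r s] monoD[OF k(1), of s t] unfolding J I_def by auto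
    then show "is_interval J" unfolding is_interval_1 by blast
    show "f constant_on J" unfolding constant_on_def J I_def
    proof (cases "\<exists>t\<in>{0..T}. k t = j")
      case True
      then obtain t where "k t = j" by blast
      then show "\<exists>y. \<forall>x\<in>{t \<in> {0..T}. k t = j}. f x = y" using k(2) by (intro exI[of _ "f t"]) auto
    qed (intro exI[of _ 0], auto)
  qed
  ultimately show "\<exists>P. finite P \<and> partition_on {0..T} P \<and> (\<forall>I\<in>P. is_interval I \<and> f constant_on I)" by blast
qed

lemma step_bump_discontinuities:
  assumes T: "T > 0"
  shows "\<exists>S. finite S \<and> (\<forall>t\<in>{0<..<X} - S. isCont (step_bump T a b) t)"
proof -
  define S where "S c = (\<lambda>i. c + T * of_int i) ` {\<lfloor>(0 - c) / T\<rfloor>..\<lfloor>(X - c) / T\<rfloor>}" for c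
  have cont: "isCont (\<lambda>t. real_of_int \<lfloor>(t - c) / T\<rfloor>) t" if t: "t \<in> {0<..<X} - S c" for t c
  proof -
    have "(t - c) / T \<notin> \<int>"
    proof
      assume "(t - c) / T \<in> \<int>"
      then obtain i where i: "(t - c) / T = of_int i" by (auto elim: Ints_cases)
      have "\<lfloor>(0 - c) / T\<rfloor> \<le> \<lfloor>(t - c) / T\<rfloor>" "\<lfloor>(t - c) / T\<rfloor> \<le> \<lfloor>(X - c) / T\<rfloor>"
        using t T by (intro floor_mono divide_right_mono; simp)+
      then have "i \<in> {\<lfloor>(0 - c) / T\<rfloor>..\<lfloor>(X - c) / T\<rfloor>}" unfolding i by simp
      moreover have "t = c + T * of_int i" using i T by (simp add: field_simps)
      ultimately show False using t unfolding S_def by blast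
    qed
    then have "isCont (real_of_int \<circ> floor) ((t - c) / T)" by (rule continuous_floor)
    moreover have "isCont (\<lambda>t. (t - c) / T) t" using T by (intro continuous_intros) auto
    ultimately show ?thesis using isCont_o2[of t "\<lambda>t. (t - c) / T" "real_of_int \<circ> floor"] by simp
  qed
  show ?thesis
  proof (intro exI[of _ "S a \<union> S b"] conjI ballI)
    show "finite (S a \<union> S b)" unfolding S_def by simp
    show "isCont (step_bump T a b) t" if "t \<in> {0<..<X} - (S a \<union> S b)" for t
      unfolding step_bump_def[abs_def] of_int_diff using that by (intro continuous_diff cont) auto
  qed
qed

lemma step_bump_periodic: "T > 0 \<Longrightarrow> step_bump T a b (t + T) = step_bump T a b t"
proof -
  assume "T > 0"
  then have "(t + T - c) / T = (t - c) / T + 1" for c by (simp add: field_simps)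
  then show ?thesis unfolding step_bump_def by simp
qed

lemma step_bump_nonneg: "T > 0 \<Longrightarrow> a < b \<Longrightarrow> 0 \<le> step_bump T a b t"
  unfolding step_bump_def by (auto intro!: floor_mono divide_right_mono)

lemma step_bump_values:
  assumes "0 < \<eta>" "\<eta> \<le> a" "a < b" "b + \<eta> \<le> T"
  shows "t \<in> {a<..<b} \<Longrightarrow> step_bump T a b t = 1"
    and "t \<in> {0..T} \<Longrightarrow> t \<notin> {a - \<eta><..<b + \<eta>} \<Longrightarrow> step_bump T a b t = 0"
proof -
  have T: "T > 0" using assms by linarith
  have neg: "\<lfloor>(t - c) / T\<rfloor> = -1" if "t < c" "c \<le> t + T" for c
    using that T by (intro floor_unique) (auto simp: field_simps)
  have pos: "\<lfloor>(t - c) / T\<rfloor> = 0" if "c \<le> t" "t < c + T" for c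
    using that T by (intro floor_unique) (auto simp: field_simps)
  show "step_bump T a b t = 1" if "t \<in> {a<..<b}"
    using neg[of b] pos[of a] that assms unfolding step_bump_def by simp
  show "step_bump T a b t = 0" if "t \<in> {0..T}" "t \<notin> {a - \<eta><..<b + \<eta>}"
  proof (cases "t \<le> a - \<eta>")
    case True
    then show ?thesis using neg[of a] neg[of b] that assms unfolding step_bump_def by simp
  next
    case False
    then show ?thesis using pos[of a] pos[of b] that assms unfolding step_bump_def by simp
  qed
qed

section \<open>Smooth functions and a periodic smooth bump\<close>

definition flat_exp :: "nat \<Rightarrow> real \<Rightarrow> real" where
  "flat_exp n x = (if x > 0 then (1 / x) ^ n * exp (- (1 / x)) else 0)"

lemma flat_exp_pos_iff: "0 < flat_exp 0 x \<longleftrightarrow> 0 < x"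
  and flat_exp_nonneg: "0 \<le> flat_exp n x"
  and flat_exp_eq_0: "x \<le> 0 \<Longrightarrow> flat_exp n x = 0"
  unfolding flat_exp_def by auto

lemma power_le_fact_mult_exp:
  fixes x :: real
  assumes "x \<ge> 0"
  shows "x ^ n \<le> fact n * exp x"
proof -
  have "(\<Sum>k\<in>{n}. x ^ k /\<^sub>R fact k) \<le> exp x"
    unfolding exp_def using assms by (intro sum_le_suminf summable_exp_generic) auto
  then show ?thesis by (simp add: divide_inverse[symmetric] field_simps)
qed

text \<open>With \<open>y = 1 / x\<close> this is the estimate
  \<open>y^(n+2) exp (-y) <= (n+2)!\<close>. The quadratic decay at 0 is what makes the derivative
  there vanish.\<close>

lemma flat_exp_le: "\<bar>flat_exp n x\<bar> \<le> fact (n + 2) * x\<^sup>2"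
proof (cases "x > 0")
  case True
  have "(1 / x) ^ (n + 2) * exp (- (1 / x)) \<le> fact (n + 2) * exp (1 / x) * exp (- (1 / x))"
    using True by (intro mult_right_mono power_le_fact_mult_exp) auto
  also have "\<dots> = fact (n + 2)" by (simp add: mult.assoc flip: exp_add)
  finally have "(1 / x) ^ (n + 2) * exp (- (1 / x)) * x\<^sup>2 \<le> fact (n + 2) * x\<^sup>2" by (rule mult_right_mono) simp
  moreover have "(1 / x) ^ (n + 2) * exp (- (1 / x)) * x\<^sup>2 = flat_exp n x * ((1 / x)\<^sup>2 * x\<^sup>2)"
    unfolding flat_exp_def power_add using True by simp
  moreover have "(1 / x)\<^sup>2 * x\<^sup>2 = 1" using True by (simp add: power_divide)
  ultimately show ?thesis using flat_exp_nonneg[of n x] by simp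
qed (simp add: flat_exp_def)

text \<open>The powers of \<open>1 / x\<close> are carried along so that the family, which starts
  with the classical flat function at \<open>n = 0\<close>, is closed under differentiation up to
  linear combinations.\<close>

lemma flat_exp_has_derivative:
  "(flat_exp n has_real_derivative flat_exp (n + 2) x - real n * flat_exp (n + 1) x) (at x)"
proof (cases x "0 :: real" rule: linorder_cases)
  case less
  have "((\<lambda>x. 0) has_real_derivative 0) (at x)" by simp
  then have "(flat_exp n has_real_derivative 0) (at x)"
    by (rule has_field_derivative_transform_within_open[of _ _ _ "{..<0}"]) (use less in \<open>auto simp: flat_exp_def\<close>)
  then show ?thesis using less by (simp add: flat_exp_def)
next
  case equal
  have "((\<lambda>h. flat_exp n h / h) \<longlongrightarrow> 0) (at 0)"
  proof (rule Lim_null_comparison)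
    define K :: real where "K = fact (n + 2)"
    have "norm (flat_exp n h / h) \<le> K * \<bar>h\<bar>" for h
    proof (cases "h = 0")
      case False
      have "\<bar>flat_exp n h\<bar> \<le> K * (\<bar>h\<bar> * \<bar>h\<bar>)"
        using flat_exp_le[of n h] unfolding K_def by (simp add: power2_eq_square)
      then show ?thesis using False by (simp add: pos_divide_le_eq mult.assoc)
    qed simp
    then show "\<forall>\<^sub>F h in at 0. norm (flat_exp n h / h) \<le> K * \<bar>h\<bar>" by simp
    show "((\<lambda>h. K * \<bar>h\<bar>) \<longlongrightarrow> 0) (at 0)"
      by (rule tendsto_eq_intros | simp)+
  qed
  then show ?thesis unfolding equal DERIV_def by (simp add: flat_exp_eq_0)
next
  case greater
  have "((\<lambda>x. (1 / x) ^ n * exp (- (1 / x))) has_real_derivative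
      (real n * (1 / x) ^ (n - 1) * (- (1 / x\<^sup>2))) * exp (- (1 / x)) + (1 / x) ^ n * (exp (- (1 / x)) * (1 / x\<^sup>2))) (at x)"
    using greater by (auto intro!: derivative_eq_intros simp: power2_eq_square)
  moreover have "(real n * (1 / x) ^ (n - 1) * (- (1 / x\<^sup>2))) * exp (- (1 / x)) + (1 / x) ^ n * (exp (- (1 / x)) * (1 / x\<^sup>2))
      = flat_exp (n + 2) x - real n * flat_exp (n + 1) x"
    using greater by (cases n) (auto simp: flat_exp_def power2_eq_square field_simps)
  ultimately have "((\<lambda>x. (1 / x) ^ n * exp (- (1 / x))) has_real_derivative flat_exp (n + 2) x - real n * flat_exp (n + 1) x) (at x)"
    by simp
  then show ?thesis
    by (rule has_field_derivative_transform_within_open[of _ _ _ "{0<..}"]) (use greater in \<open>auto simp: flat_exp_def\<close>)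
qed

text \<open>A class of expressions that contains the bumps and the derivatives of its members.
  Smoothness then follows by iterating a single derivative, without formulas for higher
  ones.\<close>

inductive_set smooth_functions :: "(real \<Rightarrow> real) set" where
  const: "(\<lambda>_. r) \<in> smooth_functions"
| ident: "(\<lambda>t. t) \<in> smooth_functions"
| add: "f \<in> smooth_functions \<Longrightarrow> g \<in> smooth_functions \<Longrightarrow> (\<lambda>t. f t + g t) \<in> smooth_functions"
| mult: "f \<in> smooth_functions \<Longrightarrow> g \<in> smooth_functions \<Longrightarrow> (\<lambda>t. f t * g t) \<in> smooth_functions"
| inverse: "f \<in> smooth_functions \<Longrightarrow> (\<And>t. f t \<noteq> 0) \<Longrightarrow> (\<lambda>t. inverse (f t)) \<in> smooth_functions"
| sin: "f \<in> smooth_functions \<Longrightarrow> (\<lambda>t. sin (f t)) \<in> smooth_functions"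
| cos: "f \<in> smooth_functions \<Longrightarrow> (\<lambda>t. cos (f t)) \<in> smooth_functions"
| flat_exp: "f \<in> smooth_functions \<Longrightarrow> (\<lambda>t. flat_exp n (f t)) \<in> smooth_functions"

lemma smooth_functions_scale: "f \<in> smooth_functions \<Longrightarrow> (\<lambda>t. r * f t) \<in> smooth_functions"
  by (intro smooth_functions.mult smooth_functions.const)

lemma smooth_functions_diff:
  "f \<in> smooth_functions \<Longrightarrow> g \<in> smooth_functions \<Longrightarrow> (\<lambda>t. f t - g t) \<in> smooth_functions"
  using smooth_functions.add[OF _ smooth_functions_scale[of g "-1"], of f] by simp

lemma smooth_functions_derivativeI:
  "g \<in> smooth_functions \<Longrightarrow> (\<And>t. (f has_real_derivative g t) (at t)) \<Longrightarrow>
    \<exists>g\<in>smooth_functions. \<forall>t. (f has_real_derivative g t) (at t)"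
  by blast

lemma smooth_functions_derivative:
  "f \<in> smooth_functions \<Longrightarrow> \<exists>g\<in>smooth_functions. \<forall>t. (f has_real_derivative g t) (at t)"
proof (induction rule: smooth_functions.induct)
  case (const r)
  show ?case using smooth_functions.const[of 0] by (intro bexI[of _ "\<lambda>_. 0"]) auto
next
  case ident
  show ?case using smooth_functions.const[of 1] by (intro bexI[of _ "\<lambda>_. 1"]) auto
next
  case (add f g)
  then obtain f' g' where f': "f' \<in> smooth_functions" "\<And>t. (f has_real_derivative f' t) (at t)"
    and g': "g' \<in> smooth_functions" "\<And>t. (g has_real_derivative g' t) (at t)" by blast
  then have "(\<lambda>t. f' t + g' t) \<in> smooth_functions" by (intro smooth_functions.add)
  moreover have "((\<lambda>t. f t + g t) has_real_derivative f' t + g' t) (at t)" for t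
    using f'(2) g'(2) by (intro DERIV_add)
  ultimately show ?case by (rule smooth_functions_derivativeI)
next
  case (mult f g)
  then obtain f' g' where f': "f' \<in> smooth_functions" "\<And>t. (f has_real_derivative f' t) (at t)"
    and g': "g' \<in> smooth_functions" "\<And>t. (g has_real_derivative g' t) (at t)" by blast
  then have "(\<lambda>t. f' t * g t + g' t * f t) \<in> smooth_functions"
    using mult by (intro smooth_functions.add smooth_functions.mult)
  moreover have "((\<lambda>t. f t * g t) has_real_derivative f' t * g t + g' t * f t) (at t)" for t
    using f'(2) g'(2) by (intro DERIV_mult)
  ultimately show ?case by (rule smooth_functions_derivativeI)
next
  case (inverse f)
  then obtain f' where f': "f' \<in> smooth_functions" "\<And>t. (f has_real_derivative f' t) (at t)" by blast
  then have "(\<lambda>t. (- 1) * (inverse (f t) * f' t * inverse (f t))) \<in> smooth_functions"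
    using inverse smooth_functions.inverse[of f]
    by (intro smooth_functions_scale smooth_functions.mult) auto
  moreover have "((\<lambda>t. inverse (f t)) has_real_derivative (- 1) * (inverse (f t) * f' t * inverse (f t))) (at t)" for t
    using DERIV_inverse'[OF f'(2)[of t] inverse(2)[of t]] by simp
  ultimately show ?case by (rule smooth_functions_derivativeI)
next
  case (sin f)
  then obtain f' where f': "f' \<in> smooth_functions" "\<And>t. (f has_real_derivative f' t) (at t)" by blast
  then have "(\<lambda>t. cos (f t) * f' t) \<in> smooth_functions"
    using sin by (intro smooth_functions.mult smooth_functions.cos)
  moreover have "((\<lambda>t. sin (f t)) has_real_derivative cos (f t) * f' t) (at t)" for t
    by (rule DERIV_chain2[OF DERIV_sin f'(2)])
  ultimately show ?case by (rule smooth_functions_derivativeI)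
next
  case (cos f)
  then obtain f' where f': "f' \<in> smooth_functions" "\<And>t. (f has_real_derivative f' t) (at t)" by blast
  then have "(\<lambda>t. ((- 1) * sin (f t)) * f' t) \<in> smooth_functions"
    using cos by (intro smooth_functions.mult smooth_functions_scale smooth_functions.sin)
  moreover have "((\<lambda>t. cos (f t)) has_real_derivative ((- 1) * sin (f t)) * f' t) (at t)" for t
    using DERIV_chain2[OF DERIV_cos f'(2)[of t]] by simp
  ultimately show ?case by (rule smooth_functions_derivativeI)
next
  case (flat_exp f n)
  then obtain f' where f': "f' \<in> smooth_functions" "\<And>t. (f has_real_derivative f' t) (at t)" by blast
  then have "(\<lambda>t. (flat_exp (n + 2) (f t) - real n * flat_exp (n + 1) (f t)) * f' t) \<in> smooth_functions"
    using flat_exp by (intro smooth_functions.mult smooth_functions_diff smooth_functions_scale smooth_functions.flat_exp)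
  moreover have "((\<lambda>t. flat_exp n (f t)) has_real_derivative
      (flat_exp (n + 2) (f t) - real n * flat_exp (n + 1) (f t)) * f' t) (at t)" for t
    by (rule DERIV_chain2[OF flat_exp_has_derivative f'(2)])
  ultimately show ?case by (rule smooth_functions_derivativeI)
qed

lemma smooth_functions_isCont: "f \<in> smooth_functions \<Longrightarrow> isCont f t"
  using smooth_functions_derivative DERIV_isCont by blast

lemma smooth_functions_smooth_on_halfline:
  assumes "f \<in> smooth_functions"
  shows "smooth_on_halfline f"
proof -
  obtain d where d: "\<And>g. g \<in> smooth_functions \<Longrightarrow> d g \<in> smooth_functions"
    "\<And>g t. g \<in> smooth_functions \<Longrightarrow> (g has_real_derivative d g t) (at t)"
    using smooth_functions_derivative by metis
  have "(d ^^ n) f \<in> smooth_functions" for n by (induction n) (simp_all add: assms d(1))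
  then have "((d ^^ n) f has_real_derivative (d ^^ Suc n) f t) (at t within {0..})" for n t
    by (auto intro: has_field_derivative_at_within d(2))
  then show ?thesis unfolding smooth_on_halfline_def by (intro exI[of _ "\<lambda>n. (d ^^ n) f"]) auto
qed

text \<open>The cosine of the scaled distance from the midpoint \<open>m\<close> makes the function
  periodic. Modulo \<open>T\<close>, \<open>inside\<close> is positive at distances below
  \<open>r + \<eta>\<close> and \<open>outside\<close> at distances above \<open>r\<close>, so the
  quotient is 1 near \<open>m\<close>, 0 far from it and smooth in between.\<close>

definition smooth_bump :: "real \<Rightarrow> real \<Rightarrow> real \<Rightarrow> real \<Rightarrow> real \<Rightarrow> real" where
  "smooth_bump T \<eta> a b t =
     (let m = (a + b) / 2; r = (b - a) / 2; \<theta> = (2 * pi / T) * (t - m);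
          inside = flat_exp 0 (cos \<theta> - cos ((2 * pi / T) * (r + \<eta>)));
          outside = flat_exp 0 (cos ((2 * pi / T) * r) - cos \<theta>)
      in inside * inverse (inside + outside))"

lemma smooth_bump_periodic: "T > 0 \<Longrightarrow> smooth_bump T \<eta> a b (t + T) = smooth_bump T \<eta> a b t"
proof -
  assume "T > 0"
  then have "(2 * pi / T) * (t + T - m) = (2 * pi / T) * (t - m) + 2 * pi" for m by (simp add: field_simps)
  then show ?thesis unfolding smooth_bump_def Let_def by (simp only: cos_periodic)
qed

lemma smooth_bump_nonneg: "0 \<le> smooth_bump T \<eta> a b t"
  unfolding smooth_bump_def Let_def by (intro mult_nonneg_nonneg) (auto simp: flat_exp_nonneg)

context
  fixes \<eta> a b T :: real
  assumes \<eta>: "0 < \<eta>" "\<eta> \<le> a" "a < b" "b + \<eta> \<le> T"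
begin

text \<open>The constraints give \<open>r + \<eta> <= T / 2\<close>, where the cosine of the scaled
  distance is still strictly decreasing. The two thresholds therefore overlap, and every real
  \<open>u\<close> passes at least one of them.\<close>

lemma smooth_bump_denominator_pos:
  "0 < flat_exp 0 (u - cos ((2 * pi / T) * ((b - a) / 2 + \<eta>))) + flat_exp 0 (cos ((2 * pi / T) * ((b - a) / 2)) - u)"
proof -
  have T: "T > 0" using \<eta> by linarith
  have "(b - a) / 2 + \<eta> \<le> T / 2" using \<eta> unfolding diff_divide_distrib by linarith
  then have "(2 * pi / T) * ((b - a) / 2 + \<eta>) \<le> (2 * pi / T) * (T / 2)" using T by (intro mult_left_mono) auto
  moreover have "(2 * pi / T) * ((b - a) / 2) < (2 * pi / T) * ((b - a) / 2 + \<eta>)"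
    using \<eta> T by (intro mult_strict_left_mono) auto
  moreover have "0 \<le> (2 * pi / T) * ((b - a) / 2)" using \<eta> T by simp
  ultimately have "cos ((2 * pi / T) * ((b - a) / 2 + \<eta>)) < cos ((2 * pi / T) * ((b - a) / 2))"
    using T by (intro cos_monotone_0_pi) auto
  then have "0 < flat_exp 0 (u - cos ((2 * pi / T) * ((b - a) / 2 + \<eta>))) \<or> 0 < flat_exp 0 (cos ((2 * pi / T) * ((b - a) / 2)) - u)"
    unfolding flat_exp_pos_iff by linarith
  then show ?thesis using flat_exp_nonneg by (metis add_pos_nonneg add_nonneg_pos)
qed

lemma smooth_bump_smooth: "smooth_bump T \<eta> a b \<in> smooth_functions"
  unfolding smooth_bump_def[abs_def] Let_def
  using smooth_bump_denominator_pos
  by (intro smooth_functions.intros smooth_functions_diff less_imp_neq[THEN not_sym])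

lemma smooth_bump_one:
  assumes t: "t \<in> {a<..<b}"
  shows "smooth_bump T \<eta> a b t = 1"
proof -
  have T: "T > 0" using \<eta> by linarith
  have "\<bar>t - (a + b) / 2\<bar> \<le> (b - a) / 2" using t unfolding greaterThanLessThan_iff diff_divide_distrib add_divide_distrib by linarith
  then have "(2 * pi / T) * \<bar>t - (a + b) / 2\<bar> \<le> (2 * pi / T) * ((b - a) / 2)" using T by (intro mult_left_mono) auto
  moreover have "(2 * pi / T) * ((b - a) / 2) \<le> (2 * pi / T) * (T / 2)" using \<eta> T by (intro mult_left_mono) auto
  ultimately have "cos ((2 * pi / T) * ((b - a) / 2)) \<le> cos ((2 * pi / T) * \<bar>t - (a + b) / 2\<bar>)"
    using T by (intro cos_monotone_0_pi_le) auto
  also have "(2 * pi / T) * \<bar>t - (a + b) / 2\<bar> = \<bar>(2 * pi / T) * (t - (a + b) / 2)\<bar>"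
    using T unfolding abs_mult by simp
  finally have "flat_exp 0 (cos ((2 * pi / T) * ((b - a) / 2)) - cos ((2 * pi / T) * (t - (a + b) / 2))) = 0"
    unfolding cos_abs_real by (intro flat_exp_eq_0) (simp only: diff_le_0_iff_le)
  then show ?thesis
    using smooth_bump_denominator_pos[of "cos ((2 * pi / T) * (t - (a + b) / 2))"] unfolding smooth_bump_def Let_def by simp
qed

lemma smooth_bump_zero:
  assumes t: "t \<in> {0..T}" "t \<notin> {a - \<eta><..<b + \<eta>}"
  shows "smooth_bump T \<eta> a b t = 0"
proof -
  have T: "T > 0" using \<eta> by linarith
  define w where "w = 2 * pi / T"
  have w: "w > 0" "w * T = 2 * pi" unfolding w_def using T by auto
  define \<phi> where "\<phi> = w * \<bar>t - (a + b) / 2\<bar>"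
  define \<psi> where "\<psi> = w * ((b - a) / 2 + \<eta>)"
  \<comment> \<open>The distance of \<open>t\<close> from the midpoint lies between
    \<open>(b - a) / 2 + \<eta>\<close> and \<open>T\<close> minus this number. Hence the angle
    \<phi> lies between \<psi> and \<open>2 * pi - \<psi>\<close>, where the cosine is at most
    \<open>cos \<psi>\<close>.\<close>
  have "(b - a) / 2 + \<eta> \<le> \<bar>t - (a + b) / 2\<bar>"
  proof (cases "t \<le> a - \<eta>")
    case False
    then have "b + \<eta> \<le> t" using t(2) by simp
    then show ?thesis unfolding diff_divide_distrib add_divide_distrib by linarith
  qed (unfold diff_divide_distrib add_divide_distrib, linarith)
  then have 1: "\<psi> \<le> \<phi>" unfolding \<psi>_def \<phi>_def using w by (intro mult_left_mono) auto
  have "\<bar>t - (a + b) / 2\<bar> \<le> T - ((b - a) / 2 + \<eta>)" using t(1) \<eta> unfolding atLeastAtMost_iff diff_divide_distrib add_divide_distrib by linarith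
  then have "\<phi> \<le> w * (T - ((b - a) / 2 + \<eta>))" unfolding \<phi>_def using w by (intro mult_left_mono) auto
  then have 2: "\<phi> \<le> 2 * pi - \<psi>" unfolding \<psi>_def right_diff_distrib w(2) .
  have 3: "0 \<le> \<psi>" unfolding \<psi>_def using w \<eta> by simp
  have "cos \<phi> \<le> cos \<psi>"
  proof (cases "\<phi> \<le> pi")
    case True
    then show ?thesis using 1 3 by (intro cos_monotone_0_pi_le) auto
  next
    case False
    have "cos \<phi> = cos (2 * pi - \<phi>)" by simp
    also have "\<dots> \<le> cos \<psi>" using False 2 3 by (intro cos_monotone_0_pi_le) auto
    finally show ?thesis .
  qed
  moreover have "\<phi> = \<bar>w * (t - (a + b) / 2)\<bar>" unfolding \<phi>_def using w by (simp add: abs_mult)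
  ultimately have "flat_exp 0 (cos (w * (t - (a + b) / 2)) - cos \<psi>) = 0" by (intro flat_exp_eq_0) simp
  then show ?thesis unfolding smooth_bump_def Let_def \<psi>_def w_def by simp
qed

end

section \<open>Decay of all solutions\<close>

text \<open>Linearity, idempotence and mutual orthogonality each say that some vector has the
  characterizing property of the projection, so uniqueness of the projection yields them.\<close>

lemma orthogonal_projectionsI:
  fixes E :: "nat \<Rightarrow> 'a::{real_inner,complete_space} set"
  assumes E: "\<And>k. subspace (E k)" and orth: "\<And>j k x y. j \<noteq> k \<Longrightarrow> x \<in> E j \<Longrightarrow> y \<in> E k \<Longrightarrow> x \<bullet> y = 0"
    and P: "\<And>k x. P k x \<in> E k" "\<And>k x s. s \<in> E k \<Longrightarrow> (x - P k x) \<bullet> s = 0"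
  shows "orthogonal_projections P"
proof -
  have unique: "P k x = p" if p: "p \<in> E k" "\<And>s. s \<in> E k \<Longrightarrow> (x - p) \<bullet> s = 0" for k x p
  proof -
    have "P k x - p \<in> E k" using P(1) p(1) E by (simp add: subspace_diff)
    then have "(x - p) \<bullet> (P k x - p) = 0" "(x - P k x) \<bullet> (P k x - p) = 0" using p(2) P(2) by auto
    then have "(P k x - p) \<bullet> (P k x - p) = 0" by (simp add: inner_diff_left)
    then show ?thesis by simp
  qed
  have linear: "linear (P k)" for k
  proof (rule linearI)
    show "P k (x + y) = P k x + P k y" for x y
      using P(2)[of _ k x] P(2)[of _ k y]
      by (intro unique subspace_add E P(1)) (auto simp: inner_add_left inner_diff_left)
    show "P k (r *\<^sub>R x) = r *\<^sub>R P k x" for r x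
      using P(2)[of _ k x]
      by (intro unique subspace_scale E P(1)) (auto simp: inner_diff_left)
  qed
  have sym: "P k x \<bullet> y = x \<bullet> P k y" for k x y
    using P(2)[OF P(1)[of k y], of x] P(2)[OF P(1)[of k x], of y]
    by (simp add: inner_diff_left inner_commute[of y] inner_commute[of "P k y" "P k x"])
  have idem: "P k (P k x) = P k x" for k x using P(1) by (intro unique) auto
  have "P j (P k x) = 0" if "j \<noteq> k" for j k x
    using orth[OF that] P(1) by (intro unique subspace_0 E) (auto simp: inner_commute)
  with linear sym idem show ?thesis by (rule orthogonal_projections.intro)
qed

context complete_projections
begin

text \<open>The decay factor does not depend on \<open>k\<close>, so the estimates for single
  frequencies add up to one for the total energy.\<close>

lemma energy_decay:
  assumes a: "\<And>k. a k > 0" and T: "T > 0" and R: "R > 0"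
    and nonneg: "\<And>t. t \<ge> 0 \<Longrightarrow> \<delta> t \<ge> 0" and per: "\<And>t. t \<ge> 0 \<Longrightarrow> \<delta> (t + T) = \<delta> t"
    and \<delta>: "\<And>X. X > 0 \<Longrightarrow> \<exists>S. finite S \<and> (\<forall>t\<in>{0<..<X} - S. isCont \<delta> t)"
    and contract: "\<And>k x y c. damped_mode (a k) \<delta> x y c \<Longrightarrow> x T + y T \<le> exp (- R * T) * (x 0 + y 0)"
    and sol: "weak_solution (diag (\<lambda>k. (a k)\<^sup>2)) \<delta> u u'" and t: "t \<ge> 0"
  shows "energy (diag (\<lambda>k. (a k)\<^sup>2)) u u' t
    \<le> energy (diag (\<lambda>k. (a k)\<^sup>2)) u u' 0 * exp (- R * max (t - T) 0)"
proof (rule sums_le)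
  show "(\<lambda>k. (norm (a k *\<^sub>R P k (u t)))\<^sup>2 + (norm (P k (u' t)))\<^sup>2) sums energy (diag (\<lambda>k. (a k)\<^sup>2)) u u' t"
    by (rule energy_sums[OF sol a t])
  show "(\<lambda>k. ((norm (a k *\<^sub>R P k (u 0)))\<^sup>2 + (norm (P k (u' 0)))\<^sup>2) * exp (- R * max (t - T) 0)) sums
      (energy (diag (\<lambda>k. (a k)\<^sup>2)) u u' 0 * exp (- R * max (t - T) 0))"
    by (intro sums_mult2 energy_sums[OF sol a]) simp
  show "(norm (a k *\<^sub>R P k (u t)))\<^sup>2 + (norm (P k (u' t)))\<^sup>2
      \<le> ((norm (a k *\<^sub>R P k (u 0)))\<^sup>2 + (norm (P k (u' 0)))\<^sup>2) * exp (- R * max (t - T) 0)" for k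
    using periodic_contraction_imp_decay[OF weak_solution_damped_mode[OF sol a \<delta>] a nonneg per T R contract t, of k]
    by simp
qed

end

lemma selfadjoint_discrete_spectrum_diag:
  fixes A :: "'a::{real_inner,complete_space} \<rightharpoonup> 'a" and l :: "nat \<Rightarrow> real"
  assumes A: "selfadjoint_operator A" "nonneg_operator A"
    and l: "\<And>k. l k > 0" and mono: "strict_mono (\<lambda>k. (l k)\<^sup>2)" and spec: "spectrum A = range (\<lambda>k. (l k)\<^sup>2)"
  shows "\<exists>P. complete_projections P \<and> A = complete_projections.diag P (\<lambda>k. (l k)\<^sup>2)"
proof -
  interpret A: selfadjoint_op A using A(1) by unfold_locales
  define a where "a k = (l k)\<^sup>2" for k
  have a: "strict_mono a" "spectrum A = range a" using mono spec unfolding a_def[abs_def] by auto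
  have a_pos: "a k > 0" for k unfolding a_def using l[of k] by simp
  define E where "E k = A.eigenspace (a k)" for k
  have "\<forall>k x. \<exists>p\<in>E k. \<forall>s\<in>E k. (x - p) \<bullet> s = 0"
    unfolding E_def using exists_orthogonal_projection A.eigenspace_subspace A.eigenspace_closed by blast
  then obtain P where P: "\<And>k x. P k x \<in> E k" "\<And>k x s. s \<in> E k \<Longrightarrow> (x - P k x) \<bullet> s = 0" by metis
  interpret orthogonal_projections P
  proof (rule orthogonal_projectionsI[OF _ _ P])
    show "subspace (E k)" for k unfolding E_def by (rule A.eigenspace_subspace)
    show "x \<bullet> y = 0" if "j \<noteq> k" "x \<in> E j" "y \<in> E k" for j k x y
      using that a(1) A.eigenspace_orthogonal[of x "a j" y "a k"] unfolding E_def by (simp add: strict_mono_eq)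
  qed auto
  interpret complete_projections P
  proof
    fix x assume x: "\<And>k. P k x = 0"
    show "x = 0"
    proof (rule A.eigenvectors_complete[OF A(2)])
      show "0 \<in> resolvent_set A" using a(2) a_pos unfolding spectrum_def by (metis ComplI less_irrefl rangeE)
      fix \<mu> assume "\<mu> \<in> spectrum A"
      then obtain k where k: "\<mu> = a k" using a(2) by blast
      \<comment> \<open>The distance to the neighbouring eigenvalues; the lowest one has only an
        upper neighbour, for which 1 is an arbitrary substitute.\<close>
      define \<epsilon> where "\<epsilon> = min (a (Suc k) - a k) (if k = 0 then 1 else a k - a (k - 1))"
      have "\<epsilon> > 0" unfolding \<epsilon>_def using a(1) by (auto simp: strict_mono_def)
      moreover have "z \<in> resolvent_set A" if z: "z \<in> {\<mu> - \<epsilon><..<\<mu> + \<epsilon>} - {\<mu>}" for z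
      proof (rule ccontr)
        assume "z \<notin> resolvent_set A"
        then obtain j where j: "z = a j" using a(2) unfolding spectrum_def by blast
        then have "j \<noteq> k" using z k by blast
        then consider "j < k" | "Suc k \<le> j" by linarith
        then show False
        proof cases
          case 1
          then have "a j \<le> a (k - 1)" using a(1) by (simp add: strict_mono_less_eq)
          then show False using z k j 1 unfolding \<epsilon>_def by auto
        next
          case 2
          then have "a (Suc k) \<le> a j" using a(1) by (simp add: strict_mono_less_eq)
          then show False using z k j unfolding \<epsilon>_def by auto
        qed
      qed
      ultimately show "\<exists>\<epsilon>>0. {\<mu> - \<epsilon><..<\<mu> + \<epsilon>} - {\<mu>} \<subseteq> resolvent_set A" by blast
      show "x \<bullet> e = 0" if "e \<in> A.eigenspace \<mu>" for e
        using P(2)[of e k x] x that unfolding E_def k by simp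
    qed
  qed
  have "A (P k w) = Some (a k *\<^sub>R P k w)" for k w using P(1)[of k w] unfolding E_def A.eigenspace_iff .
  then have "A = diag a" by (intro selfadjoint_eq_diag[OF A(1)])
  then show ?thesis using complete_projections_axioms unfolding a_def[abs_def] by blast
qed

theorem theorem2p5:
  fixes A :: "'a::{real_inner, complete_space} \<rightharpoonup> 'a"
    and lam :: "nat \<Rightarrow> real"
    and R t0 :: real
  assumes "selfadjoint_operator A"
    and "nonneg_operator A"
    and "\<And>k. k \<ge> 1 \<Longrightarrow> lam k > 0"
    and "strict_mono_on {1..} (\<lambda>k. (lam k)\<^sup>2)"
    and "\<not> bdd_above ((\<lambda>k. (lam k)\<^sup>2) ` {1..})"
    and "spectrum A = (\<lambda>k. (lam k)\<^sup>2) ` {1..}"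
    and "R > 0"
    and "t0 = pi * (\<Sum>k | k \<ge> 1 \<and> (lam k)\<^sup>2 \<le> 2 * (R + lam 1)\<^sup>2. 1 / lam k)"
  shows "(\<exists>\<delta>. smooth_on_halfline \<delta> \<and> (\<forall>t\<ge>0. \<delta> t \<ge> 0) \<and> periodic_on_halfline t0 \<delta> \<and>
            (\<forall>u u'. weak_solution A \<delta> u u' \<longrightarrow>
               (\<forall>t\<ge>0. energy A u u' t \<le> energy A u u' 0 * exp (- R * max (t - t0) 0)))) \<and>
         (\<exists>\<delta>. piecewise_constant_on_halfline \<delta> \<and> (\<forall>t\<ge>0. \<delta> t \<ge> 0) \<and> periodic_on_halfline t0 \<delta> \<and>
            (\<forall>u u'. weak_solution A \<delta> u u' \<longrightarrow>
               (\<forall>t\<ge>0. energy A u u' t \<le> energy A u u' 0 * exp (- R * max (t - t0) 0))))"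
proof -
  define l where "l k = lam (Suc k)" for k
  define D where "D = R + l 0"
  have range: "(\<lambda>k. (lam k)\<^sup>2) ` {1..} = range (\<lambda>k. (l k)\<^sup>2)"
    unfolding l_def by (force simp: image_iff Suc_le_eq gr0_conv_Suc)
  have l: "l k > 0" for k unfolding l_def using assms(3) by simp
  have mono: "strict_mono (\<lambda>k. (l k)\<^sup>2)"
    using assms(4) unfolding l_def strict_mono_def strict_mono_on_def by simp
  have D: "D > 0" "l 0 \<le> D" unfolding D_def using assms(7) l[of 0] by auto
  obtain P where P: "complete_projections P" and A: "A = complete_projections.diag P (\<lambda>k. (l k)\<^sup>2)"
    using selfadjoint_discrete_spectrum_diag[OF assms(1,2) l mono] assms(6) range by auto
  interpret complete_projections P by (rule P)
  have "\<exists>k. 2 * D\<^sup>2 < (l k)\<^sup>2"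
    using assms(5) unfolding range by (auto simp: bdd_above_def not_le)
  \<comment> \<open>By monotonicity \<open>n\<close> is the number of low frequencies, that is, of
    terms in the sum defining \<open>t0\<close>; it exists because the spectrum is
    unbounded.\<close>
  define n where "n = (LEAST k. 2 * D\<^sup>2 < (l k)\<^sup>2)"
  have high: "2 * D\<^sup>2 < (l k)\<^sup>2" if "k \<ge> n" for k
  proof -
    have "2 * D\<^sup>2 < (l n)\<^sup>2" unfolding n_def using \<open>\<exists>k. 2 * D\<^sup>2 < (l k)\<^sup>2\<close> by (rule LeastI_ex)
    also have "\<dots> \<le> (l k)\<^sup>2" using strict_mono_less_eq[OF mono] that by simp
    finally show ?thesis .
  qed
  have low: "(l k)\<^sup>2 \<le> 2 * D\<^sup>2" if "k < n" for k
    using not_less_Least[of k "\<lambda>k. 2 * D\<^sup>2 < (l k)\<^sup>2"] that unfolding n_def by simp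
  have "(l 0)\<^sup>2 \<le> D\<^sup>2" using l[of 0] D by (intro power_mono) auto
  also have "\<dots> \<le> 2 * D\<^sup>2" by simp
  finally have n: "n > 0" using high[of 0] by (auto intro: gr0I)
  have "{k. k \<ge> 1 \<and> (lam k)\<^sup>2 \<le> 2 * (R + lam 1)\<^sup>2} = Suc ` {..<n}"
  proof -
    have "(l k)\<^sup>2 \<le> 2 * D\<^sup>2 \<longleftrightarrow> k < n" for k using low[of k] high[of k] by (cases "k < n") auto
    then have "k \<ge> 1 \<and> (lam k)\<^sup>2 \<le> 2 * (R + lam 1)\<^sup>2 \<longleftrightarrow> k \<in> Suc ` {..<n}" for k
      unfolding D_def l_def by (cases k) auto
    then show ?thesis by blast
  qed
  then have t0: "t0 = pi * (\<Sum>k<n. 1 / l k)"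
    unfolding assms(8) l_def by (simp add: sum.reindex)
  have "0 < (\<Sum>k<n. 1 / l k)" using n l by (intro sum_pos) auto
  then have T: "t0 > 0" unfolding t0 by simp
  have low': "l k \<le> 2 * (R + l 0)" if "k < n" for k
  proof (rule power2_le_imp_le)
    have "(l k)\<^sup>2 \<le> 2 * D\<^sup>2" by (rule low[OF that])
    also have "\<dots> \<le> (2 * D)\<^sup>2" by (simp add: power_mult_distrib)
    finally show "(l k)\<^sup>2 \<le> (2 * (R + l 0))\<^sup>2" unfolding D_def .
  qed (use D in \<open>simp add: D_def\<close>)
  have high': "7 * (R + l 0) \<le> 5 * l k" if "k \<ge> n" for k
  proof (rule power2_le_imp_le)
    \<comment> \<open>The fraction 7/5 is a rational lower bound of \<open>sqrt 2\<close>, since 49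
      <= 50.\<close>
    have "(7 * D)\<^sup>2 \<le> 25 * (2 * D\<^sup>2)" by (simp add: power_mult_distrib)
    also have "\<dots> \<le> 25 * (l k)\<^sup>2" using high[OF that] by simp
    finally show "(7 * (R + l 0))\<^sup>2 \<le> (5 * l k)\<^sup>2" unfolding D_def by (simp add: power_mult_distrib)
  qed (use l[of k] in simp)
  note contracting = exists_contracting_damping[OF l assms(7) n t0 low' high']
  have decay: "\<forall>u u'. weak_solution A \<delta> u u' \<longrightarrow>
      (\<forall>t\<ge>0. energy A u u' t \<le> energy A u u' 0 * exp (- R * max (t - t0) 0))"
    if nonneg: "\<forall>t\<ge>0. 0 \<le> \<delta> t" and per: "\<And>t. \<delta> (t + t0) = \<delta> t"
      and cont: "\<And>X. \<exists>S. finite S \<and> (\<forall>t\<in>{0<..<X} - S. isCont \<delta> t)"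
      and contract: "\<forall>k x y c. damped_mode (l k) \<delta> x y c \<longrightarrow> x t0 + y t0 \<le> exp (- R * t0) * (x 0 + y 0)" for \<delta>
    unfolding A
  proof (intro allI impI)
    fix u u' t assume sol: "weak_solution (diag (\<lambda>k. (l k)\<^sup>2)) \<delta> u u'" and t: "(t :: real) \<ge> 0"
    show "energy (diag (\<lambda>k. (l k)\<^sup>2)) u u' t
        \<le> energy (diag (\<lambda>k. (l k)\<^sup>2)) u u' 0 * exp (- R * max (t - t0) 0)"
    proof (rule energy_decay[OF l T assms(7) _ _ _ _ sol t])
      show "0 \<le> \<delta> s" if "s \<ge> 0" for s using nonneg that by blast
      show "x t0 + y t0 \<le> exp (- R * t0) * (x 0 + y 0)" if "damped_mode (l k) \<delta> x y c" for k x y c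
        using contract that by blast
    qed (rule per cont)+
  qed
  \<comment> \<open>Periodicity is stable under the sums and multiples of the construction, so it is
    carried through \<open>Q\<close> together with the regularity.\<close>
  define Q1 where "Q1 f \<longleftrightarrow> f \<in> smooth_functions \<and> (\<forall>t. f (t + t0) = f t)" for f
  have "\<exists>\<delta>. Q1 \<delta> \<and> (\<forall>t\<ge>0. 0 \<le> \<delta> t) \<and>
      (\<forall>k x y c. damped_mode (l k) \<delta> x y c \<longrightarrow> x t0 + y t0 \<le> exp (- R * t0) * (x 0 + y 0))"
  proof (rule contracting[where bump = "smooth_bump t0"])
    show "Q1 (smooth_bump t0 \<eta> a b)" if "0 < \<eta>" "\<eta> \<le> a" "a < b" "b + \<eta> \<le> t0" for \<eta> a b
      unfolding Q1_def using smooth_bump_smooth[OF that] smooth_bump_periodic[OF T] by blast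
  qed (auto simp: Q1_def smooth_bump_nonneg smooth_bump_one smooth_bump_zero
      intro: smooth_functions_scale smooth_functions.add)
  then obtain \<delta>1 where \<delta>1: "\<delta>1 \<in> smooth_functions" "\<And>t. \<delta>1 (t + t0) = \<delta>1 t" "\<forall>t\<ge>0. 0 \<le> \<delta>1 t"
    "\<forall>k x y c. damped_mode (l k) \<delta>1 x y c \<longrightarrow> x t0 + y t0 \<le> exp (- R * t0) * (x 0 + y 0)"
    unfolding Q1_def by blast
  define Q2 where "Q2 f \<longleftrightarrow> step_function f \<and> (\<forall>t. f (t + t0) = f t) \<and>
    (\<forall>X. \<exists>S. finite S \<and> (\<forall>t\<in>{0<..<X} - S. isCont f t))" for f
  have "\<exists>\<delta>. Q2 \<delta> \<and> (\<forall>t\<ge>0. 0 \<le> \<delta> t) \<and>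
      (\<forall>k x y c. damped_mode (l k) \<delta> x y c \<longrightarrow> x t0 + y t0 \<le> exp (- R * t0) * (x 0 + y 0))"
  \<comment> \<open>A step bump jumps and has no ramps, so the ramp width is ignored.\<close>
  proof (rule contracting[where bump = "\<lambda>_. step_bump t0"])
    show "Q2 (step_bump t0 a b)" for a b
      unfolding Q2_def
      by (intro conjI allI step_function_bump[OF T] step_bump_periodic[OF T] step_bump_discontinuities[OF T])
    show "Q2 (\<lambda>t. r * f t)" if "Q2 f" for f r
      unfolding Q2_def
    proof (intro conjI allI)
      show "step_function (\<lambda>t. r * f t)" using that unfolding Q2_def by (intro step_function_scale) auto
      show "r * f (t + t0) = r * f t" for t using that unfolding Q2_def by simp
      fix X
      obtain S where "finite S" "\<forall>t\<in>{0<..<X} - S. isCont f t" using \<open>Q2 f\<close> unfolding Q2_def by blast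
      then show "\<exists>S. finite S \<and> (\<forall>t\<in>{0<..<X} - S. isCont (\<lambda>t. r * f t) t)"
        by (intro exI[of _ S]) (auto intro: isCont_mult)
    qed
    show "Q2 (\<lambda>t. f t + g t)" if f: "Q2 f" and g: "Q2 g" for f g
      unfolding Q2_def
    proof (intro conjI allI)
      show "step_function (\<lambda>t. f t + g t)" using f g unfolding Q2_def by (intro step_function_add) auto
      show "f (t + t0) + g (t + t0) = f t + g t" for t using f g unfolding Q2_def by simp
      fix X
      obtain S where S: "finite S" "\<forall>t\<in>{0<..<X} - S. isCont f t" using f unfolding Q2_def by blast
      obtain S' where S': "finite S'" "\<forall>t\<in>{0<..<X} - S'. isCont g t" using g unfolding Q2_def by blast
      show "\<exists>S. finite S \<and> (\<forall>t\<in>{0<..<X} - S. isCont (\<lambda>t. f t + g t) t)"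
        using S S' by (intro exI[of _ "S \<union> S'"]) (auto intro: isCont_add)
    qed
  qed (auto simp: step_bump_nonneg T step_bump_values)
  then obtain \<delta>2 where \<delta>2: "step_function \<delta>2" "\<And>t. \<delta>2 (t + t0) = \<delta>2 t" "\<forall>t\<ge>0. 0 \<le> \<delta>2 t"
    "\<And>X. \<exists>S. finite S \<and> (\<forall>t\<in>{0<..<X} - S. isCont \<delta>2 t)"
    "\<forall>k x y c. damped_mode (l k) \<delta>2 x y c \<longrightarrow> x t0 + y t0 \<le> exp (- R * t0) * (x 0 + y 0)"
    unfolding Q2_def by blast
  have "\<exists>S. finite S \<and> (\<forall>t\<in>{0<..<X} - S. isCont \<delta>1 t)" for X
    using smooth_functions_isCont[OF \<delta>1(1)] by blast
  then have "\<forall>u u'. weak_solution A \<delta>1 u u' \<longrightarrow>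
      (\<forall>t\<ge>0. energy A u u' t \<le> energy A u u' 0 * exp (- R * max (t - t0) 0))"
    using \<delta>1 by (intro decay) auto
  moreover have "\<forall>u u'. weak_solution A \<delta>2 u u' \<longrightarrow>
      (\<forall>t\<ge>0. energy A u u' t \<le> energy A u u' 0 * exp (- R * max (t - t0) 0))"
    using \<delta>2 by (intro decay) auto
  ultimately show ?thesis
    using smooth_functions_smooth_on_halfline[OF \<delta>1(1)] step_function_piecewise_constant[OF \<delta>2(1)] \<delta>1(2,3) \<delta>2(2,3)
    unfolding periodic_on_halfline_def by blast
qed

end
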